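(* Let $\{x_k^\delta\}_{k\ge0}$ be the (r)SVRG iterates defined in the context, let $e_k^\delta=x_k^\delta-x_\dag$, and assume: the step size is a constant $c_0>0$ (independent of $\delta$) with $c_0\le L^{-1}$, $L=\max_{1\le i\le n}\|A_i\|^2$; there exist $\nu>0$ and $w\in\mathcal N(A_\dag)^\perp$ with $x_\dag-x_0=B_\dag^\nu w$, where $B_\dag=n^{-1}A_\dag^*A_\dag$; and $A$ is obtained from $A_\dag$ by the truncation rule in the context with constant $a\ge0$ and exponent $b=(1+2\nu)^{-1}$. In the estimates in expectation assume $c_0<\overline{C_0}$, and in the estimates without expectation (which hold for every realization of the random indices) assume $c_0<C_0$. All constants hidden in $\mathcal O(\delta^{\frac{2\nu}{1+2\nu}})$ below are independent of $\delta$ and $k$. (i) If $a>0$ (rSVRG), then for any small $\epsilon>0$, $$\mathbb E[\|e_k^\delta\|^2]^{\frac12}\le\mathcal O(\delta^{\frac{2\nu}{1+2\nu}})\quad\forall k\ge k(\delta):=\delta^{-\frac{2\nu}{(1+2\nu)\min(\nu,\frac12)}},$$ $$\|e_k^\delta\|\le\mathcal O(\delta^{\frac{2\nu}{1+2\nu}})\quad\forall k\ge k(\delta):=\delta^{-\frac{2\nu}{(1+2\nu)\min(\nu,\frac12-\epsilon)}}.$$ (ii) If $a=0$ (SVRG), let $k(\delta)\in\mathbb N$ be any choice of stopping index for which there exist constants $0<C_1<C_2$ and $\delta_0>0$ such that $C_1\delta^{-\frac{2}{1+2\nu}}\le k(\delta)\le C_2\delta^{-\frac{2}{1+2\nu}}$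 for all $\delta\in(0,\delta_0]$. Then $$\mathbb E[\|e_{k(\delta)}^\delta\|^2]^{\frac12}\le\mathcal O(\delta^{\frac{2\nu}{1+2\nu}})\quad\text{if }\nu\in(0,\tfrac12],$$ $$\|e_{k(\delta)}^\delta\|\le\mathcal O(\delta^{\frac{2\nu}{1+2\nu}})\quad\text{if }\nu\in(0,\tfrac12).$$
   Context: Setting. $X,Y_1,\dots,Y_n$ are Hilbert spaces and $Y=Y_1\times\cdots\times Y_n$ with $\|y\|^2=\sum_{i=1}^n\|y_i\|^2$. $A_\dag=(A_{\dag,1},\dots,A_{\dag,n})^T:X\to Y$ with each $A_{\dag,i}:X\to Y_i$ bounded linear. $\mathcal N(A_\dag)$ is the null space of $A_\dag$. $x_0\in X$ is an initial guess, $y_\dag\in Y$ is exact data in the range of $A_\dag$, and $x_\dag=\arg\min\{\|x-x_0\|: x\in X,\ A_\dag x=y_\dag\}$. The noisy data is $y^\delta=y_\dag+\xi$ with $\xi\in Y$ and noise level $\delta=\|\xi\|<1$. Truncation rule (constants $a\ge0$, $b>0$). If $a=0$, then $A=A_\dag$. If $a>0$, then $A_\dag$ is compact with singular value decomposition $A_\dag(\cdot)=\sum_{j=1}^\infty\sigma_j\langle\varphi_j,\cdot\rangle\psi_j$, where $\{\sigma_j\}\subset[0,\infty)$, $\sigma_j\ge\sigma_{j'}\ge a\delta^b>0$ for all $j\le j'\le J$, and $\sigma_j<a\delta^b$ for all $j>J$; and $A(\cdot)=\sum_{j=1}^J\sigma_j\langle\varphi_j,\cdot\rangle\psi_j$.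 Write $A=(A_1,\dots,A_n)^T$ with $A_i:X\to Y_i$. (r)SVRG with constant step size $c_0$ and frequency $M\in\mathbb N$, $M\ge1$: $x_0^\delta=x_0$, and for $K=0,1,\dots$ and $t=0,\dots,M-1$, $$x_{KM+t+1}^\delta=x_{KM+t}^\delta-c_0\Big(A_{i_{KM+t}}^*A_{i_{KM+t}}(x_{KM+t}^\delta-x_{KM}^\delta)+g_K\Big),\qquad g_K=\tfrac1nA^*(Ax_{KM}^\delta-y^\delta),$$ where the indices $i_k$ are drawn i.i.d. uniformly from $\{1,\dots,n\}$. The case $a=0$ is called SVRG and the case $a>0$ rSVRG. $\mathbb E$ is the expectation over the random indices. Constants: $$\overline{C_0}=\max\Big(3^{-1}\|A\|^{-1}(5Ln^{-1}M)^{-\frac12},\ 9^{-1}L^{-1}(15+7\ln M)^{-1}\Big),$$ $$C_0=\Big(14^2\sqrt L\,M\|A\|\ln\big(2e^2n\sqrt L\|A\|^{-1}\big)\Big)^{-1}.$$ *)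

theory Defs
  imports "HOL-Analysis.Analysis" "HOL-Computational_Algebra.Polynomial"
    "HOL-Probability.Probability"
begin

(* Hilbert spaces are (real) types of sort {real_inner, banach}.  The spaces Y_1, ..., Y_n are
   closed subspaces of one Hilbert space 'y, indexed by a finite type 'n with n = CARD('n); any
   finite family of Hilbert spaces arises in this way, inside its direct sum.  The product
   Y = Y_1 x ... x Y_n is the corresponding subspace of 'y^'n, whose norm is the Euclidean one.
   Norms of bounded linear functions are operator norms. *)

definition hilbert_prod :: "('n::finite \<Rightarrow> 'y::{real_inner,banach} set) \<Rightarrow> ('y^'n) set" where
  "hilbert_prod Ys = {y. \<forall>i. y $ i \<in> Ys i}"

(* The adjoint of a bounded operator between Hilbert spaces exists and is bounded, so neither the
   choice in adjoint nor the conversion Blinfun is a dummy value. *)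
definition blinfun_adj ::
  "('x::{real_inner,banach} \<Rightarrow>\<^sub>L 'y::{real_inner,banach}) \<Rightarrow> ('y \<Rightarrow>\<^sub>L 'x)" where
  "blinfun_adj A = Blinfun (adjoint (blinfun_apply A))"

definition blinfun_row ::
  "('x::{real_inner,banach} \<Rightarrow>\<^sub>L (('y::{real_inner,banach})^('n::finite))) \<Rightarrow> 'n \<Rightarrow> ('x \<Rightarrow>\<^sub>L 'y)" where
  "blinfun_row A i = Blinfun (\<lambda>x. blinfun_apply A x $ i)"

definition normal_op ::
  "('x::{real_inner,banach} \<Rightarrow>\<^sub>L (('y::{real_inner,banach})^('n::finite))) \<Rightarrow> ('x \<Rightarrow>\<^sub>L 'x)" where
  "normal_op A = inverse (real CARD('n)) *\<^sub>R (blinfun_adj A o\<^sub>L A)"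

definition null_space :: "('x::{real_inner,banach} \<Rightarrow>\<^sub>L 'y::{real_inner,banach}) \<Rightarrow> 'x set" where
  "null_space A = {x. blinfun_apply A x = 0}"

definition blinfun_poly :: "real poly \<Rightarrow> ('x::{real_inner,banach} \<Rightarrow>\<^sub>L 'x) \<Rightarrow> ('x \<Rightarrow>\<^sub>L 'x)" where
  "blinfun_poly p B = (\<Sum>i\<le>degree p. coeff p i *\<^sub>R (((o\<^sub>L) B ^^ i) id_blinfun))"

(* Fractional power B^s (s > 0) of a bounded positive self-adjoint operator by the continuous
   functional calculus: the spectrum of B lies in {0..norm B}, and B^s is the limit in operator norm
   of p_m(B) for every sequence of polynomials p_m converging uniformly there to t^s.  Note that
   0 powr s = 0. *)
definition blinfun_powr :: "('x::{real_inner,banach} \<Rightarrow>\<^sub>L 'x) \<Rightarrow> real \<Rightarrow> ('x \<Rightarrow>\<^sub>L 'x)" where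
  "blinfun_powr B s = (THE T. \<forall>p :: nat \<Rightarrow> real poly.
     uniform_limit {0..norm B} (\<lambda>m. poly (p m)) (\<lambda>t. t powr s) sequentially
       \<longrightarrow> (\<lambda>m. blinfun_poly (p m) B) \<longlonglongrightarrow> T)"

definition compact_blinfun ::
  "('x::{real_inner,banach} \<Rightarrow>\<^sub>L 'y::{real_inner,banach}) \<Rightarrow> bool" where
  "compact_blinfun A \<longleftrightarrow> compact (closure (blinfun_apply A ` cball 0 1))"

definition orthonormal_on :: "'j set \<Rightarrow> ('j \<Rightarrow> 'x::real_inner) \<Rightarrow> bool" where
  "orthonormal_on S f \<longleftrightarrow> (\<forall>j\<in>S. \<forall>k\<in>S. f j \<bullet> f k = (if j = k then 1 else 0))"

(* Sequences are indexed from 0.  Orthonormality is only required where the singular value is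
   nonzero, so that operators of finite rank (and finite-dimensional spaces) are covered by padding
   with zero singular values. *)
definition is_svd :: "('x::{real_inner,banach} \<Rightarrow>\<^sub>L 'y::{real_inner,banach}) \<Rightarrow>
    (nat \<Rightarrow> real) \<Rightarrow> (nat \<Rightarrow> 'x) \<Rightarrow> (nat \<Rightarrow> 'y) \<Rightarrow> bool" where
  "is_svd A \<sigma> \<phi> \<psi> \<longleftrightarrow>
     (\<forall>j. 0 \<le> \<sigma> j) \<and>
     orthonormal_on {j. \<sigma> j \<noteq> 0} \<phi> \<and> orthonormal_on {j. \<sigma> j \<noteq> 0} \<psi> \<and>
     (\<forall>x. (\<lambda>j. (\<sigma> j * (\<phi> j \<bullet> x)) *\<^sub>R \<psi> j) sums blinfun_apply A x)"

(* "A is obtained from Ad by the truncation rule with constants a, b at noise level delta".  With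
   indices from 0, the condition j <= J becomes j < J. *)
definition truncation_rule :: "('x::{real_inner,banach} \<Rightarrow>\<^sub>L 'y::{real_inner,banach}) \<Rightarrow>
    real \<Rightarrow> real \<Rightarrow> real \<Rightarrow> ('x \<Rightarrow>\<^sub>L 'y) \<Rightarrow> bool" where
  "truncation_rule Ad a b \<delta> A \<longleftrightarrow>
     (if a = 0 then A = Ad
      else compact_blinfun Ad \<and>
        (\<exists>\<sigma> \<phi> \<psi> J. is_svd Ad \<sigma> \<phi> \<psi> \<and>
           0 < a * \<delta> powr b \<and>
           (\<forall>j j'. j \<le> j' \<and> j' < J \<longrightarrow> \<sigma> j \<ge> \<sigma> j' \<and> \<sigma> j' \<ge> a * \<delta> powr b) \<and>
           (\<forall>j\<ge>J. \<sigma> j < a * \<delta> powr b) \<and>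
           (\<forall>x. blinfun_apply A x = (\<Sum>j<J. (\<sigma> j * (\<phi> j \<bullet> x)) *\<^sub>R \<psi> j))))"

(* The iterate with index KM+t+1 is the one with index Suc k for k = KM+t, where K = k div M. *)
function svrg :: "('x::{real_inner,banach} \<Rightarrow>\<^sub>L (('y::{real_inner,banach})^('n::finite))) \<Rightarrow> 'y^'n \<Rightarrow>
    real \<Rightarrow> nat \<Rightarrow> 'x \<Rightarrow> (nat \<Rightarrow> 'n) \<Rightarrow> nat \<Rightarrow> 'x" where
  "svrg A y c0 M x0 i 0 = x0"
| "svrg A y c0 M x0 i (Suc k) =
     (let x = svrg A y c0 M x0 i k;
          z = svrg A y c0 M x0 i (k div M * M);
          g = inverse (real CARD('n)) *\<^sub>R blinfun_adj A (blinfun_apply A z - y)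
      in x - c0 *\<^sub>R (blinfun_adj (blinfun_row A (i k)) (blinfun_row A (i k) (x - z)) + g))"
  by pat_completeness auto
termination
  by (relation "Wellfounded.measure (\<lambda>(A, y, c0, M, x0, i, k). k)") (auto simp: le_imp_less_Suc)

definition max_row_sq ::
  "('x::{real_inner,banach} \<Rightarrow>\<^sub>L (('y::{real_inner,banach})^('n::finite))) \<Rightarrow> real" where
  "max_row_sq A = Max (range (\<lambda>i. (norm (blinfun_row A i))\<^sup>2))"

definition step_bound_expectation ::
  "('x::{real_inner,banach} \<Rightarrow>\<^sub>L (('y::{real_inner,banach})^('n::finite))) \<Rightarrow> nat \<Rightarrow> real" where
  "step_bound_expectation A M =
     max (inverse 3 * inverse (norm A) *
            (5 * max_row_sq A * inverse (real CARD('n)) * real M) powr (- 1 / 2))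
         (inverse 9 * inverse (max_row_sq A) * inverse (15 + 7 * ln (real M)))"

definition step_bound_pathwise ::
  "('x::{real_inner,banach} \<Rightarrow>\<^sub>L (('y::{real_inner,banach})^('n::finite))) \<Rightarrow> nat \<Rightarrow> real" where
  "step_bound_pathwise A M =
     inverse (14\<^sup>2 * sqrt (max_row_sq A) * real M * norm A *
       ln (2 * (exp 1)\<^sup>2 * real CARD('n) * sqrt (max_row_sq A) * inverse (norm A)))"

(* The step size condition c0 <= 1/L, c0 < bound.  The truncated operator may vanish when the noise
   level is large; then L = 0 and 1/L and the bounds are read as infinity, whereas inverse 0 = 0 in
   HOL. *)
definition step_size_ok ::
  "('x::{real_inner,banach} \<Rightarrow>\<^sub>L (('y::{real_inner,banach})^('n::finite))) \<Rightarrow> real \<Rightarrow> real \<Rightarrow> bool" where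
  "step_size_ok A bound c0 \<longleftrightarrow> (A \<noteq> 0 \<longrightarrow> c0 \<le> inverse (max_row_sq A) \<and> c0 < bound)"

definition iid_uniform :: "'w measure \<Rightarrow> (nat \<Rightarrow> 'w \<Rightarrow> 'n::finite) \<Rightarrow> bool" where
  "iid_uniform P I \<longleftrightarrow>
     prob_space.indep_vars P (\<lambda>_. count_space UNIV) I UNIV \<and>
     (\<forall>k. distr P (count_space UNIV) (I k) = uniform_count_measure UNIV)"

end

theory Submission
  imports Defs
begin

text \<open>
  With \<open>B = A\<^sup>* A / n\<close> and \<open>R = I - c0 B\<close>, the error satisfies \<open>e (k+1) = R (e k) + c0 N k + h\<close>. Here \<open>h\<close> carries
  the data noise and \<open>N k = (B - A i\<^sup>* A i) (e k - e z)\<close>, with \<open>z\<close> the start of the current epoch, is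
  the gradient noise, which has mean zero. The deterministic part is Landweber iteration; its rate
  follows from the functional calculus, which is obtained from Bernstein polynomials.

  The gradient noise is controlled through the size \<open>d k\<close> of \<open>A (e k - e z)\<close>: the mean square in expectation,
  the norm itself for a fixed realization. Unrolling the recursion bounds \<open>d\<close> by a discrete
  convolution of \<open>d\<close> with a kernel, plus a forcing of order at most \<open>k powr (-3/2)\<close> and a noise term. The step size
  condition makes the total mass of the kernel less than one half, so \<open>d\<close> inherits the decay of the forcing,
  and summing the gradient noise once more costs only a term of order \<open>k powr (-1/2)\<close>.
  The noise contributes the data noise level times \<open>sqrt k\<close>; after truncation at a level \<open>l\<close> of the spectrum of \<open>B\<close> the factor is
  \<open>1 / sqrt l\<close> instead.
\<close>

section \<open>Adjoints and polynomials of operators\<close>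

text \<open>The gain over plain stochastic gradients is one power of the spectral variable
  \<open>x\<close>. Inside an epoch the noise-free error changes by \<open>R ^ t - I\<close>, of
  size at most \<open>M * c0 * x\<close>, and it is seen through \<open>A\<close>, worth another
  \<open>sqrt x\<close>. So the factor \<open>x powr (3/2) * (1 - c0 * x) ^ k\<close> appears, of
  order \<open>k powr (-3/2)\<close>. This order is summable, which is why a constant step size
  suffices, and convolving it with the order \<open>k powr (-1/2)\<close> of \<open>R ^ k\<close>
  after the adjoint of \<open>A\<close> leaves \<open>k powr (-1/2)\<close>. All spectral theory is
  reduced to one fact: a polynomial that is nonnegative on \<open>{0..norm S}\<close> yields a
  nonnegative quadratic form. Operator bounds then become inequalities in one real variable. The
  obstacle in the truncated case is that the source condition speaks of \<open>normal_op Ad\<close>,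
  the iteration of \<open>normal_op A\<close>, and \<open>A xd\<close> need not be
  \<open>yd\<close>. A projection commuting with both operators resolves this: on its range they
  agree, and on its kernel the iteration does not move while the initial error is already small
  there.\<close>

lemma riesz_representation:
  fixes f :: "'x::{real_inner,banach} \<Rightarrow> real"
  assumes f: "bounded_linear f"
  shows "\<exists>z. \<forall>x. f x = x \<bullet> z"
proof -
  interpret f: bounded_linear f by (rule f)
  \<comment> \<open>The representing vector is the minimiser of \<open>J\<close>. By the
    parallelogram law, fact \<open>mid\<close>, a minimising sequence is Cauchy, and a minimiser
    that failed to represent \<open>f\<close> at some \<open>x\<close> could be improved along
    \<open>x\<close>.\<close>
  define J where "J x = (norm x)\<^sup>2 - 2 * f x" for x
  obtain c where c: "\<And>x. norm (f x) \<le> norm x * c" using f.bounded by blast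
  have lower: "- c\<^sup>2 \<le> J x" for x
  proof -
    have "f x \<le> norm x * c" using c[of x] by auto
    moreover have "0 \<le> (norm x - c)\<^sup>2" by simp
    ultimately show ?thesis unfolding J_def power2_eq_square by (simp add: algebra_simps)
  qed
  have bdd: "bdd_below (range J)" using lower by (intro bdd_belowI) auto
  define m where "m = Inf (range J)"
  have m: "m \<le> J x" for x unfolding m_def using bdd by (simp add: cInf_lower)
  have "\<exists>x. J x < m + inverse (real (Suc k))" for k
  proof -
    have "Inf (range J) < m + inverse (real (Suc k))" by (simp add: m_def)
    from cInf_lessD[OF _ this] show ?thesis by auto
  qed
  then obtain s where s: "\<And>k. J (s k) < m + inverse (real (Suc k))" by metis
  have mid: "(norm (x - y))\<^sup>2 \<le> 2 * (J x - m) + 2 * (J y - m)" for x y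
  proof -
    have "(norm (x - y))\<^sup>2 = 2 * J x + 2 * J y - 4 * J ((1/2) *\<^sub>R (x + y))"
      unfolding J_def power2_norm_eq_inner
      by (simp add: f.scaleR f.add inner_add_left inner_add_right inner_diff_left
          inner_diff_right inner_commute algebra_simps)
    with m[of "(1/2) *\<^sub>R (x + y)"] show ?thesis by simp
  qed
  have "Cauchy s"
  proof (rule metric_CauchyI)
    fix e :: real assume e: "0 < e"
    obtain N where N: "inverse (real (Suc N)) < e\<^sup>2 / 4" using reals_Archimedean[of "e\<^sup>2 / 4"] e by auto
    have "dist (s k) (s l) < e" if "N \<le> k" "N \<le> l" for k l
    proof -
      have "J (s l) - m < e\<^sup>2 / 4" if "N \<le> l" for l
      proof -
        have "inverse (real (Suc l)) \<le> inverse (real (Suc N))"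
          using that by (intro le_imp_inverse_le) auto
        with N have "inverse (real (Suc l)) < e\<^sup>2 / 4" by (rule order.strict_trans1[rotated])
        with s[of l] show ?thesis by argo
      qed
      from this[OF that(1)] this[OF that(2)]
      have "2 * (J (s k) - m) + 2 * (J (s l) - m) < e\<^sup>2" by argo
      with mid have "(norm (s k - s l))\<^sup>2 < e\<^sup>2" by (rule order.strict_trans1)
      then show ?thesis using e by (simp add: dist_norm power_less_imp_less_base)
    qed
    then show "\<exists>N. \<forall>k\<ge>N. \<forall>l\<ge>N. dist (s k) (s l) < e" by blast
  qed
  then obtain z where z: "s \<longlonglongrightarrow> z" using Cauchy_convergent convergent_def by blast
  have "(\<lambda>k. J (s k)) \<longlonglongrightarrow> J z"
    unfolding J_def by (intro tendsto_intros z f.tendsto)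
  moreover have "(\<lambda>k. m + inverse (real (Suc k))) \<longlonglongrightarrow> m + 0"
    by (intro tendsto_add tendsto_const LIMSEQ_inverse_real_of_nat)
  ultimately have Jz: "J z \<le> m" using s by (intro LIMSEQ_le[of "\<lambda>k. J (s k)" "J z" "\<lambda>k. m + inverse (real (Suc k))" m]) (auto intro: less_imp_le)
  have "f x = x \<bullet> z" for x
  proof (rule ccontr)
    assume ne: "f x \<noteq> x \<bullet> z"
    define d where "d = f x - x \<bullet> z"
    have x0: "x \<noteq> 0" using ne by (auto simp: f.zero)
    then have n0: "(norm x)\<^sup>2 > 0" by simp
    define t where "t = d / (norm x)\<^sup>2"
    have "J (z + t *\<^sub>R x) = J z + t\<^sup>2 * (norm x)\<^sup>2 - 2 * t * d"
      unfolding J_def d_def power2_norm_eq_inner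
      by (simp add: f.scaleR f.add inner_add_left inner_add_right inner_commute algebra_simps power2_eq_square)
    also have "\<dots> = J z - d\<^sup>2 / (norm x)\<^sup>2"
      using n0 unfolding t_def by (simp add: power2_eq_square divide_simps)
    also have "\<dots> < m" using Jz ne n0 by (smt (verit) d_def divide_pos_pos zero_less_power2 right_minus_eq)
    finally show False using m[of "z + t *\<^sub>R x"] by simp
  qed
  then show ?thesis by blast
qed

lemma inner_eqI:
  fixes u v :: "'x::real_inner"
  assumes "\<And>x. x \<bullet> u = x \<bullet> v"
  shows "u = v"
  using assms[of "u - v"] by (metis inner_diff_right inner_eq_zero_iff right_minus_eq)

text \<open>Riesz representation makes the choice inside \<open>adjoint\<close> a genuine one, and
  Cauchy-Schwarz makes the chosen map bounded, so \<open>Blinfun\<close> returns the intended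
  operator and not a default.\<close>

lemma blinfun_adj_inner:
  fixes A :: "'x::{real_inner,banach} \<Rightarrow>\<^sub>L 'y::{real_inner,banach}"
  shows "x \<bullet> blinfun_adj A y = A x \<bullet> y"
proof -
  have "\<exists>z. \<forall>x. A x \<bullet> y = x \<bullet> z" for y
    by (rule riesz_representation)
      (intro bounded_linear_compose[OF bounded_linear_inner_left] blinfun.bounded_linear_right)
  then have "\<exists>f'. \<forall>x y. A x \<bullet> y = x \<bullet> f' y" by metis
  then have adj: "A x \<bullet> y = x \<bullet> adjoint A y" for x y
    unfolding adjoint_def by (rule someI2_ex) auto
  have "bounded_linear (adjoint A)"
  proof (rule bounded_linear_intro)
    show "adjoint A (u + v) = adjoint A u + adjoint A v" for u v
      by (rule inner_eqI) (simp add: inner_add_right flip: adj)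
    show "adjoint A (r *\<^sub>R u) = r *\<^sub>R adjoint A u" for r u
      by (rule inner_eqI) (simp flip: adj)
    show "norm (adjoint A u) \<le> norm u * norm A" for u
    proof -
      have "norm (adjoint A u) * norm (adjoint A u) = A (adjoint A u) \<bullet> u"
        by (simp add: adj norm_eq_sqrt_inner)
      also have "\<dots> \<le> norm (A (adjoint A u)) * norm u" by (rule norm_cauchy_schwarz)
      also have "\<dots> \<le> norm A * norm (adjoint A u) * norm u"
        by (intro mult_right_mono norm_blinfun) auto
      finally have "norm (adjoint A u) * norm (adjoint A u) \<le> norm (adjoint A u) * (norm u * norm A)"
        by (simp add: mult_ac)
      then show ?thesis by (cases "norm (adjoint A u) = 0") (auto simp: mult_le_cancel_left)
    qed
  qed
  then show ?thesis
    unfolding blinfun_adj_def by (simp add: bounded_linear_Blinfun_apply adj)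
qed

lemma blinfun_adj_inner':
  fixes A :: "'x::{real_inner,banach} \<Rightarrow>\<^sub>L 'y::{real_inner,banach}"
  shows "blinfun_adj A y \<bullet> x = y \<bullet> A x"
  by (metis blinfun_adj_inner inner_commute)

lemma blinfun_row_apply [simp]:
  fixes A :: "'x::{real_inner,banach} \<Rightarrow>\<^sub>L ('y::{real_inner,banach}^'n::finite)"
  shows "blinfun_row A i x = A x $ i"
proof -
  have "bounded_linear (\<lambda>x. A x $ i)"
    by (intro bounded_linear_compose[OF bounded_linear_vec_nth] blinfun.bounded_linear_right)
  then show ?thesis unfolding blinfun_row_def by (simp add: bounded_linear_Blinfun_apply)
qed

lemma norm_vec_sq: "(norm (y :: 'y::real_inner^'n::finite))\<^sup>2 = (\<Sum>i\<in>UNIV. (norm (y $ i))\<^sup>2)"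
  by (simp add: power2_norm_eq_inner inner_vec_def)

lemma sum_adj_rows:
  fixes A :: "'x::{real_inner,banach} \<Rightarrow>\<^sub>L ('y::{real_inner,banach}^'n::finite)"
  shows "(\<Sum>i\<in>UNIV. blinfun_adj (blinfun_row A i) (y $ i)) = blinfun_adj A y"
  by (rule inner_eqI) (simp add: inner_sum_right blinfun_adj_inner inner_vec_def)

lemma adj_row_eq_adj_axis:
  fixes A :: "'x::{real_inner,banach} \<Rightarrow>\<^sub>L ('y::{real_inner,banach}^'n::finite)"
  shows "blinfun_adj (blinfun_row A i) z = blinfun_adj A (axis i z)"
  by (rule inner_eqI) (simp add: blinfun_adj_inner inner_axis)

lemma normal_op_apply:
  "normal_op (A :: 'x::{real_inner,banach} \<Rightarrow>\<^sub>L ('y::{real_inner,banach}^'n::finite)) x =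
     inverse (real CARD('n)) *\<^sub>R blinfun_adj A (A x)"
  by (simp add: normal_op_def scaleR_blinfun.rep_eq)

lemma norm_row_sq_le_max:
  fixes A :: "'x::{real_inner,banach} \<Rightarrow>\<^sub>L ('y::{real_inner,banach}^'n::finite)"
  shows "(norm (blinfun_row A i))\<^sup>2 \<le> max_row_sq A"
  unfolding max_row_sq_def by (intro Max_ge) auto

lemma max_row_sq_nonneg: "0 \<le> max_row_sq A"
  using norm_row_sq_le_max[of A undefined] zero_le_power2 order_trans by blast

text \<open>Together with \<open>norm_normal_op_le\<close> this puts the spectrum of
  \<open>c0 *\<^sub>R normal_op A\<close> into \<open>{0..1}\<close> as soon as
  \<open>c0 * max_row_sq A \<le> 1\<close>.\<close>

lemma norm_sq_le_max_row:
  fixes A :: "'x::{real_inner,banach} \<Rightarrow>\<^sub>L ('y::{real_inner,banach}^'n::finite)"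
  shows "(norm A)\<^sup>2 \<le> real CARD('n) * max_row_sq A"
proof -
  have L: "0 \<le> real CARD('n) * max_row_sq A"
    by (intro mult_nonneg_nonneg max_row_sq_nonneg) simp
  have "norm A \<le> sqrt (real CARD('n) * max_row_sq A)"
  proof (rule norm_blinfun_bound)
    show "norm (A x) \<le> sqrt (real CARD('n) * max_row_sq A) * norm x" for x
    proof (rule power2_le_imp_le)
      have "(norm (A x))\<^sup>2 = (\<Sum>i\<in>UNIV. (norm (blinfun_row A i x))\<^sup>2)" by (simp add: norm_vec_sq)
      also have "\<dots> \<le> (\<Sum>i\<in>(UNIV::'n set). max_row_sq A * (norm x)\<^sup>2)"
      proof (rule sum_mono)
        fix i
        have "(norm (blinfun_row A i x))\<^sup>2 \<le> (norm (blinfun_row A i) * norm x)\<^sup>2"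
          by (intro power_mono norm_blinfun) auto
        also have "\<dots> \<le> max_row_sq A * (norm x)\<^sup>2"
          unfolding power_mult_distrib by (intro mult_right_mono norm_row_sq_le_max) auto
        finally show "(norm (blinfun_row A i x))\<^sup>2 \<le> max_row_sq A * (norm x)\<^sup>2" .
      qed
      also have "\<dots> = (sqrt (real CARD('n) * max_row_sq A) * norm x)\<^sup>2"
        using L by (simp add: power_mult_distrib)
      finally show "(norm (A x))\<^sup>2 \<le> (sqrt (real CARD('n) * max_row_sq A) * norm x)\<^sup>2" .
    qed (use L in auto)
  qed (use L in auto)
  then have "(norm A)\<^sup>2 \<le> (sqrt (real CARD('n) * max_row_sq A))\<^sup>2" by (intro power_mono) auto
  then show ?thesis using L by simp
qed

section \<open>Polynomials of one operator\<close>

lemma blinfun_poly_alt: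
  assumes "degree p \<le> N"
  shows "blinfun_poly p B = (\<Sum>i\<le>N. coeff p i *\<^sub>R (((o\<^sub>L) B ^^ i) id_blinfun))"
  unfolding blinfun_poly_def using assms
  by (intro sum.mono_neutral_left) (auto simp: coeff_eq_0)

lemma blinfun_poly_0 [simp]: "blinfun_poly 0 B = 0"
  by (simp add: blinfun_poly_def)

lemma blinfun_poly_add: "blinfun_poly (p + q) B = blinfun_poly p B + blinfun_poly q B"
  by (simp add: blinfun_poly_alt[of _ "max (degree p) (degree q)"] degree_add_le
      sum.distrib scaleR_add_left)

lemma blinfun_poly_smult: "blinfun_poly (smult c p) B = c *\<^sub>R blinfun_poly p B"
  by (simp add: blinfun_poly_alt[of _ "degree p"] scaleR_sum_right)

lemma blinfun_poly_minus: "blinfun_poly (- p) B = - blinfun_poly p B"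
  using blinfun_poly_smult[of "-1" p B] by simp

lemma blinfun_poly_diff: "blinfun_poly (p - q) B = blinfun_poly p B - blinfun_poly q B"
  using blinfun_poly_add[of p "-q" B] by (simp add: blinfun_poly_minus)

text \<open>Horner's scheme: with it, identities for \<open>blinfun_poly\<close> are proved by
  induction over \<open>pCons\<close>.\<close>

lemma blinfun_poly_pCons:
  "blinfun_poly (pCons c p) B = c *\<^sub>R id_blinfun + (B o\<^sub>L blinfun_poly p B)"
proof -
  have "blinfun_poly (pCons c p) B =
      (\<Sum>i\<le>Suc (degree p). coeff (pCons c p) i *\<^sub>R (((o\<^sub>L) B ^^ i) id_blinfun))"
    by (rule blinfun_poly_alt) (simp add: degree_pCons_le)
  also have "\<dots> = c *\<^sub>R id_blinfun + (\<Sum>i\<le>degree p. coeff p i *\<^sub>R (B o\<^sub>L (((o\<^sub>L) B ^^ i) id_blinfun)))"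
    by (subst sum.atMost_Suc_shift) simp
  finally show ?thesis
    unfolding blinfun_poly_def
    by (simp add: bounded_bilinear.sum_right[OF bounded_bilinear_blinfun_compose]
        bounded_bilinear.scaleR_right[OF bounded_bilinear_blinfun_compose])
qed

lemma blinfun_poly_pCons_apply:
  "blinfun_poly (pCons c p) B x = c *\<^sub>R x + B (blinfun_poly p B x)"
  by (simp add: blinfun_poly_pCons plus_blinfun.rep_eq scaleR_blinfun.rep_eq)

lemma blinfun_poly_mult_apply:
  "blinfun_poly (p * q) B x = blinfun_poly p B (blinfun_poly q B x)"
  by (induction p)
    (simp_all add: blinfun_poly_add blinfun_poly_smult blinfun_poly_pCons_apply mult_pCons_left
      plus_blinfun.rep_eq scaleR_blinfun.rep_eq)

lemma blinfun_poly_1 [simp]: "blinfun_poly 1 B x = x"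
  unfolding one_pCons by (simp add: blinfun_poly_pCons_apply)

lemma blinfun_poly_add_apply:
  "blinfun_poly (p + q) B x = blinfun_poly p B x + blinfun_poly q B x"
  "blinfun_poly (p - q) B x = blinfun_poly p B x - blinfun_poly q B x"
  "blinfun_poly (smult c p) B x = c *\<^sub>R blinfun_poly p B x"
  by (simp_all add: blinfun_poly_add blinfun_poly_diff blinfun_poly_smult plus_blinfun.rep_eq
      minus_blinfun.rep_eq scaleR_blinfun.rep_eq)

lemma blinfun_poly_sum_apply:
  "blinfun_poly (\<Sum>i\<in>S. p i) B x = (\<Sum>i\<in>S. blinfun_poly (p i) B x)"
  by (induction S rule: infinite_finite_induct) (simp_all add: blinfun_poly_add_apply)

text \<open>Serves to carry \<open>A\<close> from polynomials of the normal operator to polynomials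
  of its counterpart on the data space, and to move projections past polynomials, possibly changing
  the operator on the way.\<close>

lemma blinfun_poly_intertwine:
  fixes T :: "'a::{real_inner,banach} \<Rightarrow> 'b::{real_inner,banach}"
    and S :: "'a \<Rightarrow>\<^sub>L 'a" and S' :: "'b \<Rightarrow>\<^sub>L 'b"
  assumes "linear T" "\<And>x. T (S x) = S' (T x)"
  shows "T (blinfun_poly p S x) = blinfun_poly p S' (T x)"
proof -
  interpret linear T by fact
  show ?thesis by (induction p) (simp_all add: blinfun_poly_pCons_apply add scaleR zero assms(2))
qed

section \<open>Functional calculus of a positive operator\<close>

definition pos_op :: "('x::{real_inner,banach} \<Rightarrow>\<^sub>L 'x) \<Rightarrow> bool" where
  "pos_op S \<longleftrightarrow> (\<forall>x y. S x \<bullet> y = x \<bullet> S y) \<and> (\<forall>x. 0 \<le> S x \<bullet> x)"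

lemma blinfun_poly_self_adjoint:
  assumes "pos_op S"
  shows "blinfun_poly p S x \<bullet> y = x \<bullet> blinfun_poly p S y"
proof (induction p arbitrary: x y)
  case (pCons c p)
  have "blinfun_poly (pCons c p) S x = c *\<^sub>R x + blinfun_poly p S (S x)"
    unfolding blinfun_poly_pCons_apply
    using blinfun_poly_mult_apply[of p "[:0,1:]" S x] blinfun_poly_mult_apply[of "[:0,1:]" p S x]
    by (simp add: blinfun_poly_pCons_apply mult.commute)
  then show ?case using pCons.IH assms
    by (simp add: blinfun_poly_pCons_apply inner_add_left inner_add_right pos_op_def)
qed simp

text \<open>In terms of forms this is \<open>S - S\<^sup>2 \<ge> 0\<close>, obtained without a
  square root of \<open>S\<close>: the difference equals
  \<open>S (I - S)\<^sup>2 + S (I - S) S\<close>, where the first term inherits positivity from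
  \<open>S\<close> and the second from \<open>norm S \<le> 1\<close>.\<close>

lemma pos_op_norm_sq_le:
  assumes S: "pos_op S" and n: "norm S \<le> 1"
  shows "S y \<bullet> S y \<le> S y \<bullet> y"
proof -
  have "S (S y) \<bullet> S y \<le> norm (S (S y)) * norm (S y)" by (rule norm_cauchy_schwarz)
  also have "\<dots> \<le> (1 * norm (S y)) * norm (S y)"
    by (intro mult_right_mono order_trans[OF norm_blinfun]) (use n in auto)
  finally have 1: "S (S y) \<bullet> S y \<le> S y \<bullet> S y" by (simp add: power2_norm_eq_inner flip: power2_eq_square)
  have "0 \<le> S (y - S y) \<bullet> (y - S y)" using S unfolding pos_op_def by blast
  also have "\<dots> = S y \<bullet> y - 2 * (S y \<bullet> S y) + S (S y) \<bullet> S y"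
  proof -
    have "S (S y) \<bullet> y = S y \<bullet> S y" using S unfolding pos_op_def by blast
    then show ?thesis by (simp add: blinfun.diff_right inner_diff_left inner_diff_right)
  qed
  finally show ?thesis using 1 by linarith
qed

text \<open>The even parts of both exponents form a square \<open>q * q\<close>, which
  self-adjointness moves to both sides of the inner product. What remains is one of
  \<open>1\<close>, \<open>X\<close>, \<open>1 - X\<close> and \<open>X (1 - X)\<close>, the last
  being \<open>pos_op_norm_sq_le\<close>.\<close>

lemma pos_op_monomials:
  assumes S: "pos_op S" and n: "norm S \<le> 1"
  shows "0 \<le> blinfun_poly ([:0,1:] ^ k * [:1,-1:] ^ m) S x \<bullet> x"
proof -
  have sq: "blinfun_poly (r * (q * q)) S x \<bullet> x =
      blinfun_poly r S (blinfun_poly q S x) \<bullet> blinfun_poly q S x" for r q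
    by (metis (no_types, lifting) S blinfun_poly_mult_apply blinfun_poly_self_adjoint mult.left_commute)
  have le: "S y \<bullet> y \<le> y \<bullet> y" for y
  proof -
    have "S y \<bullet> y \<le> norm (S y) * norm y" by (rule norm_cauchy_schwarz)
    also have "\<dots> \<le> (1 * norm y) * norm y"
      by (intro mult_right_mono order_trans[OF norm_blinfun]) (use n in auto)
    finally show ?thesis by (simp add: power2_norm_eq_inner flip: power2_eq_square)
  qed
  have nn: "0 \<le> blinfun_poly ([:0,1:] ^ i * [:1,-1:] ^ j) S y \<bullet> y" if "i < 2" "j < 2" for i j y
  proof -
    have "i = 0 \<or> i = 1" "j = 0 \<or> j = 1" using that by auto
    then show ?thesis
      using S le[of y] pos_op_norm_sq_le[OF S n, of y]
      by (auto simp: pos_op_def blinfun_poly_pCons_apply inner_add_left inner_diff_left blinfun.diff_right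
          blinfun.add_right blinfun.minus_right)
  qed
  have "[:0,1:] ^ k * [:1,-1:] ^ m = ([:0,1:] ^ (k mod 2) * [:1,-1:] ^ (m mod 2)) *
      (([:0,1:] ^ (k div 2) * [:1,-1:] ^ (m div 2)) * ([:0,1:] ^ (k div 2) * [:1,-1::real:] ^ (m div 2)))"
  proof -
    have "z ^ k = z ^ (k mod 2) * (z ^ (k div 2) * z ^ (k div 2))" for z :: "real poly" and k
      unfolding power_add[symmetric] by (rule arg_cong[where f="\<lambda>j. z ^ j"]) presburger
    from this[of "[:0,1:]" k] this[of "[:1,-1:]" m] show ?thesis by (simp only: mult_ac)
  qed
  then show ?thesis using nn[of "k mod 2" "m mod 2"] sq by simp
qed

section \<open>Bernstein expansions and positivity\<close>

definition bern_poly :: "nat \<Rightarrow> (nat \<Rightarrow> real) \<Rightarrow> real poly" where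
  "bern_poly N f = (\<Sum>k\<le>N. smult (f k * real (N choose k)) ([:0,1:] ^ k * [:1,-1:] ^ (N - k)))"

lemma bern_poly_add: "bern_poly N (\<lambda>k. f k + g k) = bern_poly N f + bern_poly N g"
  by (simp add: bern_poly_def sum.distrib distrib_right smult_add_left)

lemma bern_poly_scale: "bern_poly N (\<lambda>k. c * f k) = smult c (bern_poly N f)"
  by (rule poly_eqI) (simp add: bern_poly_def coeff_sum sum_distrib_left mult_ac)

text \<open>Multiply \<open>X ^ j\<close> by \<open>(X + (1 - X)) ^ (N - j) = 1\<close> and expand;
  \<open>choose_mult\<close> brings the coefficients into Bernstein form. The coefficients are not
  the values of the monomial at the nodes, which is why \<open>bern_poly\<close> takes an arbitrary
  coefficient sequence.\<close>

lemma bern_poly_choose: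
  assumes "j \<le> N"
  shows "bern_poly N (\<lambda>k. real (k choose j) / real (N choose j)) = [:0,1:] ^ j"
proof -
  let ?X = "[:0,1:] :: real poly" and ?Y = "[:1,-1:] :: real poly"
  have pos: "real (N choose j) > 0" using assms by simp
  have "bern_poly N (\<lambda>k. real (k choose j) / real (N choose j)) =
     (\<Sum>k\<in>{j..N}. smult (real (k choose j) / real (N choose j) * real (N choose k)) (?X ^ k * ?Y ^ (N - k)))"
    unfolding bern_poly_def by (rule sum.mono_neutral_right) auto
  also have "\<dots> = (\<Sum>k\<in>{j..N}. smult (real ((N - j) choose (k - j))) (?X ^ k * ?Y ^ (N - k)))"
  proof (rule sum.cong[OF refl])
    fix k assume k: "k \<in> {j..N}"
    have "real (N choose k) * real (k choose j) = real (N choose j) * real ((N - j) choose (k - j))"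
      using choose_mult[of j k N] k by (metis atLeastAtMost_iff of_nat_mult)
    then have "real (k choose j) / real (N choose j) * real (N choose k) = real ((N - j) choose (k - j))"
      using pos by (simp add: field_simps)
    then show "smult (real (k choose j) / real (N choose j) * real (N choose k)) (?X ^ k * ?Y ^ (N - k)) =
      smult (real ((N - j) choose (k - j))) (?X ^ k * ?Y ^ (N - k))" by simp
  qed
  also have "\<dots> = (\<Sum>k\<le>N - j. smult (real ((N - j) choose k)) (?X ^ (k + j) * ?Y ^ (N - j - k)))"
    by (rule sum.reindex_bij_witness[of _ "\<lambda>k. k + j" "\<lambda>k. k - j"]) (use assms in auto)
  also have "\<dots> = ?X ^ j * (\<Sum>k\<le>N - j. of_nat ((N - j) choose k) * ?X ^ k * ?Y ^ (N - j - k))"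
    by (simp add: sum_distrib_left power_add of_nat_poly mult_ac)
  also have "\<dots> = ?X ^ j * (?X + ?Y) ^ (N - j)" by (simp only: binomial_ring)
  also have "?X + ?Y = 1" by (simp add: one_pCons)
  finally show ?thesis by simp
qed

lemma bern_poly_const: "bern_poly N (\<lambda>k. c) = [:c:]"
proof -
  have "bern_poly N (\<lambda>k. c * 1) = [:c:]"
    using bern_poly_choose[of 0 N] unfolding bern_poly_scale by simp
  then show ?thesis by simp
qed

lemma bern_poly_nonneg:
  assumes S: "pos_op S" and n: "norm S \<le> 1" and f: "\<And>k. k \<le> N \<Longrightarrow> 0 \<le> f k"
  shows "0 \<le> blinfun_poly (bern_poly N f) S x \<bullet> x"
  unfolding bern_poly_def blinfun_poly_sum_apply blinfun_poly_add_apply inner_sum_left inner_scaleR_left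
  by (intro sum_nonneg mult_nonneg_nonneg pos_op_monomials S n) (use f in auto)

text \<open>The ratios of binomial coefficients are the exact Bernstein coefficients of a monomial, and
  they approach its values at the nodes.\<close>

lemma choose_ratio_bound:
  assumes "k \<le> N" "j < N"
  shows "\<bar>real (k choose j) / real (N choose j) - (real k / real N) ^ j\<bar> \<le> real j * real j / (real N - real j)"
  using assms(2)
proof (induction j)
  case (Suc j)
  define a where "a = real (k choose j) / real (N choose j)"
  define b where "b = (real k / real N) ^ j"
  have j: "j < N" "0 < N" and IH: "\<bar>a - b\<bar> \<le> real j * real j / (real N - real j)"
    using Suc unfolding a_def b_def by auto
  have a01: "0 \<le> a" "a \<le> 1"
    unfolding a_def using j assms(1) by (auto simp: divide_le_eq binomial_right_mono)
  have kN: "0 \<le> real k / real N" "real k / real N \<le> 1" using assms(1) j by (auto simp: divide_le_eq)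
  have step: "real (m choose Suc j) * real (Suc j) = real (m choose j) * (real m - real j)" for m
  proof (cases "j \<le> m")
    case True
    have "Suc j * (m choose Suc j) = (m - j) * (m choose j)" 
      by (simp only: binomial_absorption binomial_absorb_comp)
    then show ?thesis using True by (metis mult.commute of_nat_diff of_nat_mult)
  qed (simp add: binomial_eq_0)
  have eq: "real (k choose Suc j) / real (N choose Suc j) = a * ((real k - real j) / (real N - real j))"
  proof -
    have "real (k choose Suc j) / real (N choose Suc j) =
      (real (k choose Suc j) * real (Suc j)) / (real (N choose Suc j) * real (Suc j))" by simp
    then show ?thesis unfolding step a_def by simp
  qed
  have Nj: "real N - real j > 0" using j by simp
  have 1: "\<bar>a * ((real k - real j) / (real N - real j)) - a * (real k / real N)\<bar> \<le> real j / (real N - real j)"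
  \<comment> \<open>For \<open>k < j\<close> the quotient \<open>(k - j) / (N - j)\<close> is
    negative and the comparison of factors fails, but then \<open>k choose j\<close> vanishes and so
    does \<open>a\<close>.\<close>
  proof (cases "k < j")
    case False
    have "(real k - real j) / (real N - real j) - real k / real N
       = - (real j / (real N - real j)) * (1 - real k / real N)"
      using Nj j by (simp add: divide_simps) (simp add: algebra_simps)
    then have "\<bar>(real k - real j) / (real N - real j) - real k / real N\<bar>
       = real j / (real N - real j) * (1 - real k / real N)"
      using Nj kN by (simp add: abs_mult)
    also have "\<dots> \<le> real j / (real N - real j) * 1" using kN Nj by (intro mult_left_mono) auto
    finally have "\<bar>(real k - real j) / (real N - real j) - real k / real N\<bar> \<le> real j / (real N - real j)" by simp
    then have "a * \<bar>(real k - real j) / (real N - real j) - real k / real N\<bar> \<le> 1 * (real j / (real N - real j))"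
      using a01 by (intro mult_mono) auto
    then show ?thesis using a01 by (simp only: abs_mult abs_of_nonneg mult_1 right_diff_distrib[symmetric])
  next
    case True
    then have "a = 0" by (simp add: a_def)
    then show ?thesis using Nj by simp
  qed
  have 2: "\<bar>a * (real k / real N) - b * (real k / real N)\<bar> \<le> real j * real j / (real N - real j)"
  proof -
    have "\<bar>a - b\<bar> * (real k / real N) \<le> (real j * real j / (real N - real j)) * 1"
      using IH kN Nj by (intro mult_mono) auto
    then show ?thesis using kN by (simp only: abs_mult abs_of_nonneg mult_1_right left_diff_distrib[symmetric])
  qed
  have "\<bar>real (k choose Suc j) / real (N choose Suc j) - (real k / real N) ^ Suc j\<bar>
      \<le> real j / (real N - real j) + real j * real j / (real N - real j)"
    using 1 2 unfolding eq b_def[symmetric] power_Suc2 by linarith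
  also have "\<dots> = (real j * (1 + real j)) / (real N - real j)" by (simp add: add_divide_distrib algebra_simps)
  also have "\<dots> \<le> real (Suc j) * real (Suc j) / (real N - real (Suc j))"
    using Suc.prems by (intro frac_le mult_mono) auto
  finally show ?case .
qed simp

text \<open>The claim is about all large \<open>N\<close> so that the finitely many monomials of
  \<open>p\<close> can share one degree; their coefficients and errors then add up.\<close>

lemma bern_poly_approx:
  assumes "\<epsilon> > 0"
  shows "\<forall>\<^sub>F N in sequentially. \<exists>f. p = bern_poly N f \<and> (\<forall>k\<le>N. \<bar>f k - poly p (real k / real N)\<bar> \<le> \<epsilon>)"
proof -
  have mon: "\<forall>\<^sub>F N in sequentially. \<exists>f. monom c j = bern_poly N f \<and>
      (\<forall>k\<le>N. \<bar>f k - poly (monom c j) (real k / real N)\<bar> \<le> \<epsilon>)" if e: "\<epsilon> > 0" for c j \<epsilon>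
  proof -
    have "(\<lambda>N. \<bar>c\<bar> * (real j * real j / (real N - real j))) \<longlonglongrightarrow> \<bar>c\<bar> * 0"
      by (intro tendsto_mult tendsto_const tendsto_divide_0[OF tendsto_const] filterlim_at_top_imp_at_infinity
          filterlim_tendsto_add_at_top[of "\<lambda>_. - real j" "- real j" sequentially real, simplified]
          filterlim_real_sequentially)
    then have "(\<lambda>N. \<bar>c\<bar> * (real j * real j / (real N - real j))) \<longlonglongrightarrow> 0" by simp
    from order_tendstoD(2)[OF this e] eventually_gt_at_top[of j] show ?thesis
    proof eventually_elim
      case (elim N)
      let ?f = "\<lambda>k. c * (real (k choose j) / real (N choose j))"
      have "bern_poly N ?f = monom c j"
        unfolding bern_poly_scale using elim by (simp add: bern_poly_choose monom_altdef)
      moreover have "\<bar>?f k - poly (monom c j) (real k / real N)\<bar> \<le> \<epsilon>" if "k \<le> N" for k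
      proof -
        have "\<bar>?f k - poly (monom c j) (real k / real N)\<bar>
          = \<bar>c\<bar> * \<bar>real (k choose j) / real (N choose j) - (real k / real N) ^ j\<bar>"
          unfolding poly_monom by (simp only: abs_mult right_diff_distrib[symmetric])
        also have "\<dots> \<le> \<bar>c\<bar> * (real j * real j / (real N - real j))"
          using elim that by (intro mult_left_mono choose_ratio_bound) auto
        finally show ?thesis using elim by linarith
      qed
      ultimately show ?case by metis
    qed
  qed
  have "\<forall>\<^sub>F N in sequentially. \<exists>f. (\<Sum>j<m. monom (coeff p j) j) = bern_poly N f \<and>
      (\<forall>k\<le>N. \<bar>f k - poly (\<Sum>j<m. monom (coeff p j) j) (real k / real N)\<bar> \<le> \<epsilon>)" if "\<epsilon> > 0" for m \<epsilon>
    using that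
  proof (induction m arbitrary: \<epsilon>)
    case 0
    have "0 = bern_poly N (\<lambda>_. 0)" for N using bern_poly_const[of N 0] by simp
    then show ?case using 0 by (intro always_eventually allI exI[of _ "\<lambda>_. 0"]) auto
  next
    case (Suc m)
    have "\<epsilon> / 2 > 0" using Suc by simp
    from Suc.IH[OF this] mon[OF this, of "coeff p m" m] show ?case
    proof eventually_elim
      case (elim N)
      then obtain f g where fg: "(\<Sum>j<m. monom (coeff p j) j) = bern_poly N f" "monom (coeff p m) m = bern_poly N g"
        and b: "\<And>k. k \<le> N \<Longrightarrow> \<bar>f k - poly (\<Sum>j<m. monom (coeff p j) j) (real k / real N)\<bar> \<le> \<epsilon> / 2"
         "\<And>k. k \<le> N \<Longrightarrow> \<bar>g k - poly (monom (coeff p m) m) (real k / real N)\<bar> \<le> \<epsilon> / 2" by blast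
      show ?case
      proof (intro exI conjI allI impI)
        show "(\<Sum>j<Suc m. monom (coeff p j) j) = bern_poly N (\<lambda>k. f k + g k)"
          unfolding bern_poly_add by (simp add: fg)
        show "\<bar>(f k + g k) - poly (\<Sum>j<Suc m. monom (coeff p j) j) (real k / real N)\<bar> \<le> \<epsilon>" if "k \<le> N" for k
          using b[OF that] unfolding sum.lessThan_Suc poly_add by linarith
      qed
    qed
  qed
  from this[OF assms, of "Suc (degree p)"] show ?thesis
    by (simp only: lessThan_Suc_atMost poly_as_sum_of_monoms)
qed

text \<open>For large \<open>N\<close> the Bernstein coefficients of \<open>p\<close> are at least
  \<open>- \<epsilon>\<close>, so those of \<open>p + \<epsilon>\<close> are nonnegative and
  \<open>pos_op_monomials\<close> applies term by term; then \<open>\<epsilon>\<close> tends to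
  zero.\<close>

lemma blinfun_poly_nonneg_unit:
  assumes S: "pos_op S" and n: "norm S \<le> 1" and p: "\<And>t. 0 \<le> t \<Longrightarrow> t \<le> 1 \<Longrightarrow> 0 \<le> poly p t"
  shows "0 \<le> blinfun_poly p S x \<bullet> x"
proof (rule field_le_epsilon)
  fix e :: real assume e: "e > 0"
  define \<epsilon> where "\<epsilon> = e / (1 + x \<bullet> x)"
  have xx: "1 + x \<bullet> x > 0" by (simp add: add_pos_nonneg)
  have "\<epsilon> > 0" using e xx by (simp add: \<epsilon>_def)
  from bern_poly_approx[OF this, of p] eventually_gt_at_top[of 0]
  obtain N f where N: "N > 0" and f: "p = bern_poly N f" "\<And>k. k \<le> N \<Longrightarrow> \<bar>f k - poly p (real k / real N)\<bar> \<le> \<epsilon>"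
    using eventually_conj_iff eventually_happens' sequentially_bot by (smt (verit, del_insts))
  have "0 \<le> f k + \<epsilon>" if "k \<le> N" for k
    using f(2)[OF that] p[of "real k / real N"] N that by (auto simp: divide_le_eq)
  then have "0 \<le> blinfun_poly (bern_poly N (\<lambda>k. f k + \<epsilon>)) S x \<bullet> x" by (rule bern_poly_nonneg[OF S n])
  then have "0 \<le> blinfun_poly p S x \<bullet> x + \<epsilon> * (x \<bullet> x)"
    unfolding bern_poly_add bern_poly_const f(1)[symmetric]
    by (simp add: blinfun_poly_add_apply blinfun_poly_pCons_apply inner_add_left)
  also have "\<epsilon> * (x \<bullet> x) \<le> e" unfolding \<epsilon>_def using e xx by (simp add: divide_simps)
  finally show "0 \<le> blinfun_poly p S x \<bullet> x + e" by simp
qed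

lemma blinfun_poly_pcompose_scale:
  "blinfun_poly (pcompose p [:0, \<beta>:]) S x = blinfun_poly p (\<beta> *\<^sub>R S) x"
  by (induction p arbitrary: x)
    (simp_all add: pcompose_pCons blinfun_poly_add_apply blinfun_poly_pCons_apply blinfun_poly_smult
      scaleR_blinfun.rep_eq blinfun.scaleR_right)

lemma blinfun_poly_nonneg:
  assumes S: "pos_op S" and n: "norm S \<le> \<beta>" and p: "\<And>t. 0 \<le> t \<Longrightarrow> t \<le> \<beta> \<Longrightarrow> 0 \<le> poly p t"
  shows "0 \<le> blinfun_poly p S x \<bullet> x"
proof (cases "\<beta> = 0")
  case True
  then have "S = 0" using n by simp
  then have "blinfun_poly p S x = poly p 0 *\<^sub>R x" by (cases p) (simp add: blinfun_poly_pCons_apply)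
  then show ?thesis using p[of 0] True by simp
next
  case False
  then have b: "\<beta> > 0" using n by (smt (verit) norm_ge_zero)
  have "0 \<le> blinfun_poly (pcompose p [:0, \<beta>:]) (inverse \<beta> *\<^sub>R S) x \<bullet> x"
  proof (rule blinfun_poly_nonneg_unit)
    show "pos_op (inverse \<beta> *\<^sub>R S)"
      using S b by (auto simp: pos_op_def scaleR_blinfun.rep_eq)
    show "norm (inverse \<beta> *\<^sub>R S) \<le> 1" using b n by (simp add: divide_simps)
    show "0 \<le> poly (pcompose p [:0, \<beta>:]) t" if "0 \<le> t" "t \<le> 1" for t
      using p[of "t * \<beta>"] that b by (simp add: poly_pcompose mult_left_le_one_le)
  qed
  then show ?thesis using b by (simp add: blinfun_poly_pcompose_scale)
qed

text \<open>Positivity of the polynomial \<open>C\<^sup>2 - p * p\<close>, whose form at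
  \<open>x\<close> is \<open>C\<^sup>2 (norm x)\<^sup>2\<close> minus the square of the norm to be
  bounded.\<close>

lemma norm_blinfun_poly_le:
  assumes S: "pos_op S" and n: "norm S \<le> \<beta>" and p: "\<And>t. 0 \<le> t \<Longrightarrow> t \<le> \<beta> \<Longrightarrow> \<bar>poly p t\<bar> \<le> C"
  shows "norm (blinfun_poly p S x) \<le> C * norm x"
proof -
  have C: "0 \<le> C" using p[of 0] n order_trans[OF norm_ge_zero n] by auto
  have "0 \<le> blinfun_poly ([:C\<^sup>2:] - p * p) S x \<bullet> x"
  proof (rule blinfun_poly_nonneg[OF S n])
    fix t assume "0 \<le> t" "t \<le> \<beta>"
    then have "\<bar>poly p t\<bar>\<^sup>2 \<le> C\<^sup>2" using p by (intro power_mono) auto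
    then show "0 \<le> poly ([:C\<^sup>2:] - p * p) t" by (simp add: power2_eq_square)
  qed
  then have "(norm (blinfun_poly p S x))\<^sup>2 \<le> (C * norm x)\<^sup>2"
    by (simp add: blinfun_poly_add_apply blinfun_poly_mult_apply blinfun_poly_pCons_apply inner_diff_left
       blinfun_poly_self_adjoint[OF S] power2_norm_eq_inner power_mult_distrib)
  then show ?thesis by (rule power2_le_imp_le) (use C in simp)
qed

section \<open>Norm bounds for \<open>A\<close> and its adjoint next to a polynomial of the normal
  operator\<close>

lemma pos_op_normal_op: "pos_op (normal_op A)"
  by (auto simp: pos_op_def normal_op_apply blinfun_adj_inner blinfun_adj_inner')

lemma norm_blinfun_adj_le: "norm (blinfun_adj A y) \<le> norm A * norm y"
proof -
  have "norm (blinfun_adj A y) * norm (blinfun_adj A y) = A (blinfun_adj A y) \<bullet> y"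
    by (simp only: power2_norm_eq_inner blinfun_adj_inner flip: power2_eq_square)
  also have "\<dots> \<le> norm (A (blinfun_adj A y)) * norm y" by (rule norm_cauchy_schwarz)
  also have "\<dots> \<le> norm A * norm (blinfun_adj A y) * norm y"
    by (intro mult_right_mono norm_blinfun) auto
  finally have "norm (blinfun_adj A y) * norm (blinfun_adj A y) \<le> norm (blinfun_adj A y) * (norm A * norm y)"
    by (simp add: mult_ac)
  then show ?thesis by (cases "norm (blinfun_adj A y) = 0") (auto simp: mult_le_cancel_left)
qed

lemma norm_normal_op_le:
  fixes A :: "'x::{real_inner,banach} \<Rightarrow>\<^sub>L ('y::{real_inner,banach}^'n::finite)"
  shows "norm (normal_op A) \<le> (norm A)\<^sup>2 / real CARD('n)"
proof (rule norm_blinfun_bound)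
  fix x
  have "norm (blinfun_adj A (A x)) \<le> norm A * (norm A * norm x)"
    by (intro order_trans[OF norm_blinfun_adj_le] mult_left_mono norm_blinfun) auto
  then have "inverse (real CARD('n)) * norm (blinfun_adj A (A x)) \<le> inverse (real CARD('n)) * (norm A * (norm A * norm x))"
    by (intro mult_left_mono) auto
  then show "norm (normal_op A x) \<le> (norm A)\<^sup>2 / real CARD('n) * norm x"
    by (simp add: normal_op_apply power2_eq_square field_simps)
qed simp

text \<open>\<open>A\<close> counts as the square root of \<open>n\<close> times the normal
  operator: the square of the left side is \<open>n\<close> times the form of
  \<open>t * (p t)\<^sup>2\<close>, and \<open>C\<^sup>2 - t * (p t)\<^sup>2\<close> is
  nonnegative.\<close>

lemma norm_A_poly_le:
  fixes A :: "'x::{real_inner,banach} \<Rightarrow>\<^sub>L ('y::{real_inner,banach}^'n::finite)"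
  assumes p: "\<And>t. 0 \<le> t \<Longrightarrow> t \<le> (norm A)\<^sup>2 / real CARD('n) \<Longrightarrow> t * (poly p t)\<^sup>2 \<le> C\<^sup>2" and C: "0 \<le> C"
  shows "norm (A (blinfun_poly p (normal_op A) x)) \<le> sqrt (real CARD('n)) * C * norm x"
proof (rule power2_le_imp_le)
  let ?B = "normal_op A" and ?n = "real CARD('n)"
  have "0 \<le> blinfun_poly ([:C\<^sup>2:] - [:0,1:] * (p * p)) ?B x \<bullet> x"
    by (rule blinfun_poly_nonneg[OF pos_op_normal_op norm_normal_op_le])
      (use p in \<open>auto simp: power2_eq_square\<close>)
  then have "blinfun_poly p ?B x \<bullet> ?B (blinfun_poly p ?B x) \<le> C\<^sup>2 * (x \<bullet> x)"
    unfolding mult.left_commute[of "[:0,1:]"] blinfun_poly_add_apply blinfun_poly_mult_apply inner_diff_left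
      blinfun_poly_self_adjoint[OF pos_op_normal_op, of p _ x]
    by (simp add: blinfun_poly_pCons_apply inner_commute)
  then have "?n * (blinfun_poly p ?B x \<bullet> ?B (blinfun_poly p ?B x)) \<le> ?n * (C\<^sup>2 * (x \<bullet> x))"
    by (intro mult_left_mono) auto
  then show "(norm (A (blinfun_poly p ?B x)))\<^sup>2 \<le> (sqrt ?n * C * norm x)\<^sup>2"
    by (simp add: normal_op_apply blinfun_adj_inner power2_norm_eq_inner power_mult_distrib field_simps)
qed (use C in auto)

lemma norm_poly_adj_le:
  fixes A :: "'x::{real_inner,banach} \<Rightarrow>\<^sub>L ('y::{real_inner,banach}^'n::finite)"
  assumes p: "\<And>t. 0 \<le> t \<Longrightarrow> t \<le> (norm A)\<^sup>2 / real CARD('n) \<Longrightarrow> t * (poly p t)\<^sup>2 \<le> C\<^sup>2" and C: "0 \<le> C"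
  shows "norm (blinfun_poly p (normal_op A) (blinfun_adj A y)) \<le> sqrt (real CARD('n)) * C * norm y"
proof -
  define z where "z = blinfun_poly p (normal_op A) (blinfun_adj A y)"
  have "norm z * norm z = blinfun_adj A y \<bullet> blinfun_poly p (normal_op A) z"
    using blinfun_poly_self_adjoint[OF pos_op_normal_op, of p A "blinfun_adj A y" z]
    by (simp add: z_def[symmetric] power2_norm_eq_inner flip: power2_eq_square)
  also have "\<dots> = y \<bullet> A (blinfun_poly p (normal_op A) z)" by (rule blinfun_adj_inner')
  also have "\<dots> \<le> norm y * norm (A (blinfun_poly p (normal_op A) z))" by (rule norm_cauchy_schwarz)
  also have "\<dots> \<le> norm y * (sqrt (real CARD('n)) * C * norm z)"
    by (intro mult_left_mono norm_A_poly_le p C) auto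
  finally have "norm z * norm z \<le> norm z * (sqrt (real CARD('n)) * C * norm y)" by (simp add: mult_ac)
  then show ?thesis unfolding z_def[symmetric]
    using C by (cases "norm z = 0") (auto simp: mult_le_cancel_left)
qed

text \<open>With \<open>A\<close> on one side and its adjoint on the other a full power of
  \<open>t\<close> is available. It becomes visible on the data space: \<open>A\<close> intertwines
  the normal operator with \<open>G\<close>, and the expression turns into \<open>n\<close> times
  \<open>t * p t\<close> evaluated at \<open>G\<close>.\<close>

lemma norm_A_poly_adj_le:
  fixes A :: "'x::{real_inner,banach} \<Rightarrow>\<^sub>L ('y::{real_inner,banach}^'n::finite)"
  assumes p: "\<And>t. 0 \<le> t \<Longrightarrow> t \<le> (norm A)\<^sup>2 / real CARD('n) \<Longrightarrow> t * \<bar>poly p t\<bar> \<le> C"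
  shows "norm (A (blinfun_poly p (normal_op A) (blinfun_adj A y))) \<le> real CARD('n) * C * norm y"
proof -
  let ?n = "real CARD('n)"
  define G where "G = inverse ?n *\<^sub>R (A o\<^sub>L blinfun_adj A)"
  have G: "G y = inverse ?n *\<^sub>R A (blinfun_adj A y)" for y by (simp add: G_def scaleR_blinfun.rep_eq)
  have "A (blinfun_adj A x) \<bullet> y = blinfun_adj A x \<bullet> blinfun_adj A y" for x y
    by (rule blinfun_adj_inner[symmetric])
  then have pG: "pos_op G" by (auto simp: pos_op_def G) (metis inner_commute)
  have nG: "norm G \<le> (norm A)\<^sup>2 / ?n"
  proof (rule norm_blinfun_bound)
    fix x
    have "norm (A (blinfun_adj A x)) \<le> norm A * (norm A * norm x)"
      by (intro order_trans[OF norm_blinfun] mult_left_mono norm_blinfun_adj_le) auto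
    then have "inverse ?n * norm (A (blinfun_adj A x)) \<le> inverse ?n * (norm A * (norm A * norm x))"
      by (intro mult_left_mono) auto
    then show "norm (G x) \<le> (norm A)\<^sup>2 / ?n * norm x"
      by (simp add: G power2_eq_square field_simps)
  qed simp
  have "A (blinfun_poly p (normal_op A) (blinfun_adj A y)) = blinfun_poly p G (A (blinfun_adj A y))"
    by (rule blinfun_poly_intertwine)
      (auto intro: bounded_linear.linear blinfun.bounded_linear_right simp: G normal_op_apply blinfun.scaleR_right)
  also have "A (blinfun_adj A y) = ?n *\<^sub>R G y" by (simp add: G)
  also have "blinfun_poly p G (?n *\<^sub>R G y) = ?n *\<^sub>R blinfun_poly (p * [:0,1:]) G y"
    by (simp only: blinfun_poly_mult_apply) (simp add: blinfun_poly_pCons_apply blinfun.scaleR_right)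
  also have "norm \<dots> \<le> ?n * (C * norm y)"
    unfolding norm_scaleR
    by (intro mult_mono norm_blinfun_poly_le[OF pG nG]) (use p in \<open>auto simp: abs_mult\<close>)
  finally show ?thesis by simp
qed

text \<open>Uniform closeness of polynomials on \<open>{0..norm B}\<close> gives closeness in
  operator norm. Hence all approximating sequences have one common limit, which the definite
  description denotes; Stone-Weierstrass provides a sequence to start from.\<close>

lemma blinfun_powr_limit:
  assumes S: "pos_op B" and s: "s > 0"
  obtains p where "uniform_limit {0..norm B} (\<lambda>m. poly (p m)) (\<lambda>t. t powr s) sequentially"
    "(\<lambda>m. blinfun_poly (p m) B) \<longlonglongrightarrow> blinfun_powr B s"
proof -
  have cont: "continuous_on {0..norm B} (\<lambda>t. t powr s)"
    using s by (intro continuous_on_powr' continuous_intros) auto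
  obtain g where g: "uniform_limit {0..norm B} g (\<lambda>t. t powr s) sequentially"
      "\<And>m. polynomial_function (g m)"
    using Stone_Weierstrass_uniform_limit[OF compact_Icc cont] by blast
  have "\<exists>q. g m = poly q" for m
  proof -
    obtain a n where "g m = (\<lambda>x. \<Sum>i\<le>n. a i * x ^ i)"
      using g(2)[of m] unfolding real_polynomial_function_eq[symmetric] real_polynomial_function_iff_sum by blast
    then have "g m = poly (\<Sum>i\<le>n. monom (a i) i)" by (simp add: poly_sum poly_monom fun_eq_iff)
    then show ?thesis by blast
  qed
  then obtain p where gp: "\<And>m. g m = poly (p m)" by metis
  have p: "uniform_limit {0..norm B} (\<lambda>m. poly (p m)) (\<lambda>t. t powr s) sequentially"
    using g(1) by (simp add: gp[symmetric])
  have nle: "norm (blinfun_poly q B - blinfun_poly r B) \<le> C"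
    if "\<And>t. t \<in> {0..norm B} \<Longrightarrow> dist (poly q t) (poly r t) \<le> C" for q r C
  proof (rule norm_blinfun_bound)
    show "0 \<le> C" using that[of 0] by (meson atLeastAtMost_iff norm_ge_zero order_refl order_trans zero_le_dist)
    show "norm ((blinfun_poly q B - blinfun_poly r B) x) \<le> C * norm x" for x
      unfolding blinfun_poly_diff[symmetric]
      by (rule norm_blinfun_poly_le[OF S order_refl]) (use that in \<open>auto simp: dist_real_def\<close>)
  qed
  have unif: "\<forall>\<^sub>F m in sequentially. \<forall>t\<in>{0..norm B}. dist (poly (q m) t) (t powr s) < e"
    if "uniform_limit {0..norm B} (\<lambda>m. poly (q m)) (\<lambda>t. t powr s) sequentially" "e > 0" for q and e :: real
    using that by (rule uniform_limitD)
  have "Cauchy (\<lambda>m. blinfun_poly (p m) B)"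
  proof (rule metric_CauchyI)
    fix e :: real assume e: "0 < e"
    obtain N where N: "\<And>m t. N \<le> m \<Longrightarrow> t \<in> {0..norm B} \<Longrightarrow> dist (poly (p m) t) (t powr s) < e / 3"
      using unif[OF p, of "e / 3"] e unfolding eventually_sequentially by (meson zero_less_divide_iff zero_less_numeral)
    have "dist (blinfun_poly (p k) B) (blinfun_poly (p l) B) < e" if "N \<le> k" "N \<le> l" for k l
    proof -
      have "norm (blinfun_poly (p k) B - blinfun_poly (p l) B) \<le> e / 3 + e / 3"
        by (rule nle) (use N[OF that(1)] N[OF that(2)] in \<open>smt (verit, ccfv_SIG) dist_commute dist_triangle\<close>)
      then show ?thesis using e by (simp add: dist_norm)
    qed
    then show "\<exists>N. \<forall>k\<ge>N. \<forall>l\<ge>N. dist (blinfun_poly (p k) B) (blinfun_poly (p l) B) < e" by blast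
  qed
  then obtain T where T: "(\<lambda>m. blinfun_poly (p m) B) \<longlonglongrightarrow> T" using Cauchy_convergent convergent_def by blast
  have all: "(\<lambda>m. blinfun_poly (q m) B) \<longlonglongrightarrow> T"
    if q: "uniform_limit {0..norm B} (\<lambda>m. poly (q m)) (\<lambda>t. t powr s) sequentially" for q
  proof -
    have "(\<lambda>m. blinfun_poly (q m) B - blinfun_poly (p m) B) \<longlonglongrightarrow> 0"
    proof (rule tendstoI)
      fix e :: real assume e: "0 < e"
      then have "e / 3 > 0" by simp
      from unif[OF q this] unif[OF p this]
      show "\<forall>\<^sub>F m in sequentially. dist (blinfun_poly (q m) B - blinfun_poly (p m) B) 0 < e"
      proof eventually_elim
        case (elim m)
        have "norm (blinfun_poly (q m) B - blinfun_poly (p m) B) \<le> e / 3 + e / 3"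
          by (rule nle) (use elim in \<open>smt (verit, ccfv_SIG) dist_commute dist_triangle\<close>)
        then show ?case using e by simp
      qed
    qed
    from tendsto_add[OF this T] show ?thesis by simp
  qed
  have "blinfun_powr B s = T"
    unfolding blinfun_powr_def
    by (rule the_equality) (use all p LIMSEQ_unique in blast)+
  then show thesis using that p T by blast
qed

section \<open>Discrete Volterra inequalities\<close>

text \<open>The power \<open>3/2\<close> is the decay of the increments inside an epoch: its inverse
  is summable, and the kernels of both estimates decay at least as fast.\<close>

definition wt :: "nat \<Rightarrow> real" where
  "wt j = real (Suc j) * sqrt (real (Suc j))"

lemma wt_ge_1: "1 \<le> wt j"
proof -
  have "1 * 1 \<le> real (Suc j) * sqrt (real (Suc j))" by (intro mult_mono) auto
  then show ?thesis by (simp add: wt_def)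
qed

lemma wt_pos: "0 < wt j"
  using wt_ge_1[of j] by linarith

lemma inverse_wt_le_telescope:
  assumes "x > 0"
  shows "1 / ((x + 1) * sqrt (x + 1)) \<le> 2 / sqrt x - 2 / sqrt (x + 1)"
proof -
  define a b where "a = sqrt x" and "b = sqrt (x + 1)"
  have ab: "0 < a" "a \<le> b" "b\<^sup>2 - a\<^sup>2 = 1" "b\<^sup>2 = x + 1" using assms by (auto simp: a_def b_def)
  then have b: "0 < b" by linarith
  have "1 / ((x + 1) * b) = 2 / ((b * b) * (b + b))" using b ab(4) by (simp add: power2_eq_square)
  also have "\<dots> \<le> 2 / ((a * b) * (a + b))"
    using ab b by (intro divide_left_mono mult_mono mult_pos_pos) auto
  also have "\<dots> = 2 * (b\<^sup>2 - a\<^sup>2) / ((a * b) * (a + b))" using ab(3) by simp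
  also have "\<dots> = 2 / a - 2 / b"
    using ab b by (simp add: divide_simps) (simp add: power2_eq_square algebra_simps)
  finally show ?thesis by (simp add: a_def b_def)
qed

lemma sum_inverse_wt_le: "(\<Sum>j<k. 1 / wt j) \<le> 3"
proof (cases k)
  case (Suc m)
  have "(\<Sum>j<Suc m. 1 / wt j) \<le> 3 - 2 / sqrt (real (Suc m))"
  proof (induction m)
    case (Suc m)
    have "1 / wt (Suc m) \<le> 2 / sqrt (real (Suc m)) - 2 / sqrt (real (Suc m) + 1)"
      using inverse_wt_le_telescope[of "real (Suc m)"] by (simp add: wt_def add_ac)
    with Suc show ?case by (simp add: add_ac)
  qed (simp add: wt_def)
  moreover have "0 \<le> 2 / sqrt (real (Suc m))" by simp
  ultimately show ?thesis unfolding Suc by linarith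
qed simp

lemma sum_inverse_sqrt_le: "(\<Sum>r<k. 1 / sqrt (real (Suc r))) \<le> 2 * sqrt (real k)"
proof (induction k)
  case (Suc k)
  define a b where "a = sqrt (real k)" and "b = sqrt (real (Suc k))"
  have ab: "0 \<le> a" "a \<le> b" "0 < b" "b\<^sup>2 - a\<^sup>2 = 1" by (auto simp: a_def b_def)
  have "1 = (b - a) * (b + a)" using ab(4) by (simp add: power2_eq_square algebra_simps)
  also have "\<dots> \<le> (b - a) * (2 * b)" using ab by (intro mult_left_mono) auto
  finally have "1 / b \<le> 2 * b - 2 * a" using ab(3) by (simp add: divide_simps algebra_simps)
  then show ?case using Suc by (simp add: a_def b_def)
qed simp

text \<open>The two bounds cross where \<open>Suc r\<close> is about \<open>\<mu>\<close>. Up to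
  there the inverse roots sum to \<open>2 * sqrt \<mu>\<close>, one crossing term costs
  \<open>sqrt \<mu>\<close>, and the tail another \<open>2 * sqrt \<mu>\<close>. The subtracted term
  in \<open>large\<close> lets the tail telescope.\<close>

lemma sum_min_decay_le:
  assumes "\<mu> > 0"
  shows "(\<Sum>r<k. min (1 / sqrt (real (Suc r))) (\<mu> / wt r)) \<le> 5 * sqrt \<mu>"
proof -
  define S where "S k = (\<Sum>r<k. min (1 / sqrt (real (Suc r))) (\<mu> / wt r))" for k
  have small: "S k \<le> 2 * sqrt (real k)" for k
    unfolding S_def by (rule order_trans[OF sum_mono sum_inverse_sqrt_le]) simp
  have large: "S k \<le> 5 * sqrt \<mu> - 2 * \<mu> / sqrt (real k)" if "\<mu> < real k" for k
    using that
  proof (induction k)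
    case (Suc k)
    have Sk: "S (Suc k) \<le> S k + \<mu> / wt k" unfolding S_def by simp
    have m: "\<mu> / sqrt (real (Suc k)) \<le> sqrt \<mu>"
    proof -
      have "sqrt \<mu> * sqrt \<mu> \<le> sqrt \<mu> * sqrt (real (Suc k))" using assms Suc.prems by (intro mult_left_mono) auto
      then show ?thesis using assms by (simp add: divide_simps)
    qed
    show ?case
    proof (cases "\<mu> < real k")
      case True
      then have "real k > 0" using assms by linarith
      then have "\<mu> * (1 / wt k) \<le> \<mu> * (2 / sqrt (real k) - 2 / sqrt (real (Suc k)))"
        using inverse_wt_le_telescope[of "real k"] assms by (intro mult_left_mono) (auto simp: wt_def add_ac)
      then show ?thesis using Sk Suc.IH[OF True] by (simp add: right_diff_distrib mult.commute)
    next
      case False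
      then have "sqrt (real k) \<le> sqrt \<mu>" by simp
      then have "S k \<le> 2 * sqrt \<mu>" using small[of k] by linarith
      moreover have "\<mu> / wt k \<le> \<mu> / sqrt (real (Suc k))"
        using assms unfolding wt_def by (intro divide_left_mono) auto
      ultimately show ?thesis using Sk m by linarith
    qed
  qed (use assms in simp)
  show ?thesis
  proof (cases "\<mu> < real k")
    case True
    then have "0 \<le> 2 * \<mu> / sqrt (real k)" using assms by simp
    then show ?thesis using large[OF True] unfolding S_def by linarith
  next
    case False
    then have "sqrt (real k) \<le> sqrt \<mu>" by simp
    moreover have "0 \<le> sqrt \<mu>" using assms by simp
    ultimately show ?thesis using small[of k] unfolding S_def[symmetric] by linarith
  qed
qed

section \<open>Convolutions with the inverse weight\<close>

lemma mult_inverse_sqrt_le: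
  fixes x y :: real
  assumes "x > 0" "y > 0"
  shows "1 / (x * sqrt y) \<le> 1 / (x * sqrt x) + 1 / (y * sqrt y)"
proof (cases "x \<le> y")
  case True
  then have "1 / (x * sqrt y) \<le> 1 / (x * sqrt x)" using assms by (intro divide_left_mono mult_left_mono) auto
  moreover have "0 \<le> 1 / (x * sqrt x)" "0 \<le> 1 / (y * sqrt y)" using assms by simp_all
  ultimately show ?thesis by linarith
next
  case False
  then have "1 / (x * sqrt y) \<le> 1 / (y * sqrt y)" using assms by (intro divide_left_mono mult_right_mono) auto
  moreover have "0 \<le> 1 / (x * sqrt x)" "0 \<le> 1 / (y * sqrt y)" using assms by simp_all
  ultimately show ?thesis by linarith
qed

lemma sum_inverse_wt_reindex: "(\<Sum>j<k. 1 / wt (k - Suc j)) \<le> 3"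
  using sum_inverse_wt_le[of k] sum.nat_diff_reindex[of "\<lambda>j. 1 / wt j" k] by simp

text \<open>With \<open>x = k - j\<close> and \<open>y = j + 1\<close> one has
  \<open>x + y = k + 1\<close>. Multiplying by this sum cancels one factor of each product, and what
  is left is dominated by the inverse weight at \<open>j\<close> and at the lag, both summable
  uniformly in \<open>k\<close>.\<close>

lemma convolution_wt:
  "(\<Sum>j<k. 1 / real (Suc (k - Suc j)) * (1 / wt j)) \<le> 9 / real (Suc k)"
proof -
  have "real (Suc k) * (\<Sum>j<k. 1 / real (Suc (k - Suc j)) * (1 / wt j))
      \<le> (\<Sum>j<k. 2 * (1 / wt j) + 1 / wt (k - Suc j))"
    unfolding sum_distrib_left
  proof (rule sum_mono)
    fix j assume "j \<in> {..<k}"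
    define x y where "x = real (Suc (k - Suc j))" and "y = real (Suc j)"
    have xy: "x > 0" "y > 0" "real (Suc k) = x + y" and "real (Suc k) \<le> x + y"
      using \<open>j \<in> {..<k}\<close> by (auto simp: x_def y_def)
    have "real (Suc k) * (1 / x * (1 / wt j)) = 1 / (y * sqrt y) + 1 / (x * sqrt y)"
      unfolding xy(3) wt_def y_def[symmetric] using xy by (simp add: field_simps)
    also have "\<dots> \<le> 2 * (1 / wt j) + 1 / wt (k - Suc j)"
      using mult_inverse_sqrt_le[OF xy(1,2)] unfolding wt_def y_def[symmetric] x_def[symmetric] by argo
    finally show "real (Suc k) * (1 / real (Suc (k - Suc j)) * (1 / wt j)) \<le> 2 * (1 / wt j) + 1 / wt (k - Suc j)"
      unfolding x_def .
  qed
  also have "\<dots> \<le> 2 * 3 + 3"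
    unfolding sum.distrib sum_distrib_left[symmetric]
    by (intro add_mono mult_left_mono sum_inverse_wt_le sum_inverse_wt_reindex) auto
  finally show ?thesis by (simp add: field_simps)
qed

lemma convolution_wt_sqrt:
  "(\<Sum>j<k. 1 / sqrt (real (Suc (k - Suc j))) * (1 / wt j)) \<le> 9 / sqrt (real (Suc k))"
proof -
  have "sqrt (real (Suc k)) * (\<Sum>j<k. 1 / sqrt (real (Suc (k - Suc j))) * (1 / wt j))
      \<le> (\<Sum>j<k. 2 * (1 / wt j) + 1 / wt (k - Suc j))"
    unfolding sum_distrib_left
  proof (rule sum_mono)
    fix j assume "j \<in> {..<k}"
    define x y where "x = real (Suc (k - Suc j))" and "y = real (Suc j)"
    have xy: "x > 0" "y > 0" "real (Suc k) = x + y"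
      using \<open>j \<in> {..<k}\<close> by (auto simp: x_def y_def)
    have "sqrt (real (Suc k)) \<le> sqrt x + sqrt y" unfolding xy(3) by (rule sqrt_add_le_add_sqrt) (use xy in auto)
    then have "sqrt (real (Suc k)) * (1 / sqrt x * (1 / wt j)) \<le> (sqrt x + sqrt y) * (1 / sqrt x * (1 / wt j))"
      using xy wt_pos[of j] by (intro mult_right_mono) auto
    also have "\<dots> = 1 / (y * sqrt y) + 1 / (y * sqrt x)"
      unfolding wt_def y_def[symmetric] using xy by (simp add: field_simps)
    also have "\<dots> \<le> 2 * (1 / wt j) + 1 / wt (k - Suc j)"
      using mult_inverse_sqrt_le[OF xy(2,1)] unfolding wt_def y_def[symmetric] x_def[symmetric] by argo
    finally show "sqrt (real (Suc k)) * (1 / sqrt (real (Suc (k - Suc j))) * (1 / wt j)) \<le> 2 * (1 / wt j) + 1 / wt (k - Suc j)"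
      unfolding x_def .
  qed
  also have "\<dots> \<le> 2 * 3 + 3"
    unfolding sum.distrib sum_distrib_left[symmetric]
    by (intro add_mono mult_left_mono sum_inverse_wt_le sum_inverse_wt_reindex) auto
  finally show ?thesis by (simp add: field_simps)
qed

text \<open>The asymmetry is the point: the constant at \<open>wt (K - m)\<close> is as close to one
  as desired, so that multiplied by a kernel mass below one it can still be absorbed. The large
  constant only meets \<open>wt m\<close>, which the decay of the kernel pays for.\<close>

lemma wt_quasi_subadditive:
  assumes e: "0 < e" and m: "m \<le> K"
  shows "wt K \<le> (1 + e)\<^sup>2 * wt (K - m) + (1 + 1 / e)\<^sup>2 * wt m"
proof -
  define x y where "x = real (Suc (K - m))" and "y = real (Suc m)"
  have xy: "x > 0" "y > 0" "real (Suc K) \<le> x + y" using m by (auto simp: x_def y_def)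
  have scale: "wt K \<le> c\<^sup>2 * (z * sqrt z)" if "real (Suc K) \<le> c * z" "1 \<le> c" "0 < z" for c z
  proof -
    have "wt K \<le> (c * z) * sqrt (c * z)" unfolding wt_def using that by (intro mult_mono) auto
    also have "\<dots> = (c * sqrt c) * (z * sqrt z)" by (simp add: real_sqrt_mult mult_ac)
    also have "\<dots> \<le> (c * c) * (z * sqrt z)"
    proof (intro mult_right_mono mult_left_mono)
      show "sqrt c \<le> c" using that(2) by (intro real_le_lsqrt) (auto simp: power2_eq_square intro: mult_left_mono[of 1 c c, simplified])
    qed (use that in auto)
    finally show ?thesis by (simp add: power2_eq_square)
  qed
  show ?thesis
  proof (cases "y \<le> e * x")
    case True
    then have "real (Suc K) \<le> (1 + e) * x" using xy(3) by (simp add: algebra_simps)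
    from scale[OF this] e xy have "wt K \<le> (1 + e)\<^sup>2 * wt (K - m)" by (simp add: wt_def x_def)
    moreover have "0 \<le> (1 + 1 / e)\<^sup>2 * wt m" using wt_pos[of m] by simp
    ultimately show ?thesis by linarith
  next
    case False
    then have "x \<le> y / e" using e by (simp add: field_simps)
    then have "real (Suc K) \<le> (1 + 1 / e) * y" using xy(3) by (simp add: algebra_simps)
    from scale[OF this] e xy have "wt K \<le> (1 + 1 / e)\<^sup>2 * wt m" by (simp add: wt_def y_def)
    moreover have "0 \<le> (1 + e)\<^sup>2 * wt (K - m)" using wt_pos[of "K - m"] by simp
    ultimately show ?thesis by linarith
  qed
qed

section \<open>Absorbing a kernel of mass below one\<close>

lemma sum_convolution_le:
  fixes \<rho> u :: "nat \<Rightarrow> real"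
  assumes "\<And>m. 0 \<le> \<rho> m" "\<And>m. 0 \<le> u m"
  shows "(\<Sum>K\<le>N. \<Sum>m\<le>K. \<rho> m * u (K - m)) \<le> (\<Sum>m\<le>N. \<rho> m) * (\<Sum>K\<le>N. u K)"
proof -
  have "(\<Sum>K\<le>N. \<Sum>m\<le>K. \<rho> m * u (K - m)) = (\<Sum>(m, l)\<in>{(m, l). m + l \<le> N}. \<rho> m * u l)"
    by (rule sum.triangle_reindex_eq[symmetric])
  also have "\<dots> \<le> (\<Sum>(m, l)\<in>{..N} \<times> {..N}. \<rho> m * u l)"
    by (rule sum_mono2) (use assms in auto)
  also have "\<dots> = (\<Sum>m\<le>N. \<rho> m) * (\<Sum>K\<le>N. u K)"
    by (simp add: sum_product sum.cartesian_product)
  finally show ?thesis .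
qed

text \<open>The sequence is summable because the kernel has mass below one; quasi-subadditivity of the
  weight then transfers the decay of the kernel and of the forcing to the solution.\<close>

lemma volterra_decay_without_constant:
  fixes \<rho> u :: "nat \<Rightarrow> real"
  assumes q: "0 \<le> q" "q < 1" and R: "0 \<le> R"
    and \<rho>: "\<And>m. 0 \<le> \<rho> m" "\<And>m. \<rho> m * wt m \<le> R" "\<And>N. (\<Sum>m\<le>N. \<rho> m) \<le> q"
    and u: "\<And>K. 0 \<le> u K" "\<And>K. u K \<le> \<Phi> / wt K + (\<Sum>m\<le>K. \<rho> m * u (K - m))"
    and \<Phi>: "0 \<le> \<Phi>"
  defines "e \<equiv> (1 - q) / 6"
  shows "wt K * u K \<le> \<Phi> * ((1 + (1 + 1 / e)\<^sup>2 * R * (3 / (1 - q))) * (2 / (1 - q)))"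
proof -
  have e: "0 < e" "e \<le> 1" using q by (auto simp: e_def)
  have U: "(\<Sum>l\<le>N. u l) \<le> 3 * \<Phi> / (1 - q)" for N
  proof -
    have "(\<Sum>l\<le>N. u l) \<le> (\<Sum>l\<le>N. \<Phi> / wt l) + (\<Sum>l\<le>N. \<Sum>m\<le>l. \<rho> m * u (l - m))"
      unfolding sum.distrib[symmetric] by (intro sum_mono u)
    also have "(\<Sum>l\<le>N. \<Phi> / wt l) = \<Phi> * (\<Sum>l<Suc N. 1 / wt l)"
      by (simp add: sum_distrib_left lessThan_Suc_atMost)
    also have "\<dots> \<le> \<Phi> * 3" by (intro mult_left_mono sum_inverse_wt_le \<Phi>)
    also have "(\<Sum>l\<le>N. \<Sum>m\<le>l. \<rho> m * u (l - m)) \<le> (\<Sum>m\<le>N. \<rho> m) * (\<Sum>l\<le>N. u l)"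
      by (intro sum_convolution_le \<rho> u)
    also have "\<dots> \<le> q * (\<Sum>l\<le>N. u l)" by (intro mult_right_mono \<rho> sum_nonneg u)
    finally have "(\<Sum>l\<le>N. u l) * (1 - q) \<le> 3 * \<Phi>" by (simp add: algebra_simps)
    then show ?thesis using q by (simp add: le_divide_eq)
  qed
  define c where "c = (1 + 1 / e)\<^sup>2"
  have c: "0 \<le> c" by (simp add: c_def)
  \<comment> \<open>A maximum over a finite window is finite a priori, hence may be absorbed into
    the left side; the final bound does not depend on the window.\<close>
  define S where "S = Max ((\<lambda>l. wt l * u l) ` {..K})"
  have S: "wt l * u l \<le> S" if "l \<le> K" for l using that by (auto simp: S_def)
  have S0: "0 \<le> S" using S[of K] u(1)[of K] wt_pos[of K] by (meson order.trans order_refl mult_nonneg_nonneg less_imp_le)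
  have bound: "wt l * u l \<le> \<Phi> + (1 + q) / 2 * S + c * R * (3 * \<Phi> / (1 - q))" if l: "l \<le> K" for l
  proof -
    have "wt l * u l \<le> wt l * (\<Phi> / wt l + (\<Sum>m\<le>l. \<rho> m * u (l - m)))"
      using u(2)[of l] wt_pos[of l] by (intro mult_left_mono) auto
    also have "\<dots> = \<Phi> + (\<Sum>m\<le>l. wt l * (\<rho> m * u (l - m)))"
      using wt_pos[of l] by (simp add: distrib_left sum_distrib_left)
    also have "(\<Sum>m\<le>l. wt l * (\<rho> m * u (l - m)))
        \<le> (\<Sum>m\<le>l. (1 + e)\<^sup>2 * S * \<rho> m + c * R * u (l - m))"
    proof (rule sum_mono)
      fix m assume "m \<in> {..l}"
      then have "wt l * (\<rho> m * u (l - m)) \<le> ((1 + e)\<^sup>2 * wt (l - m) + c * wt m) * (\<rho> m * u (l - m))"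
        unfolding c_def using \<rho> u e by (intro mult_right_mono wt_quasi_subadditive mult_nonneg_nonneg) auto
      also have "\<dots> = (1 + e)\<^sup>2 * (wt (l - m) * u (l - m)) * \<rho> m + c * (\<rho> m * wt m) * u (l - m)"
        by (simp add: algebra_simps)
      also have "\<dots> \<le> (1 + e)\<^sup>2 * S * \<rho> m + c * R * u (l - m)"
        using \<rho> u c l by (intro add_mono mult_right_mono mult_left_mono S) auto
      finally show "wt l * (\<rho> m * u (l - m)) \<le> (1 + e)\<^sup>2 * S * \<rho> m + c * R * u (l - m)" .
    qed
    also have "\<dots> = (1 + e)\<^sup>2 * S * (\<Sum>m\<le>l. \<rho> m) + c * R * (\<Sum>m\<le>l. u m)"
      using sum.nat_diff_reindex[of u "Suc l"]
      by (simp add: sum.distrib lessThan_Suc_atMost flip: sum_distrib_left)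
    also have "\<dots> \<le> (1 + e)\<^sup>2 * S * q + c * R * (3 * \<Phi> / (1 - q))"
      using S0 c R by (intro add_mono mult_left_mono \<rho> U mult_nonneg_nonneg) auto
    \<comment> \<open>The reason for \<open>e = (1 - q) / 6\<close>: the factor
      \<open>(1 + e)\<^sup>2 \<le> 1 + 3 * e\<close> raises the mass from \<open>q\<close> at most
      to the midpoint between \<open>q\<close> and one.\<close>
    also have "(1 + e)\<^sup>2 * S * q \<le> (1 + q) / 2 * S"
    proof -
      have "(1 + e)\<^sup>2 \<le> 1 + 3 * e" using e by (simp add: power2_eq_square algebra_simps mult_left_le)
      then have "(1 + e)\<^sup>2 * q \<le> (1 + 3 * e) * q" using q by (intro mult_right_mono) auto
      also have "\<dots> = q + q * (1 - q) / 2" unfolding e_def by (simp add: field_simps)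
      also have "\<dots> \<le> q + 1 * (1 - q) / 2" using q by (intro add_left_mono divide_right_mono mult_right_mono) auto
      finally have "(1 + e)\<^sup>2 * q * S \<le> (1 + q) / 2 * S" using S0 by (intro mult_right_mono) (auto simp: field_simps)
      then show ?thesis by (simp add: mult_ac)
    qed
    finally show ?thesis by simp
  qed
  have "S \<le> \<Phi> + (1 + q) / 2 * S + c * R * (3 * \<Phi> / (1 - q))"
    unfolding S_def using bound[unfolded S_def] by (subst Max_le_iff) auto
  then have "S * ((1 - q) / 2) \<le> \<Phi> * (1 + c * R * (3 / (1 - q)))" by (simp add: field_simps)
  then have "S \<le> \<Phi> * (1 + c * R * (3 / (1 - q))) / ((1 - q) / 2)" using q by (subst pos_le_divide_eq) auto
  also have "\<dots> = \<Phi> * ((1 + c * R * (3 / (1 - q))) * (2 / (1 - q)))" by simp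
  finally show ?thesis using S[of K] unfolding c_def by simp
qed

lemma volterra_decay:
  fixes q R :: real
  assumes q: "0 \<le> q" "q < 1" and R: "0 \<le> R"
  shows "\<exists>C\<ge>0. \<forall>(\<rho> :: nat \<Rightarrow> real) u \<Phi> D.
    (\<forall>m. 0 \<le> \<rho> m \<and> \<rho> m * wt m \<le> R) \<and> (\<forall>N. (\<Sum>m\<le>N. \<rho> m) \<le> q) \<and> 0 \<le> \<Phi> \<and> 0 \<le> D \<and>
    (\<forall>K. 0 \<le> u K \<and> u K \<le> \<Phi> / wt K + D + (\<Sum>m\<le>K. \<rho> m * u (K - m)))
    \<longrightarrow> (\<forall>K. u K \<le> C * (\<Phi> / wt K + D))"
proof -
  define C0 where "C0 = ((1 + (1 + 1 / ((1 - q) / 6))\<^sup>2 * R * (3 / (1 - q))) * (2 / (1 - q)))"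
  have C0: "0 \<le> C0" unfolding C0_def using q R by auto
  define C where "C = max C0 (1 / (1 - q))"
  show ?thesis
  proof (intro exI[of _ C] conjI allI impI)
    show "0 \<le> C" using C0 by (simp add: C_def)
    fix \<rho> u :: "nat \<Rightarrow> real" and \<Phi> D K
    assume "(\<forall>m. 0 \<le> \<rho> m \<and> \<rho> m * wt m \<le> R) \<and> (\<forall>N. (\<Sum>m\<le>N. \<rho> m) \<le> q) \<and> 0 \<le> \<Phi> \<and> 0 \<le> D \<and>
      (\<forall>K. 0 \<le> u K \<and> u K \<le> \<Phi> / wt K + D + (\<Sum>m\<le>K. \<rho> m * u (K - m)))"
    then have \<rho>: "\<And>m. 0 \<le> \<rho> m" "\<And>m. \<rho> m * wt m \<le> R" "\<And>N. (\<Sum>m\<le>N. \<rho> m) \<le> q"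
      and \<Phi>: "0 \<le> \<Phi>" and D: "0 \<le> D"
      and u: "\<And>K. 0 \<le> u K" "\<And>K. u K \<le> \<Phi> / wt K + D + (\<Sum>m\<le>K. \<rho> m * u (K - m))" by auto
    \<comment> \<open>\<open>D'\<close> solves the stationary equation
      \<open>D + q * D' = D'\<close>. Subtracting it removes the constant forcing, and the positive
      part restores nonnegativity without spoiling the inequality.\<close>
    define D' where "D' = D / (1 - q)"
    have D': "0 \<le> D'" "D + q * D' = D'" using D q by (auto simp: D'_def field_simps)
    define v where "v K = max 0 (u K - D')" for K
    have v: "v K \<le> \<Phi> / wt K + (\<Sum>m\<le>K. \<rho> m * v (K - m))" for K
    proof -
      have "(\<Sum>m\<le>K. \<rho> m * u (K - m)) \<le> (\<Sum>m\<le>K. \<rho> m * v (K - m) + \<rho> m * D')"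
        unfolding distrib_left[symmetric] using \<rho> by (intro sum_mono mult_left_mono) (auto simp: v_def)
      also have "\<dots> = (\<Sum>m\<le>K. \<rho> m * v (K - m)) + (\<Sum>m\<le>K. \<rho> m) * D'"
        by (simp add: sum.distrib sum_distrib_right)
      also have "\<dots> \<le> (\<Sum>m\<le>K. \<rho> m * v (K - m)) + q * D'"
        using \<rho> D' by (intro add_left_mono mult_right_mono) auto
      finally have "u K - D' \<le> \<Phi> / wt K + (\<Sum>m\<le>K. \<rho> m * v (K - m))"
        using u(2)[of K] D'(2) by linarith
      moreover have "0 \<le> \<Phi> / wt K + (\<Sum>m\<le>K. \<rho> m * v (K - m))"
        using \<Phi> wt_pos[of K] \<rho> by (intro add_nonneg_nonneg sum_nonneg mult_nonneg_nonneg divide_nonneg_nonneg) (auto simp: v_def)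
      ultimately show ?thesis by (simp add: v_def)
    qed
    have "wt K * v K \<le> \<Phi> * C0"
      unfolding C0_def by (rule volterra_decay_without_constant[OF q R \<rho> _ v \<Phi>]) (simp add: v_def)
    then have "v K \<le> C0 * (\<Phi> / wt K)" using wt_pos[of K] by (simp add: field_simps)
    also have "\<dots> \<le> C * (\<Phi> / wt K)" using \<Phi> wt_pos[of K] by (intro mult_right_mono) (auto simp: C_def)
    finally have "u K \<le> C * (\<Phi> / wt K) + D'" by (simp add: v_def)
    also have "D' = (1 / (1 - q)) * D" by (simp add: D'_def)
    also have "\<dots> \<le> C * D" using D by (intro mult_right_mono) (auto simp: C_def)
    finally show "u K \<le> C * (\<Phi> / wt K + D)" by (simp add: distrib_left)
  qed
qed

text \<open>Lags are measured to the current step inside the running epoch, but to the start of that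
  epoch for older \<open>j\<close>. Both sums therefore begin at lag zero, and the first block of
  \<open>M\<close> lags enters the mass twice. Maximising over each epoch gives a recursion over
  epochs; returning to single steps costs at most \<open>(real M)\<^sup>2\<close>, because
  \<open>Suc j\<close> is at most \<open>M\<close> times \<open>Suc (j div M)\<close>.\<close>

lemma epoch_decay:
  fixes q R :: real and M :: nat
  assumes q: "0 \<le> q" "q < 1" and R: "0 \<le> R" and M: "M \<ge> 1"
  shows "\<exists>C\<ge>0. \<forall>(ker :: nat \<Rightarrow> real) d \<Phi> D.
    (\<forall>r. 0 \<le> ker r) \<and> (\<forall>N. (\<Sum>r<M. ker r) + (\<Sum>r<N*M. ker r) \<le> q) \<and>
    (\<forall>m. (\<Sum>r<M. ker (m*M + r)) * wt (Suc m) \<le> R) \<and> 0 \<le> \<Phi> \<and> 0 \<le> D \<and> (\<forall>j. 0 \<le> d j) \<and>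
    (\<forall>K t. t < M \<longrightarrow> d (K*M + t) \<le> \<Phi> / wt K + D + (\<Sum>j<K*M. ker (K*M - Suc j) * d j)
       + (\<Sum>s<t. ker (t - Suc s) * d (K*M + s)))
    \<longrightarrow> (\<forall>j. d j \<le> C * (\<Phi> / wt j + D))"
proof -
  have "0 \<le> max q R" using R by simp
  from volterra_decay[OF q this] obtain C where C0: "C \<ge> 0" and C: "\<forall>(\<rho> :: nat \<Rightarrow> real) u \<Phi> D.
    (\<forall>m. 0 \<le> \<rho> m \<and> \<rho> m * wt m \<le> max q R) \<and> (\<forall>N. (\<Sum>m\<le>N. \<rho> m) \<le> q) \<and> 0 \<le> \<Phi> \<and> 0 \<le> D \<and>
    (\<forall>K. 0 \<le> u K \<and> u K \<le> \<Phi> / wt K + D + (\<Sum>m\<le>K. \<rho> m * u (K - m)))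
    \<longrightarrow> (\<forall>K. u K \<le> C * (\<Phi> / wt K + D))" by (elim exE conjE)
  show ?thesis
  proof (intro exI[of _ "C * (real M)\<^sup>2"] conjI allI impI)
    show "0 \<le> C * (real M)\<^sup>2" using C0 by simp
    fix ker d :: "nat \<Rightarrow> real" and \<Phi> D j
    assume "(\<forall>r. 0 \<le> ker r) \<and> (\<forall>N. (\<Sum>r<M. ker r) + (\<Sum>r<N*M. ker r) \<le> q) \<and>
      (\<forall>m. (\<Sum>r<M. ker (m*M + r)) * wt (Suc m) \<le> R) \<and> 0 \<le> \<Phi> \<and> 0 \<le> D \<and> (\<forall>j. 0 \<le> d j) \<and>
      (\<forall>K t. t < M \<longrightarrow> d (K*M + t) \<le> \<Phi> / wt K + D + (\<Sum>j<K*M. ker (K*M - Suc j) * d j)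
         + (\<Sum>s<t. ker (t - Suc s) * d (K*M + s)))"
    then have ker: "\<And>r. 0 \<le> ker r" "\<And>N. (\<Sum>r<M. ker r) + (\<Sum>r<N*M. ker r) \<le> q"
        "\<And>m. (\<Sum>r<M. ker (m*M + r)) * wt (Suc m) \<le> R"
      and \<Phi>: "0 \<le> \<Phi>" and D: "0 \<le> D" and d: "\<And>j. 0 \<le> d j"
        "\<And>K t. t < M \<Longrightarrow> d (K*M + t) \<le> \<Phi> / wt K + D + (\<Sum>j<K*M. ker (K*M - Suc j) * d j)
         + (\<Sum>s<t. ker (t - Suc s) * d (K*M + s))" by auto
    \<comment> \<open>Index \<open>0\<close> belongs to the running epoch and \<open>Suc m\<close>
      to the one \<open>m + 1\<close> epochs earlier, so \<open>\<rho> 0\<close> and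
      \<open>\<rho> 1\<close> are the same block of lags.\<close>
    define \<rho> where "\<rho> m = (case m of 0 \<Rightarrow> \<Sum>r<M. ker r | Suc m \<Rightarrow> \<Sum>r<M. ker (m*M + r))" for m
    define u where "u K = Max ((\<lambda>t. d (K*M + t)) ` {..<M})" for K
    have u_ge: "d (K*M + t) \<le> u K" if "t < M" for K t
      unfolding u_def using that by (intro Max_ge) auto
    have u0: "0 \<le> u K" for K using u_ge[of 0 K] d(1)[of "K*M + 0"] M by linarith
    have \<rho>0: "0 \<le> \<rho> m" for m unfolding \<rho>_def by (cases m) (auto intro: sum_nonneg ker)
    have grp: "(\<Sum>m<N. \<Sum>r<M. f (m*M + r)) = (\<Sum>r<N*M. f r)" for f :: "nat \<Rightarrow> real" and N
    proof -
      have "(\<Sum>r<M. f (m*M + r)) = sum f {m*M..<m*M+M}" for m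
        using sum.shift_bounds_nat_ivl[of f 0 "m*M" M] by (simp add: add.commute lessThan_atLeast0)
      then show ?thesis using sum.nat_group[of f M N] by simp
    qed
    have \<rho>sum: "(\<Sum>m\<le>N. \<rho> m) \<le> q" for N
    proof -
      have "(\<Sum>m\<le>N. \<rho> m) = \<rho> 0 + (\<Sum>m<N. \<rho> (Suc m))"
        by (simp add: sum.atMost_shift)
      also have "\<dots> = (\<Sum>r<M. ker r) + (\<Sum>r<N*M. ker r)" by (simp add: \<rho>_def grp)
      finally show ?thesis using ker(2) by simp
    qed
    have \<rho>wt: "\<rho> m * wt m \<le> max q R" for m
    proof (cases m)
      case 0
      have "\<rho> 0 \<le> q" using \<rho>sum[of 0] by simp
      then show ?thesis using 0 by (simp add: wt_def)
    next
      case (Suc m')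
      then show ?thesis using ker(3)[of m'] by (simp add: \<rho>_def le_max_iff_disj)
    qed
    have rec: "u K \<le> \<Phi> / wt K + D + (\<Sum>m\<le>K. \<rho> m * u (K - m))" for K
    proof -
      have past: "(\<Sum>j<K*M. ker (K*M - Suc j) * d j) \<le> (\<Sum>m<K. \<rho> (Suc m) * u (K - Suc m))"
      proof -
        have "(\<Sum>j<K*M. ker (K*M - Suc j) * d j) = (\<Sum>m<K. \<Sum>t<M. ker (K*M - Suc (m*M + t)) * d (m*M + t))"
          by (rule grp[symmetric])
        also have "\<dots> \<le> (\<Sum>m<K. \<Sum>t<M. ker (K*M - Suc (m*M + t)) * u m)"
          by (intro sum_mono mult_left_mono u_ge ker) auto
        also have "\<dots> = (\<Sum>m<K. \<rho> (Suc (K - Suc m)) * u m)"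
        proof (rule sum.cong[OF refl])
          fix m assume m: "m \<in> {..<K}"
          have "(\<Sum>t<M. ker (K*M - Suc (m*M + t))) = (\<Sum>t<M. ker ((K - Suc m)*M + (M - Suc t)))"
          proof (rule sum.cong[OF refl])
            fix t assume t: "t \<in> {..<M}"
            obtain p where p: "K = Suc m + p" using m by (auto simp: Suc_le_eq[symmetric] le_iff_add)
            have "K*M - Suc (m*M + t) = (K - Suc m)*M + (M - Suc t)" using t unfolding p by (simp add: algebra_simps)
            then show "ker (K*M - Suc (m*M + t)) = ker ((K - Suc m)*M + (M - Suc t))" by simp
          qed
          also have "\<dots> = \<rho> (Suc (K - Suc m))"
            using sum.nat_diff_reindex[of "\<lambda>r. ker ((K - Suc m)*M + r)" M] by (simp add: \<rho>_def)
          finally show "(\<Sum>t<M. ker (K*M - Suc (m*M + t)) * u m) = \<rho> (Suc (K - Suc m)) * u m"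
            by (simp add: sum_distrib_right[symmetric])
        qed
        also have "\<dots> = (\<Sum>i<K. (\<lambda>m. \<rho> (Suc m) * u (K - Suc m)) (K - Suc i))" by (rule sum.cong) auto
        also have "\<dots> = (\<Sum>m<K. \<rho> (Suc m) * u (K - Suc m))" by (rule sum.nat_diff_reindex)
        finally show ?thesis .
      qed
      have now: "(\<Sum>s<t. ker (t - Suc s) * d (K*M + s)) \<le> \<rho> 0 * u K" if t: "t < M" for t
      proof -
        have "(\<Sum>s<t. ker (t - Suc s) * d (K*M + s)) \<le> (\<Sum>s<t. ker (t - Suc s) * u K)"
          using t by (intro sum_mono mult_left_mono u_ge ker) auto
        also have "\<dots> = (\<Sum>s<t. ker s) * u K"
          using sum.nat_diff_reindex[of ker t] by (simp add: sum_distrib_right[symmetric])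
        also have "\<dots> \<le> \<rho> 0 * u K"
          unfolding \<rho>_def using t by (auto intro!: mult_right_mono sum_mono2 u0 ker)
        finally show ?thesis .
      qed
      have "d (K*M + t) \<le> \<Phi> / wt K + D + (\<Sum>m\<le>K. \<rho> m * u (K - m))" if t: "t < M" for t
        using d(2)[OF t, of K] past now[OF t] by (simp add: sum.atMost_shift)
      then show ?thesis unfolding u_def using M by (subst Max_le_iff) (auto simp: lessThan_empty_iff)
    qed
    have "d j = d (j div M * M + j mod M)" by simp
    also have "\<dots> \<le> u (j div M)" using M by (intro u_ge) auto
    also have "\<dots> \<le> C * (\<Phi> / wt (j div M) + D)"
      by (rule C[rule_format, of \<rho>]) (intro conjI allI \<rho>0 \<rho>wt \<rho>sum \<Phi> D u0 rec)
    also have "\<dots> \<le> C * ((real M)\<^sup>2 * (\<Phi> / wt j + D))"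
    proof (rule mult_left_mono[OF _ C0])
      have "Suc j \<le> M * Suc (j div M)"
        using dividend_less_times_div[of M j] M by simp
      then have le: "real (Suc j) \<le> real M * real (Suc (j div M))" by (metis of_nat_mono of_nat_mult)
      have "wt j \<le> (real M * real (Suc (j div M))) * sqrt (real M * real (Suc (j div M)))"
        unfolding wt_def using le by (intro mult_mono) auto
      also have "\<dots> = (real M * sqrt (real M)) * wt (j div M)" by (simp add: wt_def real_sqrt_mult mult_ac)
      also have "\<dots> \<le> (real M * real M) * wt (j div M)"
        using M wt_pos[of "j div M"] by (intro mult_right_mono mult_left_mono real_le_lsqrt) (auto simp: power2_eq_square intro: mult_left_mono[of 1 "real M" "real M", simplified])
      finally have "\<Phi> * wt j \<le> \<Phi> * ((real M)\<^sup>2 * wt (j div M))" using \<Phi> by (intro mult_left_mono) (auto simp: power2_eq_square)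
      then have "\<Phi> / wt (j div M) \<le> (real M)\<^sup>2 * (\<Phi> / wt j)" using wt_pos[of j] wt_pos[of "j div M"] by (simp add: field_simps)
      moreover have "D \<le> (real M)\<^sup>2 * D" using D M by (simp add: mult_right_mono[of 1 _ D, simplified] one_le_power)
      ultimately show "\<Phi> / wt (j div M) + D \<le> (real M)\<^sup>2 * (\<Phi> / wt j + D)" by (simp add: distrib_left)
    qed
    finally show "d j \<le> C * (real M)\<^sup>2 * (\<Phi> / wt j + D)" by (simp add: mult_ac)
  qed
qed

section \<open>The stochastic recursion\<close>

text \<open>The constant is chosen before the operator, hence it is uniform in the noise level although the
  truncated operator varies.\<close>

definition epoch_const :: "nat \<Rightarrow> real \<Rightarrow> real \<Rightarrow> bool" where
  "epoch_const M R C \<longleftrightarrow> (\<forall>(ker :: nat \<Rightarrow> real) d \<Phi> D.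
    (\<forall>r. 0 \<le> ker r) \<and> (\<forall>N. (\<Sum>r<M. ker r) + (\<Sum>r<N*M. ker r) \<le> 1 / 2) \<and>
    (\<forall>m. (\<Sum>r<M. ker (m*M + r)) * wt (Suc m) \<le> R) \<and> 0 \<le> \<Phi> \<and> 0 \<le> D \<and> (\<forall>j. 0 \<le> d j) \<and>
    (\<forall>K t. t < M \<longrightarrow> d (K*M + t) \<le> \<Phi> / wt K + D + (\<Sum>j<K*M. ker (K*M - Suc j) * d j)
       + (\<Sum>s<t. ker (t - Suc s) * d (K*M + s)))
    \<longrightarrow> (\<forall>j. d j \<le> C * (\<Phi> / wt j + D)))"

lemma epoch_const_exists: "0 \<le> R \<Longrightarrow> M \<ge> 1 \<Longrightarrow> \<exists>C\<ge>0. epoch_const M R C"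
  unfolding epoch_const_def using epoch_decay[of "1/2" R M] by simp

section \<open>Kernel sums and bounds for \<open>s ^ p * (1 - s) ^ m\<close>\<close>

lemma sum_kernel_blocks:
  fixes f :: "nat \<Rightarrow> real"
  shows "(\<Sum>r<Suc N * M. f r) = (\<Sum>r<M. f r) + (\<Sum>m=1..N. \<Sum>r<M. f (m*M + r))"
proof (induction N)
  case (Suc N)
  have "(\<Sum>r<Suc (Suc N) * M. f r) = (\<Sum>r<Suc N * M. f r) + sum f {Suc N * M..<Suc N * M + M}"
    using sum.atLeastLessThan_concat[of 0 "Suc N * M" "Suc N * M + M" f]
    by (simp add: lessThan_atLeast0 add.commute)
  also have "sum f {Suc N * M..<Suc N * M + M} = (\<Sum>r<M. f (Suc N * M + r))"
    using sum.shift_bounds_nat_ivl[of f 0 "Suc N * M" M] by (simp add: add.commute lessThan_atLeast0)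
  finally show ?case using Suc by simp
qed simp

lemma kernel_mass_le:
  fixes ker :: "nat \<Rightarrow> real"
  assumes "\<And>r. 0 \<le> ker r" "\<And>N. 2 * (\<Sum>r<M. ker r) + (\<Sum>m=1..N. \<Sum>r<M. ker (m*M + r)) \<le> q"
  shows "(\<Sum>r<M. ker r) + (\<Sum>r<N*M. ker r) \<le> q"
proof (cases N)
  case 0
  have "0 \<le> (\<Sum>r<M. ker r)" by (intro sum_nonneg assms)
  then show ?thesis using assms(2)[of 0] 0 by simp
next
  case (Suc N')
  then show ?thesis using assms(2)[of N'] unfolding Suc sum_kernel_blocks by simp
qed

lemma sum_inverse_square_tail:
  assumes "P \<ge> 1"
  shows "(\<Sum>m=Suc P..N. 1 / (real m)\<^sup>2) \<le> 1 / real P"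
proof (cases "P \<le> N")
  case True
  then have "(\<Sum>m=Suc P..N. 1 / (real m)\<^sup>2) \<le> 1 / real P - 1 / real N"
  proof (induction N rule: dec_induct)
    case (step N)
    have N: "real N > 0" using step assms by auto
    have "1 / (real (Suc N))\<^sup>2 \<le> 1 / (real N * real (Suc N))"
      using N by (intro divide_left_mono) (auto simp: power2_eq_square intro!: mult_right_mono)
    also have "\<dots> = 1 / real N - 1 / real (Suc N)" using N by (simp add: divide_simps)
    finally show ?case using step by simp
  qed simp
  then show ?thesis by (smt (verit) divide_nonneg_nonneg of_nat_0_le_iff)
qed (use assms in auto)

lemma sum_inverse_square_le: "(\<Sum>m=1..N. 1 / (real m)\<^sup>2) \<le> 2"
proof (cases N)
  case (Suc N')
  then have "(\<Sum>m=1..N. 1 / (real m)\<^sup>2) = 1 + (\<Sum>m=Suc 1..N. 1 / (real m)\<^sup>2)"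
    by (subst sum.atLeast_Suc_atMost) auto
  then show ?thesis using sum_inverse_square_tail[of 1 N] by simp
qed simp

lemma sum_inverse_le_ln:
  assumes "N \<ge> 1"
  shows "(\<Sum>m=1..N. 1 / real m) \<le> 1 + ln (real N)"
  using assms
proof (induction N rule: dec_induct)
  case (step N)
  have N: "real N > 0" using step by auto
  have "ln (real N / real (Suc N)) \<le> real N / real (Suc N) - 1" using N by (intro ln_le_minus_one) auto
  moreover have "ln (real N / real (Suc N)) = ln (real N) - ln (real (Suc N))" using N by (simp add: ln_div)
  moreover have "real N / real (Suc N) - 1 = - (1 / real (Suc N))" by (simp add: divide_simps)
  ultimately show ?case using step by simp
qed simp

text \<open>The exact maximum is \<open>exp (-1)\<close>, attained at \<open>y = 1\<close>;
  \<open>2 / 5\<close> is a rational substitute from the quadratic Taylor bound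
  \<open>exp 1 \<ge> 5 / 2\<close>.\<close>

lemma mult_exp_minus_le: "y * exp (- y) \<le> 2 / (5::real)"
proof -
  have e: "5 / 2 \<le> exp (1::real)" using exp_lower_Taylor_quadratic[of 1] by simp
  have "y \<le> exp (y - 1)" using exp_ge_add_one_self[of "y - 1"] by simp
  then have "y * exp (- y) \<le> exp (y - 1) * exp (- y)" by (intro mult_right_mono) auto
  also have "\<dots> = 1 / exp 1" by (simp add: exp_diff exp_minus divide_simps)
  also have "\<dots> \<le> 1 / (5 / 2)" using e by (intro divide_left_mono) auto
  finally show ?thesis by simp
qed

text \<open>\<open>1 - s \<le> exp (- s)\<close> reduces the claim to the \<open>p\<close>-th power
  of \<open>mult_exp_minus_le\<close> at \<open>y = s * m / p\<close>.\<close>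

lemma power_mult_power_le:
  fixes s :: real
  assumes s: "0 \<le> s" "s \<le> 1" and p: "p \<ge> 1" and m: "m \<ge> 1"
  shows "s ^ p * (1 - s) ^ m \<le> (2 * real p / (5 * real m)) ^ p"
proof -
  define y where "y = s * real m / real p"
  have pm: "real p > 0" "real m > 0" using p m by auto
  have "(1 - s) ^ m \<le> exp (- s) ^ m" using s exp_ge_add_one_self[of "- s"] by (intro power_mono) auto
  also have "\<dots> = exp (- y) ^ p" using pm by (simp add: y_def flip: exp_of_nat_mult)
  finally have "s ^ p * (1 - s) ^ m \<le> s ^ p * exp (- y) ^ p" using s by (intro mult_left_mono) auto
  also have "\<dots> = (real p / real m * (y * exp (- y))) ^ p"
    using pm by (simp add: y_def flip: power_mult_distrib)
  also have "\<dots> \<le> (real p / real m * (2 / 5)) ^ p"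
    using pm s by (intro power_mono mult_left_mono mult_exp_minus_le) (auto simp: y_def)
  finally show ?thesis by (simp add: mult_ac)
qed

text \<open>The powers decrease, so \<open>m + 1\<close> copies of the last term are at most a
  geometric sum, which telescopes. In contrast to \<open>power_mult_power_le\<close> this covers
  \<open>m = 0\<close>.\<close>

lemma mult_power_le_inverse:
  fixes s :: real
  assumes s: "0 \<le> s" "s \<le> 1"
  shows "s * (1 - s) ^ m \<le> 1 / real (Suc m)"
proof -
  have "real (Suc m) * (s * (1 - s) ^ m) = (\<Sum>j<Suc m. s * (1 - s) ^ m)" by simp
  also have "\<dots> \<le> (\<Sum>j<Suc m. s * (1 - s) ^ j)"
    using s by (intro sum_mono mult_left_mono power_decreasing) auto
  also have "\<dots> = 1 - (1 - s) ^ Suc m"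
    using one_diff_power_eq[of "1 - s" "Suc m"]
    by (simp del: sum.lessThan_Suc power_Suc flip: sum_distrib_left)
  also have "\<dots> \<le> 1" using s by simp
  finally show ?thesis by (simp add: divide_simps mult_ac)
qed

lemma one_minus_power_bounds:
  fixes s :: real
  assumes s: "0 \<le> s" "s \<le> 1"
  shows "0 \<le> 1 - (1 - s) ^ t" "1 - (1 - s) ^ t \<le> 1" "1 - (1 - s) ^ t \<le> real t * s"
  using s Bernoulli_inequality[of "- s" t] by (auto simp: power_le_one)

lemma wt_square: "(wt K)\<^sup>2 = real (Suc K) ^ 3"
  unfolding wt_def power_mult_distrib by (simp add: power2_eq_square power3_eq_cube)

text \<open>One factor \<open>s\<close> comes from \<open>A\<close>, two from the squared increment
  over an epoch. The constant is generous to pay for the shift from \<open>K\<close> to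
  \<open>Suc K\<close> in the weight.\<close>

lemma cube_mult_power_le:
  fixes s :: real
  assumes s: "0 \<le> s" "s \<le> 1"
  shows "s ^ 3 * (1 - s) ^ (2 * K) \<le> 27 / (wt K)\<^sup>2"
proof (cases "K = 0")
  case True
  then show ?thesis using s power_le_one[of s 3] by (simp add: wt_def)
next
  case False
  then have K: "2 * K \<ge> 1" "real K > 0" by auto
  have "s ^ 3 * (1 - s) ^ (2 * K) \<le> (2 * real 3 / (5 * real (2 * K))) ^ 3"
    using s K by (intro power_mult_power_le) auto
  also have "\<dots> \<le> (3 / real (Suc K)) ^ 3"
    using K by (intro power_mono) (auto simp: divide_simps)
  finally show ?thesis unfolding wt_square by (simp add: power_divide)
qed

lemma step_arg_bounds:
  fixes A :: "'x::{real_inner,banach} \<Rightarrow>\<^sub>L ('y::{real_inner,banach}^'n::finite)"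
  assumes "0 < c" "c * max_row_sq A \<le> 1" "0 \<le> x" "x \<le> (norm A)\<^sup>2 / real CARD('n)"
  shows "0 \<le> c * x" "c * x \<le> 1"
proof -
  have "(norm A)\<^sup>2 / real CARD('n) \<le> max_row_sq A"
    using norm_sq_le_max_row[of A] by (simp add: divide_le_eq mult.commute)
  then have "c * x \<le> c * max_row_sq A" using assms by (intro mult_left_mono) auto
  then show "c * x \<le> 1" using assms by linarith
  show "0 \<le> c * x" using assms by simp
qed

text \<open>The error is kept as a function of the whole index sequence, so that the same recursion
  can be read for one realization and under averaging. Neither the exact operator nor the exact data
  occur, only the error and the data noise.\<close>

locale svrg_process =
  fixes A :: "'x::{real_inner,banach} \<Rightarrow>\<^sub>L ('y::{real_inner,banach}^'n::finite)"
    and \<xi> :: "'y^'n" and c0 :: real and M :: nat and e0 :: 'x and e :: "(nat \<Rightarrow> 'n) \<Rightarrow> nat \<Rightarrow> 'x"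
  assumes M: "M \<ge> 1" and c0: "0 < c0" and c0L: "c0 * max_row_sq A \<le> 1"
    and e_0: "e i 0 = e0"
    and e_Suc: "e i (Suc k) = e i k - c0 *\<^sub>R (blinfun_adj (blinfun_row A (i k)) (blinfun_row A (i k)
        (e i k - e i (k div M * M))) + normal_op A (e i (k div M * M))
        - inverse (real CARD('n)) *\<^sub>R blinfun_adj A \<xi>)"
begin

abbreviation "L \<equiv> max_row_sq A"
abbreviation "B \<equiv> normal_op A"
abbreviation "\<beta> \<equiv> (norm A)\<^sup>2 / real CARD('n)"
abbreviation "rp \<equiv> [:1, - c0:]"

definition "R k = blinfun_poly (rp ^ k) B"
definition "Q t = blinfun_poly (rp ^ t - 1) B"
definition "h = (c0 / real CARD('n)) *\<^sub>R blinfun_adj A \<xi>"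
definition "H t = (\<Sum>s<t. R s h)"
definition "V i k = e i k - e i (k div M * M)"
definition "noise a v = B v - blinfun_adj (blinfun_row A a) (blinfun_row A a v)"
definition "N i k = noise (i k) (V i k)"

section \<open>The unrolled error and the increment within an epoch\<close>

lemma n_pos: "1 \<le> real CARD('n)" "0 < real CARD('n)"
  using zero_less_card_finite[where 'a='n] by linarith+

lemma L_nonneg: "0 \<le> L" by (rule max_row_sq_nonneg)

lemmas c0x = step_arg_bounds[OF c0 c0L]

lemma poly_rp: "poly (rp ^ k) x = (1 - c0 * x) ^ k"
  by (simp add: poly_power mult.commute)

lemma R_0: "R 0 x = x" by (simp add: R_def)

lemma R_add: "R (j + k) x = R j (R k x)"
  by (simp add: R_def power_add blinfun_poly_mult_apply)

lemma R_1: "R (Suc 0) x = x - c0 *\<^sub>R B x"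
  by (simp add: R_def blinfun_poly_pCons_apply blinfun.scaleR_right blinfun.minus_right)

lemma Q_apply: "Q t x = R t x - x"
  by (simp add: Q_def R_def blinfun_poly_add_apply)

lemma Q_R: "Q t (R k x) = blinfun_poly (rp ^ k * (rp ^ t - 1)) B x"
  by (simp add: Q_def R_def mult.commute[of "rp ^ k"] blinfun_poly_mult_apply)

lemma H_Suc: "H (Suc t) = R (Suc 0) (H t) + h"
proof -
  have "H (Suc t) = R 0 h + (\<Sum>s<t. R (Suc s) h)" unfolding H_def by (rule sum.lessThan_Suc_shift)
  also have "(\<Sum>s<t. R (Suc s) h) = R (Suc 0) (H t)"
    unfolding H_def blinfun.sum_right by (intro sum.cong) (auto simp: R_add[symmetric])
  finally show ?thesis by (simp add: R_0 add.commute)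
qed

text \<open>Both sides arise from computing \<open>H (t + k)\<close> in two ways. In
  \<open>V_unroll\<close> it merges the data noise of all past epochs with that of the running one
  into \<open>H t\<close> damped by \<open>R k\<close>, which stays bounded in the number of
  epochs.\<close>

lemma H_shift: "Q t (H k) + H t = R k (H t)"
proof -
  have add: "H (j + k) = H j + R j (H k)" for j k
  proof -
    have "H (j + k) = H j + (\<Sum>s<k. R (j + s) h)"
      unfolding H_def by (induction k) (simp_all add: add.assoc)
    then show ?thesis unfolding H_def[of k] by (simp add: R_add blinfun.sum_right)
  qed
  have "H t + R t (H k) = H k + R k (H t)" unfolding add[symmetric] by (simp add: add.commute)
  then show ?thesis unfolding Q_apply by (simp add: algebra_simps)
qed

lemma e_step: "e i (Suc k) = R (Suc 0) (e i k) + c0 *\<^sub>R N i k + h"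
  unfolding e_Suc R_1 N_def noise_def V_def h_def
  by (simp add: algebra_simps blinfun.diff_right divide_inverse)

text \<open>Variation of constants. The start \<open>m\<close> is free because both step zero and
  the start of the running epoch are needed.\<close>

lemma e_unroll: "e i (m + t) = R t (e i m) + H t + c0 *\<^sub>R (\<Sum>s<t. R (t - Suc s) (N i (m + s)))"
proof (induction t)
  case 0
  then show ?case by (simp add: R_0 H_def)
next
  case (Suc t)
  have "(\<Sum>s<Suc t. R (Suc t - Suc s) (N i (m + s))) = R (Suc 0) (\<Sum>s<t. R (t - Suc s) (N i (m + s))) + N i (m + t)"
  proof -
    have "(\<Sum>s<t. R (Suc t - Suc s) (N i (m + s))) = (\<Sum>s<t. R (Suc 0) (R (t - Suc s) (N i (m + s))))"
      by (intro sum.cong) (auto simp: R_add[symmetric] Suc_diff_Suc)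
    then show ?thesis by (simp add: R_0 blinfun.sum_right)
  qed
  then show ?case
    by (simp add: e_step Suc blinfun.add_right blinfun.scaleR_right H_Suc R_add[of "Suc 0" t, simplified]
        scaleR_add_right)
qed

lemma V_unroll:
  assumes "t < M"
  shows "V i (K*M + t) = R (K*M) (Q t e0 + H t)
     + c0 *\<^sub>R (\<Sum>j<K*M. Q t (R (K*M - Suc j) (N i j)))
     + c0 *\<^sub>R (\<Sum>s<t. R (t - Suc s) (N i (K*M + s)))"
proof -
  have "V i (K*M + t) = e i (K*M + t) - e i (K*M)" using assms by (simp add: V_def)
  also have "\<dots> = Q t (e i (K*M)) + H t + c0 *\<^sub>R (\<Sum>s<t. R (t - Suc s) (N i (K*M + s)))"
    by (simp add: e_unroll[of i "K*M"] Q_apply)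
  also have "e i (K*M) = R (K*M) e0 + H (K*M) + c0 *\<^sub>R (\<Sum>j<K*M. R (K*M - Suc j) (N i j))"
    using e_unroll[of i 0 "K*M"] by (simp add: e_0)
  also have "Q t \<dots> = Q t (R (K*M) e0) + Q t (H (K*M)) + c0 *\<^sub>R (\<Sum>j<K*M. Q t (R (K*M - Suc j) (N i j)))"
    by (simp add: blinfun.add_right blinfun.scaleR_right blinfun.sum_right)
  also have "Q t (R (K*M) e0) = R (K*M) (Q t e0)"
    by (simp only: Q_def R_def blinfun_poly_mult_apply[symmetric] mult.commute)
  finally show ?thesis using H_shift[of t "K*M"] by (simp add: blinfun.add_right algebra_simps)
qed

text \<open>With \<open>s = c0 * x\<close>: for the initial error \<open>Q t\<close> is at most
  \<open>M * s\<close> and \<open>A\<close> adds \<open>sqrt x\<close>, so a cube of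
  \<open>s\<close> appears after squaring. For the data noise \<open>s\<close> times the geometric
  sum is \<open>1 - (1 - s) ^ t \<le> 1\<close>, so the noise is not amplified.\<close>

lemma det_part_le:
  assumes t: "t < M"
  shows "norm (A (R (K*M) (Q t e0 + H t))) \<le> sqrt (real CARD('n)) * (real M * sqrt (27 / c0)) * norm e0 / wt K + norm \<xi>"
proof -
  have 1: "norm (A (R (K*M) (Q t e0))) \<le> sqrt (real CARD('n)) * (real M * sqrt (27 / c0) / wt K) * norm e0"
  proof -
    have "R (K*M) (Q t e0) = blinfun_poly (rp ^ (K*M) * (rp ^ t - 1)) B e0"
      by (simp add: Q_def R_def blinfun_poly_mult_apply)
    moreover have "norm (A (blinfun_poly (rp ^ (K*M) * (rp ^ t - 1)) B e0)) \<le> sqrt (real CARD('n)) * (real M * sqrt (27 / c0) / wt K) * norm e0"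
    proof (rule norm_A_poly_le)
      fix x assume x: "0 \<le> x" "x \<le> \<beta>"
      define s where "s = c0 * x"
      have s: "0 \<le> s" "s \<le> 1" using c0x x by (auto simp: s_def)
      have "s ^ 3 * (1 - s) ^ (2 * (K * M)) \<le> s ^ 3 * (1 - s) ^ (2 * K)"
        using s M by (intro mult_left_mono power_decreasing) auto
      also note cube_mult_power_le[OF s, of K]
      finally have key: "s ^ 3 * (1 - s) ^ (2 * (K * M)) \<le> 27 / (wt K)\<^sup>2" .
      have "(1 - (1 - s) ^ t)\<^sup>2 \<le> (real M * s)\<^sup>2"
      proof (rule power_mono)
        have "real t * s \<le> real M * s" using t s by (intro mult_right_mono) auto
        then show "1 - (1 - s) ^ t \<le> real M * s" using one_minus_power_bounds(3)[OF s, of t] by linarith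
      qed (use one_minus_power_bounds[OF s] in auto)
      moreover have "(poly (rp ^ (K*M) * (rp ^ t - 1)) x)\<^sup>2 = ((1 - s) ^ (K*M))\<^sup>2 * (1 - (1 - s) ^ t)\<^sup>2"
        by (simp add: poly_rp s_def power_mult_distrib power2_commute[of _ 1] del: poly_power)
      ultimately have "x * (poly (rp ^ (K*M) * (rp ^ t - 1)) x)\<^sup>2 \<le> x * (((1 - s) ^ (K*M))\<^sup>2 * (real M * s)\<^sup>2)"
        using x by (auto intro!: mult_left_mono)
      also have "\<dots> = (real M)\<^sup>2 / c0 * (s ^ 3 * (1 - s) ^ (2 * (K * M)))"
        using c0 by (simp add: s_def power_mult_distrib power2_eq_square power3_eq_cube power_mult field_simps
            power_add mult_2)
      also have "\<dots> \<le> (real M)\<^sup>2 / c0 * (27 / (wt K)\<^sup>2)" using key c0 by (intro mult_left_mono) auto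
      also have "\<dots> = (real M * sqrt (27 / c0) / wt K)\<^sup>2" using c0 by (simp add: power_mult_distrib power_divide)
      finally show "x * (poly (rp ^ (K*M) * (rp ^ t - 1)) x)\<^sup>2 \<le> (real M * sqrt (27 / c0) / wt K)\<^sup>2" .
    qed (use c0 wt_pos[of K] in auto)
    ultimately show ?thesis by simp
  qed
  have 2: "norm (A (R (K*M) (H t))) \<le> norm \<xi>"
  proof -
    define g where "g = rp ^ (K*M) * (\<Sum>s<t. rp ^ s)"
    have "R (K*M) (H t) = (c0 / real CARD('n)) *\<^sub>R blinfun_poly g B (blinfun_adj A \<xi>)"
      by (simp add: g_def H_def R_def h_def blinfun_poly_mult_apply blinfun_poly_sum_apply blinfun.scaleR_right
          scaleR_sum_right blinfun.sum_right)
    moreover have "norm (A (blinfun_poly g B (blinfun_adj A \<xi>))) \<le> real CARD('n) * (1 / c0) * norm \<xi>"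
    proof (rule norm_A_poly_adj_le)
      fix x assume x: "0 \<le> x" "x \<le> \<beta>"
      define s where "s = c0 * x"
      have s: "0 \<le> s" "s \<le> 1" using c0x x by (auto simp: s_def)
      have "0 \<le> (\<Sum>j<t. (1 - s) ^ j)" using s by (intro sum_nonneg) auto
      moreover have "poly g x = (1 - s) ^ (K*M) * (\<Sum>j<t. (1 - s) ^ j)"
        by (simp add: g_def poly_sum poly_rp s_def del: poly_power)
      ultimately have "c0 * (x * \<bar>poly g x\<bar>) = (1 - s) ^ (K*M) * (s * (\<Sum>j<t. (1 - s) ^ j))"
        using s by (simp add: abs_mult s_def[symmetric] mult.assoc[symmetric])
      also have "s * (\<Sum>j<t. (1 - s) ^ j) = 1 - (1 - s) ^ t" using one_diff_power_eq[of "1 - s" t] by simp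
      also have "(1 - s) ^ (K*M) * (1 - (1 - s) ^ t) \<le> 1 * 1"
        using s one_minus_power_bounds[OF s] by (intro mult_mono power_le_one) auto
      finally show "x * \<bar>poly g x\<bar> \<le> 1 / c0" using c0 by (simp add: field_simps)
    qed
    ultimately show ?thesis using c0 n_pos by (simp add: blinfun.scaleR_right divide_simps mult_ac)
  qed
  have "norm (A (R (K*M) (Q t e0 + H t))) \<le> norm (A (R (K*M) (Q t e0))) + norm (A (R (K*M) (H t)))"
    by (simp add: blinfun.add_right norm_triangle_ineq)
  then show ?thesis using 1 2 by simp
qed

text \<open>The bound \<open>27 / 125\<close> for \<open>r\<^sup>3 s\<^sup>3 (1 - s)\<close> to the power \<open>2 r\<close> stems from \<open>y exp (- y) \<le> 2 / 5\<close>
  at \<open>y = 2 r s / 3\<close>.\<close>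

definition sq_ker :: "nat \<Rightarrow> real" where
  "sq_ker r = (if r < M then min \<beta> (1 / (c0 * real (Suc (2 * r)))) else (real M)\<^sup>2 * (27 / 125) / (c0 * real r ^ 3))"

lemma sq_ker_nonneg: "0 \<le> sq_ker r"
  using c0 by (auto simp: sq_ker_def)

lemma sq_ker_R:
  assumes x: "0 \<le> x" "x \<le> \<beta>"
  shows "x * (poly (rp ^ r) x)\<^sup>2 \<le> min \<beta> (1 / (c0 * real (Suc (2 * r))))"
proof -
  define s where "s = c0 * x"
  have s: "0 \<le> s" "s \<le> 1" using c0x x by (auto simp: s_def)
  have p: "(poly (rp ^ r) x)\<^sup>2 = (1 - s) ^ (2 * r)" by (simp add: poly_rp s_def power_mult mult.commute flip: power_mult)
  have "x * (1 - s) ^ (2 * r) \<le> \<beta> * 1" using x s by (intro mult_mono power_le_one) auto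
  moreover have "c0 * (x * (1 - s) ^ (2 * r)) \<le> 1 / real (Suc (2 * r))"
    using mult_power_le_inverse[OF s, of "2 * r"] by (simp add: s_def)
  then have "x * (1 - s) ^ (2 * r) \<le> 1 / (c0 * real (Suc (2 * r)))"
    using c0 by (simp add: field_simps del: of_nat_Suc)
  ultimately show ?thesis unfolding p by simp
qed

text \<open>The increment \<open>1 - (1 - s) ^ t\<close> is bounded by one and by
  \<open>M * s\<close>. The trivial bound is used for lags below \<open>M\<close>, the linear one
  beyond, where the extra \<open>s\<close> buys decay in the lag.\<close>

lemma poly_QR:
  assumes x: "0 \<le> x" "x \<le> \<beta>" and t: "t < M"
  shows "\<bar>poly (rp ^ r * (rp ^ t - 1)) x\<bar> \<le> (1 - c0 * x) ^ r"
    "\<bar>poly (rp ^ r * (rp ^ t - 1)) x\<bar> \<le> (1 - c0 * x) ^ r * (real M * (c0 * x))"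
proof -
  define s where "s = c0 * x"
  have s: "0 \<le> s" "s \<le> 1" using c0x x by (auto simp: s_def)
  note b = one_minus_power_bounds[OF s, of t]
  have eq: "\<bar>poly (rp ^ r * (rp ^ t - 1)) x\<bar> = (1 - s) ^ r * (1 - (1 - s) ^ t)"
  proof -
    have "poly (rp ^ r * (rp ^ t - 1)) x = - ((1 - s) ^ r * (1 - (1 - s) ^ t))"
      by (simp add: poly_rp s_def algebra_simps del: poly_power)
    then show ?thesis using s b by (simp add: abs_mult)
  qed
  have "real t * s \<le> real M * s" using t s by (intro mult_right_mono) auto
  then have "1 - (1 - s) ^ t \<le> real M * s" using b by linarith
  then show "\<bar>poly (rp ^ r * (rp ^ t - 1)) x\<bar> \<le> (1 - c0 * x) ^ r"
    "\<bar>poly (rp ^ r * (rp ^ t - 1)) x\<bar> \<le> (1 - c0 * x) ^ r * (real M * (c0 * x))"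
    unfolding eq s_def[symmetric] using s b mult_left_mono[OF b(2), of "(1 - s) ^ r"] by (auto intro!: mult_left_mono)
qed

lemma sq_ker_QR:
  assumes x: "0 \<le> x" "x \<le> \<beta>" and t: "t < M"
  shows "x * (poly (rp ^ r * (rp ^ t - 1)) x)\<^sup>2 \<le> sq_ker r"
proof (cases "r < M")
  case True
  have "x * (poly (rp ^ r * (rp ^ t - 1)) x)\<^sup>2 \<le> x * (poly (rp ^ r) x)\<^sup>2"
  proof (intro mult_left_mono x)
    have "\<bar>poly (rp ^ r * (rp ^ t - 1)) x\<bar>\<^sup>2 \<le> ((1 - c0 * x) ^ r)\<^sup>2"
      by (intro power_mono poly_QR x t) auto
    then show "(poly (rp ^ r * (rp ^ t - 1)) x)\<^sup>2 \<le> (poly (rp ^ r) x)\<^sup>2" by (simp only: power2_abs poly_rp)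
  qed
  then show ?thesis using sq_ker_R[OF x, of r] True by (simp add: sq_ker_def)
next
  case False
  then have r: "r \<ge> 1" "2 * r \<ge> 1" using M by auto
  define s where "s = c0 * x"
  have s: "0 \<le> s" "s \<le> 1" using c0x x by (auto simp: s_def)
  have "(poly (rp ^ r * (rp ^ t - 1)) x)\<^sup>2 \<le> ((1 - s) ^ r * (real M * s))\<^sup>2"
    using power_mono[OF poly_QR(2)[OF x t, of r] abs_ge_zero, of 2] by (simp only: power2_abs s_def)
  then have "x * (poly (rp ^ r * (rp ^ t - 1)) x)\<^sup>2 \<le> x * ((1 - s) ^ r * (real M * s))\<^sup>2"
    using x by (intro mult_left_mono) auto
  also have "\<dots> = (real M)\<^sup>2 / c0 * (s ^ 3 * (1 - s) ^ (2 * r))"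
    using c0 by (simp add: s_def power_mult_distrib power2_eq_square power3_eq_cube power_add mult_2)
  also have "\<dots> \<le> (real M)\<^sup>2 / c0 * (2 * real 3 / (5 * real (2 * r))) ^ 3"
    using c0 s r by (intro mult_left_mono power_mult_power_le) auto
  also have "\<dots> = sq_ker r" using False r c0 by (simp add: sq_ker_def power_divide field_simps)
  finally show ?thesis .
qed

lemma norm_adj_row_le: "norm (blinfun_adj (blinfun_row A a) z) \<le> sqrt L * norm z"
proof -
  have "norm (blinfun_row A a) \<le> sqrt L" using norm_row_sq_le_max[of A a] real_le_rsqrt by blast
  then show ?thesis
    by (intro order_trans[OF norm_blinfun_adj_le] mult_right_mono) auto
qed

lemma A_R_adj_row:
  assumes "r < M"
  shows "norm (A (R r (blinfun_adj (blinfun_row A a) z))) \<le> sqrt (real CARD('n) * L * sq_ker r) * norm z"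
proof -
  have "norm (A (R r (blinfun_adj (blinfun_row A a) z))) \<le> sqrt (real CARD('n)) * sqrt (sq_ker r) * norm (blinfun_adj (blinfun_row A a) z)"
    unfolding R_def by (rule norm_A_poly_le) (use sq_ker_R[of _ r] assms sq_ker_nonneg[of r] in \<open>auto simp: sq_ker_def\<close>)
  also have "\<dots> \<le> sqrt (real CARD('n)) * sqrt (sq_ker r) * (sqrt L * norm z)"
    by (intro mult_left_mono norm_adj_row_le) (use sq_ker_nonneg in auto)
  finally show ?thesis by (simp add: real_sqrt_mult mult_ac)
qed

lemma A_QR_adj_row:
  assumes "t < M"
  shows "norm (A (Q t (R r (blinfun_adj (blinfun_row A a) z)))) \<le> sqrt (real CARD('n) * L * sq_ker r) * norm z"
proof -
  have "norm (A (Q t (R r (blinfun_adj (blinfun_row A a) z)))) \<le> sqrt (real CARD('n)) * sqrt (sq_ker r) * norm (blinfun_adj (blinfun_row A a) z)"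
    unfolding Q_R by (rule norm_A_poly_le) (use sq_ker_QR[of _ t r] assms sq_ker_nonneg[of r] in auto)
  also have "\<dots> \<le> sqrt (real CARD('n)) * sqrt (sq_ker r) * (sqrt L * norm z)"
    by (intro mult_left_mono norm_adj_row_le) (use sq_ker_nonneg in auto)
  finally show ?thesis by (simp add: real_sqrt_mult mult_ac)
qed

lemma norm_A_row_le: "norm (blinfun_row A a v) \<le> norm (A v)"
  by (simp add: Finite_Cartesian_Product.norm_nth_le)

end

section \<open>Estimates for every realization\<close>

lemma norm_add3_le: "norm (a + b + c) \<le> norm a + norm b + norm (c :: 'a::real_normed_vector)"
  using norm_triangle_ineq[of "a + b" c] norm_triangle_ineq[of a b] by linarith

context svrg_process
begin

lemma sqrt_nL_norm: "norm A \<le> sqrt (real CARD('n) * L)"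
  using norm_sq_le_max_row[of A] real_le_rsqrt by blast

lemma norm_B_le: "norm (B v) \<le> sqrt L * norm (A v)"
proof -
  have "norm (B v) = inverse (real CARD('n)) * norm (blinfun_adj A (A v))" by (simp add: normal_op_apply)
  also have "\<dots> \<le> inverse (real CARD('n)) * (sqrt (real CARD('n) * L) * norm (A v))"
    by (intro mult_left_mono order_trans[OF norm_blinfun_adj_le] mult_right_mono sqrt_nL_norm) auto
  also have "\<dots> = inverse (sqrt (real CARD('n))) * (sqrt L * norm (A v))"
    using n_pos by (simp add: real_sqrt_mult field_simps)
  also have "\<dots> \<le> 1 * (sqrt L * norm (A v))"
    using n_pos L_nonneg by (intro mult_right_mono) (auto simp: divide_simps)
  finally show ?thesis by simp
qed

lemma norm_adj_row_row_le: "norm (blinfun_adj (blinfun_row A a) (blinfun_row A a v)) \<le> sqrt L * norm (A v)"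
  by (intro order_trans[OF norm_adj_row_le] mult_left_mono norm_A_row_le) (use L_nonneg in auto)

text \<open>The gradient noise is estimated by its norm, at most
  \<open>2 * sqrt L * norm (A v)\<close>. This forgoes the half power of the spectral variable in
  the adjoint, but the constant does not grow like \<open>n\<close>.\<close>

lemma A_poly_noise_sqrt:
  assumes q: "\<And>x. 0 \<le> x \<Longrightarrow> x \<le> \<beta> \<Longrightarrow> x * (poly q x)\<^sup>2 \<le> C\<^sup>2" and C: "0 \<le> C"
  shows "norm (A (blinfun_poly q B (noise a v))) \<le> 2 * sqrt (real CARD('n) * L) * C * norm (A v)"
proof -
  have "norm (A (blinfun_poly q B (noise a v))) \<le> sqrt (real CARD('n)) * C * norm (noise a v)"
    by (rule norm_A_poly_le[OF q C])
  also have "\<dots> \<le> sqrt (real CARD('n)) * C * (2 * (sqrt L * norm (A v)))"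
  proof (rule mult_left_mono)
    show "norm (noise a v) \<le> 2 * (sqrt L * norm (A v))"
      unfolding noise_def
      using norm_triangle_ineq4[of "B v" "blinfun_adj (blinfun_row A a) (blinfun_row A a v)"]
        norm_B_le[of v] norm_adj_row_row_le[of a v] by linarith
  qed (use C in simp)
  finally show ?thesis by (simp add: real_sqrt_mult mult_ac)
qed

lemma noise_eq_adj:
  "noise a v = inverse (real CARD('n)) *\<^sub>R blinfun_adj A (A v) - blinfun_adj A (axis a (blinfun_row A a v))"
  by (simp add: noise_def normal_op_apply adj_row_eq_adj_axis)

text \<open>Both parts of the noise lie in the range of the adjoint of \<open>A\<close>, the row
  part through \<open>axis\<close>, so any bound for \<open>T\<close> after the adjoint carries over
  with a factor two. This is the route that keeps the half power given up in
  \<open>A_poly_noise_sqrt\<close>.\<close>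

lemma adj_bound_noise:
  fixes T :: "'x \<Rightarrow> 'z::real_normed_vector"
  assumes T: "linear T" "\<And>y. norm (T (blinfun_adj A y)) \<le> C * norm y"
  shows "norm (T (noise a v)) \<le> 2 * C * norm (A v)"
proof -
  interpret linear T by fact
  have C: "0 \<le> C * norm (A v)" using order_trans[OF norm_ge_zero T(2)] .
  have "norm (T (noise a v)) \<le> norm (inverse (real CARD('n)) *\<^sub>R T (blinfun_adj A (A v)))
      + norm (T (blinfun_adj A (axis a (blinfun_row A a v))))"
    unfolding noise_eq_adj diff scaleR by (rule norm_triangle_ineq4)
  also have "norm (inverse (real CARD('n)) *\<^sub>R T (blinfun_adj A (A v))) \<le> 1 * (C * norm (A v))"
    unfolding norm_scaleR using n_pos by (intro mult_mono T) (auto simp: divide_simps)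
  also have "norm (T (blinfun_adj A (axis a (blinfun_row A a v)))) \<le> C * norm (A v)"
  \<comment> \<open>The hypothesis reveals the sign of \<open>C\<close> only through a nonzero
    vector of the data space.\<close>
  proof (cases "A v = 0")
    case True
    then have "axis a (blinfun_row A a v) = 0" by (simp add: vec_eq_iff axis_def)
    then show ?thesis using True by (simp only: blinfun.zero_right zero norm_zero)
  next
    case False
    have "0 \<le> C" using C False by (simp add: zero_le_mult_iff)
    have "norm (T (blinfun_adj A (axis a (blinfun_row A a v)))) \<le> C * norm (axis a (blinfun_row A a v))" by (rule T)
    also have "\<dots> \<le> C * norm (A v)"
      using norm_A_row_le[of a v] \<open>0 \<le> C\<close> by (intro mult_left_mono) (simp_all add: norm_eq_sqrt_inner[of "axis _ _"] inner_axis flip: norm_eq_sqrt_inner)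
    finally show ?thesis .
  qed
  finally show ?thesis by simp
qed

text \<open>The minimum joins the two routes for the gradient noise: the first entry carries the
  step size but decays only like \<open>1 / r\<close>, the second is summable but, after
  multiplication by \<open>c0\<close>, free of the step size and proportional to \<open>n\<close>.
  The constants are twice \<open>2 / 5\<close> and twice \<open>(4 / 5)\<^sup>2\<close>, from
  \<open>power_mult_power_le\<close> with \<open>p = 1\<close> and \<open>p = 2\<close>.\<close>

definition path_ker :: "nat \<Rightarrow> real" where
  "path_ker r = (if r < M then 2 * c0 * (sqrt L * norm A)
     else c0 * min (4 / 5 * (sqrt L * norm A) * real M / real r) (32 / 25 * real CARD('n) * real M / (c0 * (real r)\<^sup>2)))"

lemma path_ker_nonneg: "0 \<le> path_ker r"
  using c0 L_nonneg by (auto simp: path_ker_def)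

lemma sqrt_nL_beta: "sqrt (real CARD('n) * L) * sqrt \<beta> = sqrt L * norm A"
  using n_pos by (simp add: real_sqrt_mult real_sqrt_divide)

lemma A_R_noise:
  assumes r: "r < M"
  shows "c0 * norm (A (R r (noise a v))) \<le> path_ker r * norm (A v)"
proof -
  have "norm (A (R r (noise a v))) \<le> 2 * sqrt (real CARD('n) * L) * sqrt \<beta> * norm (A v)"
    unfolding R_def by (rule A_poly_noise_sqrt) (use sq_ker_R[of _ r] in auto)
  also have "\<dots> = 2 * (sqrt L * norm A) * norm (A v)" using sqrt_nL_beta by simp
  finally have "c0 * norm (A (R r (noise a v))) \<le> c0 * (2 * (sqrt L * norm A) * norm (A v))"
    using c0 by (intro mult_left_mono) auto
  then show ?thesis using r by (simp add: path_ker_def mult_ac)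
qed

lemma A_QR_noise:
  assumes t: "t < M"
  shows "c0 * norm (A (Q t (R r (noise a v)))) \<le> path_ker r * norm (A v)"
proof (cases "r < M")
  case True
  have "norm (A (Q t (R r (noise a v)))) \<le> 2 * sqrt (real CARD('n) * L) * sqrt \<beta> * norm (A v)"
    unfolding Q_R by (rule A_poly_noise_sqrt) (use sq_ker_QR[OF _ _ t, of _ r] True in \<open>auto simp: sq_ker_def\<close>)
  also have "\<dots> = 2 * (sqrt L * norm A) * norm (A v)" using sqrt_nL_beta by simp
  finally have "c0 * norm (A (Q t (R r (noise a v)))) \<le> c0 * (2 * (sqrt L * norm A) * norm (A v))"
    using c0 by (intro mult_left_mono) auto
  then show ?thesis using True by (simp add: path_ker_def mult_ac)
next
  case False
  then have r: "r \<ge> 1" "real r > 0" using M by auto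
  define q where "q = rp ^ r * (rp ^ t - 1)"
  have s: "0 \<le> c0 * x" "c0 * x \<le> 1" if "0 \<le> x" "x \<le> \<beta>" for x using c0x that by auto
  have q1: "\<bar>poly q x\<bar> \<le> real M * (2 / (5 * real r))" if x: "0 \<le> x" "x \<le> \<beta>" for x
  proof -
    have "\<bar>poly q x\<bar> \<le> real M * ((c0 * x) ^ 1 * (1 - c0 * x) ^ r)"
      using poly_QR(2)[OF x t, of r] by (simp add: q_def mult_ac)
    also have "\<dots> \<le> real M * ((2 * real 1 / (5 * real r)) ^ 1)"
      using s[OF x] r by (intro mult_left_mono power_mult_power_le) auto
    finally show ?thesis by simp
  qed
  have q2: "x * \<bar>poly q x\<bar> \<le> real M / c0 * (16 / (25 * (real r)\<^sup>2))" if x: "0 \<le> x" "x \<le> \<beta>" for x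
  proof -
    have "x * \<bar>poly q x\<bar> \<le> x * ((1 - c0 * x) ^ r * (real M * (c0 * x)))"
      using poly_QR(2)[OF x t, of r] x by (intro mult_left_mono) (auto simp: q_def)
    also have "\<dots> = real M / c0 * ((c0 * x) ^ 2 * (1 - c0 * x) ^ r)"
      using c0 by (simp add: power2_eq_square)
    also have "\<dots> \<le> real M / c0 * ((2 * real 2 / (5 * real r)) ^ 2)"
      using s[OF x] r c0 by (intro mult_left_mono power_mult_power_le) auto
    finally show ?thesis by (simp add: power_divide power_mult_distrib)
  qed
  have b1: "norm (A (blinfun_poly q B (noise a v))) \<le> 4 / 5 * (sqrt L * norm A) * real M / real r * norm (A v)"
  proof -
    have "norm (A (blinfun_poly q B (noise a v)))
        \<le> 2 * sqrt (real CARD('n) * L) * (sqrt \<beta> * (real M * (2 / (5 * real r)))) * norm (A v)"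
    proof (rule A_poly_noise_sqrt)
      fix x assume x: "0 \<le> x" "x \<le> \<beta>"
      have "\<bar>poly q x\<bar>\<^sup>2 \<le> (real M * (2 / (5 * real r)))\<^sup>2" using q1[OF x] by (intro power_mono) auto
      then have "x * (poly q x)\<^sup>2 \<le> \<beta> * (real M * (2 / (5 * real r)))\<^sup>2"
        using x by (intro mult_mono) (auto simp: power2_abs)
      then show "x * (poly q x)\<^sup>2 \<le> (sqrt \<beta> * (real M * (2 / (5 * real r))))\<^sup>2"
        by (simp only: power_mult_distrib[of "sqrt \<beta>"]) simp
    qed auto
    also have "\<dots> = 2 * (sqrt (real CARD('n) * L) * sqrt \<beta>) * (real M * (2 / (5 * real r))) * norm (A v)"
      by (simp only: mult_ac)
    finally show ?thesis unfolding sqrt_nL_beta by (simp add: mult_ac)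
  qed
  have b2: "norm (A (blinfun_poly q B (noise a v))) \<le> 32 / 25 * real CARD('n) * real M / (c0 * (real r)\<^sup>2) * norm (A v)"
  proof -
    have "norm (A (blinfun_poly q B (noise a v)))
      \<le> 2 * (real CARD('n) * (real M / c0 * (16 / (25 * (real r)\<^sup>2)))) * norm (A v)"
    proof (rule adj_bound_noise)
      show "linear (\<lambda>z. A (blinfun_poly q B z))"
        by (intro bounded_linear.linear bounded_linear_compose[OF blinfun.bounded_linear_right] blinfun.bounded_linear_right)
      show "norm (A (blinfun_poly q B (blinfun_adj A y))) \<le> real CARD('n) * (real M / c0 * (16 / (25 * (real r)\<^sup>2))) * norm y" for y
        by (rule norm_A_poly_adj_le[OF q2])
    qed
    then show ?thesis by (simp add: mult_ac)
  qed
  have "norm (A (Q t (R r (noise a v)))) \<le> min (4 / 5 * (sqrt L * norm A) * real M / real r)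
      (32 / 25 * real CARD('n) * real M / (c0 * (real r)\<^sup>2)) * norm (A v)"
    using b1 b2 unfolding Q_R q_def[symmetric] by (simp add: min_def)
  then have "c0 * norm (A (Q t (R r (noise a v)))) \<le> c0 * (min (4 / 5 * (sqrt L * norm A) * real M / real r)
      (32 / 25 * real CARD('n) * real M / (c0 * (real r)\<^sup>2)) * norm (A v))"
    using c0 by (intro mult_left_mono) auto
  then show ?thesis using False by (simp add: path_ker_def)
qed

lemma path_ker_block:
  assumes m: "m \<ge> 1"
  shows "(\<Sum>r<M. path_ker (m*M + r)) \<le> 4 / 5 * (c0 * real M * (sqrt L * norm A)) / real m"
    "(\<Sum>r<M. path_ker (m*M + r)) \<le> 32 / 25 * real CARD('n) / (real m)\<^sup>2"
proof -
  have mM: "real m * real M > 0" "real m > 0" "real M > 0" using m M by auto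
  have ge: "real m * real M \<le> real (m*M + r)" for r by simp
  have "M \<le> m*M" using m by simp
  then have nlt: "\<not> m*M + r < M" for r by linarith
  have sL: "0 \<le> sqrt L * norm A" using L_nonneg by simp
  have "(\<Sum>r<M. path_ker (m*M + r)) \<le> (\<Sum>r<M. c0 * (4 / 5 * (sqrt L * norm A) * real M / (real m * real M)))"
  proof (rule sum_mono)
    fix r
    have "path_ker (m*M + r) \<le> c0 * (4 / 5 * (sqrt L * norm A) * real M / real (m*M + r))"
      unfolding path_ker_def if_not_P[OF nlt] using c0 by (intro mult_left_mono min.cobounded1) auto
    also have "\<dots> \<le> c0 * (4 / 5 * (sqrt L * norm A) * real M / (real m * real M))"
      using c0 sL mM L_nonneg
      by (intro mult_left_mono divide_left_mono ge mult_pos_pos mult_nonneg_nonneg) (auto intro: add_pos_nonneg)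
    finally show "path_ker (m*M + r) \<le> c0 * (4 / 5 * (sqrt L * norm A) * real M / (real m * real M))" .
  qed
  also have "\<dots> = 4 / 5 * (c0 * real M * (sqrt L * norm A)) / real m" using mM by simp
  finally show "(\<Sum>r<M. path_ker (m*M + r)) \<le> 4 / 5 * (c0 * real M * (sqrt L * norm A)) / real m" .
  have "(\<Sum>r<M. path_ker (m*M + r)) \<le> (\<Sum>r<M. c0 * (32 / 25 * real CARD('n) * real M / (c0 * (real m * real M)\<^sup>2)))"
  proof (rule sum_mono)
    fix r
    have "path_ker (m*M + r) \<le> c0 * (32 / 25 * real CARD('n) * real M / (c0 * (real (m*M + r))\<^sup>2))"
      unfolding path_ker_def if_not_P[OF nlt] using c0 by (intro mult_left_mono min.cobounded2) auto
    also have "\<dots> \<le> c0 * (32 / 25 * real CARD('n) * real M / (c0 * (real m * real M)\<^sup>2))"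
      using c0 mM by (intro mult_left_mono divide_left_mono power_mono ge mult_pos_pos zero_less_power mult_nonneg_nonneg)
        (auto intro: add_pos_nonneg)
    finally show "path_ker (m*M + r) \<le> c0 * (32 / 25 * real CARD('n) * real M / (c0 * (real m * real M)\<^sup>2))" .
  qed
  also have "\<dots> = 32 / 25 * real CARD('n) / (real m)\<^sup>2" using mM c0 by (simp add: power2_eq_square)
  finally show "(\<Sum>r<M. path_ker (m*M + r)) \<le> 32 / 25 * real CARD('n) / (real m)\<^sup>2" .
qed

lemma wt_Suc_le: "m \<ge> 1 \<Longrightarrow> wt (Suc m) \<le> 9 * (real m)\<^sup>2"
proof -
  assume m: "m \<ge> 1"
  have "wt (Suc m) \<le> (3 * real m) * (3 * real m)"
    unfolding wt_def
  proof (intro mult_mono)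
    show 1: "real (Suc (Suc m)) \<le> 3 * real m" using m by simp
    have "real (Suc (Suc m)) \<le> (3 * real m)\<^sup>2"
    proof -
      have "3 * real m * 1 \<le> (3 * real m) * (3 * real m)" using m by (intro mult_left_mono) auto
      then show ?thesis using 1 unfolding power2_eq_square by linarith
    qed
    then show "sqrt (real (Suc (Suc m))) \<le> 3 * real m" by (intro real_le_lsqrt) auto
  qed auto
  then show ?thesis by (simp add: power2_eq_square)
qed

text \<open>The logarithm absorbs the harmonic sum over the first \<open>4 n\<close> epochs, beyond which the quadratic
  decay of the kernel suffices.\<close>

definition "small_path_step \<longleftrightarrow> (\<exists>l. 196 * (c0 * real M * (sqrt L * norm A)) * l \<le> 1 \<and>
    4 + ln (4 * real CARD('n)) \<le> 2 * l)"

text \<open>Budget for the mass: the logarithm is nonnegative, so \<open>l \<ge> 2\<close> and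
  \<open>s \<le> 1 / 392\<close>. The first block counted twice costs \<open>4 * s\<close>, the
  epochs up to \<open>P\<close> at most \<open>1 / 10\<close>, and the quadratic tail
  \<open>8 / 25\<close>.\<close>

lemma path_ker_mass:
  assumes small_path_step
  shows "(\<Sum>r<M. path_ker r) + (\<Sum>r<J*M. path_ker r) \<le> 1 / 2"
    "(\<Sum>r<M. path_ker (m*M + r)) * wt (Suc m) \<le> 12 * real CARD('n)"
proof -
  obtain l where l: "196 * (c0 * real M * (sqrt L * norm A)) * l \<le> 1" "4 + ln (4 * real CARD('n)) \<le> 2 * l"
    using assms by (auto simp: small_path_step_def)
  define s where "s = c0 * real M * (sqrt L * norm A)"
  have s0: "0 \<le> s" using c0 L_nonneg by (simp add: s_def)
  have ln0: "0 \<le> ln (4 * real CARD('n))" by (rule ln_ge_zero) (use n_pos in linarith)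
  have sl: "s * l \<le> 1 / 196" using l(1) unfolding s_def by simp
  have "s * 2 \<le> s * l" using l(2) ln0 s0 by (intro mult_left_mono) linarith+
  then have s1: "s \<le> 1 / 392" using sl by simp
  have first: "(\<Sum>r<M. path_ker r) = 2 * s" by (simp add: path_ker_def s_def)
  \<comment> \<open>Cutting at a multiple of \<open>n\<close> cancels the factor \<open>n\<close> in
    the tail bound \<open>32 / 25 * n / P\<close>.\<close>
  define P where "P = 4 * CARD('n)"
  have P: "P \<ge> 1" "real P = 4 * real CARD('n)" using zero_less_card_finite[where 'a='n] unfolding P_def by auto
  have tail: "(\<Sum>m=1..J. \<Sum>r<M. path_ker (m*M + r)) \<le> 4 / 5 * s * (1 + ln (real P)) + 32 / 25 * real CARD('n) * (1 / real P)" for J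
  proof -
    have "(\<Sum>m=1..J. \<Sum>r<M. path_ker (m*M + r)) \<le> (\<Sum>m\<in>{1..P} \<union> {Suc P..J}. \<Sum>r<M. path_ker (m*M + r))"
      by (intro sum_mono2 sum_nonneg path_ker_nonneg) auto
    also have "\<dots> = (\<Sum>m=1..P. \<Sum>r<M. path_ker (m*M + r)) + (\<Sum>m=Suc P..J. \<Sum>r<M. path_ker (m*M + r))"
      by (intro sum.union_disjoint) auto
    also have "\<dots> \<le> (\<Sum>m=1..P. 4 / 5 * s * (1 / real m)) + (\<Sum>m=Suc P..J. 32 / 25 * real CARD('n) * (1 / (real m)\<^sup>2))"
    proof (intro add_mono sum_mono)
      show "(\<Sum>r<M. path_ker (m*M + r)) \<le> 4 / 5 * s * (1 / real m)" if "m \<in> {1..P}" for m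
        using path_ker_block(1)[of m] that by (simp add: s_def)
      show "(\<Sum>r<M. path_ker (m*M + r)) \<le> 32 / 25 * real CARD('n) * (1 / (real m)\<^sup>2)" if "m \<in> {Suc P..J}" for m
        using path_ker_block(2)[of m] that P(1) by simp
    qed
    also have "\<dots> \<le> 4 / 5 * s * (1 + ln (real P)) + 32 / 25 * real CARD('n) * (1 / real P)"
      unfolding sum_distrib_left[symmetric]
      using s0 P by (intro add_mono mult_left_mono sum_inverse_le_ln sum_inverse_square_tail) auto
    finally show ?thesis .
  qed
  have "s * (1 + ln (real P)) \<le> s * (2 * l)" using l(2) s0 P by (intro mult_left_mono) auto
  then have "4 / 5 * s * (1 + ln (real P)) \<le> 1 / 10" using sl by simp
  moreover have "32 / 25 * real CARD('n) * (1 / real P) = 8 / 25" using n_pos P by simp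
  ultimately have "2 * (\<Sum>r<M. path_ker r) + (\<Sum>m=1..J. \<Sum>r<M. path_ker (m*M + r)) \<le> 1 / 2" for J
    using tail[of J] s1 first by linarith
  then show "(\<Sum>r<M. path_ker r) + (\<Sum>r<J*M. path_ker r) \<le> 1 / 2"
    by (intro kernel_mass_le path_ker_nonneg)
  show "(\<Sum>r<M. path_ker (m*M + r)) * wt (Suc m) \<le> 12 * real CARD('n)"
  proof (cases "m = 0")
    case True
    have "wt (Suc 0) \<le> 4" by (simp add: wt_def real_le_lsqrt)
    then have "2 * s * wt (Suc 0) \<le> (1 / 196) * 4" using s0 s1 wt_pos[of "Suc 0"] by (intro mult_mono) auto
    also have "\<dots> \<le> 12 * real CARD('n)" using n_pos by linarith
    finally show ?thesis using True first by simp
  next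
    case False
    then have m: "m \<ge> 1" by simp
    have "(\<Sum>r<M. path_ker (m*M + r)) * wt (Suc m) \<le> (32 / 25 * real CARD('n) / (real m)\<^sup>2) * (9 * (real m)\<^sup>2)"
      using wt_pos[of "Suc m"] m by (intro mult_mono path_ker_block wt_Suc_le) auto
    also have "\<dots> \<le> 12 * real CARD('n)" using m by simp
    finally show ?thesis .
  qed
qed

definition "det_coeff c = sqrt c * (real M * sqrt (27 / c0)) * norm e0"

lemma det_coeff_nonneg: "0 \<le> det_coeff (real CARD('n))"
  using c0 by (simp add: det_coeff_def)

lemma path_increment_le:
  assumes C: "epoch_const M (12 * real CARD('n)) C" and small: small_path_step
  shows "norm (A (V i j)) \<le> C * (det_coeff (real CARD('n)) / wt j + norm \<xi>)"
proof -
  have rec: "norm (A (V i (K*M + t))) \<le> det_coeff (real CARD('n)) / wt K + norm \<xi>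
      + (\<Sum>j<K*M. path_ker (K*M - Suc j) * norm (A (V i j)))
      + (\<Sum>s<t. path_ker (t - Suc s) * norm (A (V i (K*M + s))))" if t: "t < M" for K t
  proof -
    let ?a = "A (R (K*M) (Q t e0 + H t))"
    let ?b = "c0 *\<^sub>R (\<Sum>j<K*M. A (Q t (R (K*M - Suc j) (N i j))))"
    let ?c = "c0 *\<^sub>R (\<Sum>s<t. A (R (t - Suc s) (N i (K*M + s))))"
    have "A (V i (K*M + t)) = ?a + ?b + ?c"
      unfolding V_unroll[OF t] by (simp add: blinfun.add_right blinfun.scaleR_right blinfun.sum_right)
    then have "norm (A (V i (K*M + t))) \<le> norm ?a + norm ?b + norm ?c" by (simp only: norm_add3_le)
    moreover have "norm ?a \<le> det_coeff (real CARD('n)) / wt K + norm \<xi>"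
      using det_part_le[OF t, of K] by (simp add: det_coeff_def)
    moreover have "norm ?b \<le> (\<Sum>j<K*M. path_ker (K*M - Suc j) * norm (A (V i j)))"
      unfolding scaleR_sum_right
      by (rule sum_norm_le) (use A_QR_noise[OF t] c0 in \<open>simp add: N_def\<close>)
    moreover have "norm ?c \<le> (\<Sum>s<t. path_ker (t - Suc s) * norm (A (V i (K*M + s))))"
      unfolding scaleR_sum_right
      by (rule sum_norm_le) (use A_R_noise c0 t in \<open>simp add: N_def\<close>)
    ultimately show ?thesis by linarith
  qed
  show ?thesis
    by (rule C[unfolded epoch_const_def, rule_format, of path_ker "det_coeff (real CARD('n))" "norm \<xi>" "\<lambda>j. norm (A (V i j))"])
      (intro conjI allI impI path_ker_nonneg path_ker_mass small det_coeff_nonneg norm_ge_zero rec)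
qed

section \<open>The error of one realization\<close>

lemma norm_H_le:
  assumes \<kappa>: "\<And>r y. norm (R r (blinfun_adj A y)) \<le> \<kappa> r * norm y" "(\<Sum>r<k. \<kappa> r) \<le> \<Lambda>"
  shows "norm (H k) \<le> c0 * \<Lambda> * norm \<xi>"
proof -
  have "norm (H k) \<le> (\<Sum>r<k. c0 * \<kappa> r * norm \<xi>)"
    unfolding H_def
  proof (rule sum_norm_le)
    fix r
    have "norm (R r h) = c0 / real CARD('n) * norm (R r (blinfun_adj A \<xi>))"
      using c0 by (simp add: h_def blinfun.scaleR_right)
    also have "\<dots> \<le> c0 * (\<kappa> r * norm \<xi>)"
      using c0 n_pos by (intro mult_mono \<kappa>) (auto simp: divide_le_eq)
    finally show "norm (R r h) \<le> c0 * \<kappa> r * norm \<xi>" by simp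
  qed
  also have "\<dots> = c0 * (\<Sum>r<k. \<kappa> r) * norm \<xi>" by (simp add: sum_distrib_left sum_distrib_right)
  also have "\<dots> \<le> c0 * \<Lambda> * norm \<xi>" using c0 \<kappa>(2) by (intro mult_right_mono mult_left_mono) auto
  finally show ?thesis .
qed

text \<open>The two bounds on \<open>\<kappa>\<close> meet the two parts of the increments: its
  inverse root is convolved with the decaying part, its sum \<open>\<Lambda>\<close> multiplies the
  constant part \<open>norm \<xi>\<close>. Keeping \<open>\<Lambda>\<close> abstract allows
  \<open>sqrt k\<close> without truncation and a bound free of \<open>k\<close> with it.\<close>

lemma path_error_le:
  assumes C: "epoch_const M (12 * real CARD('n)) C" "0 \<le> C" and small: small_path_step
    and \<kappa>: "\<And>r y. norm (R r (blinfun_adj A y)) \<le> \<kappa> r * norm y" "(\<Sum>r<k. \<kappa> r) \<le> \<Lambda>"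
      "\<And>r. 0 \<le> \<kappa> r" "\<And>r. \<kappa> r \<le> sqrt (real CARD('n) / c0) / sqrt (real (Suc r))"
  shows "norm (e i k) \<le> norm (R k e0) + 18 * c0 * C * det_coeff (real CARD('n)) * sqrt (real CARD('n) / c0) / sqrt (real (Suc k))
     + (c0 + 2 * c0 * C) * \<Lambda> * norm \<xi>"
proof -
  have bnd: "norm (R (k - Suc j) (N i j)) \<le> 2 * C * (det_coeff (real CARD('n)) * sqrt (real CARD('n) / c0) * (1 / sqrt (real (Suc (k - Suc j))) * (1 / wt j))
      + \<kappa> (k - Suc j) * norm \<xi>)" for j
  proof -
    have "norm (R (k - Suc j) (N i j)) \<le> 2 * \<kappa> (k - Suc j) * norm (A (V i j))"
      unfolding N_def by (rule adj_bound_noise) (auto intro: \<kappa> bounded_linear.linear blinfun.bounded_linear_right)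
    also have "\<dots> \<le> 2 * \<kappa> (k - Suc j) * (C * (det_coeff (real CARD('n)) / wt j + norm \<xi>))"
      using \<kappa>(3) by (intro mult_left_mono path_increment_le C small) auto
    also have "\<dots> = 2 * C * (\<kappa> (k - Suc j) * (det_coeff (real CARD('n)) / wt j) + \<kappa> (k - Suc j) * norm \<xi>)"
      by (simp add: algebra_simps)
    also have "\<dots> \<le> 2 * C * (sqrt (real CARD('n) / c0) / sqrt (real (Suc (k - Suc j))) * (det_coeff (real CARD('n)) / wt j) + \<kappa> (k - Suc j) * norm \<xi>)"
      using det_coeff_nonneg wt_pos[of j] C(2) by (intro mult_left_mono add_right_mono mult_right_mono \<kappa>) auto
    finally show ?thesis by (simp add: mult_ac)
  qed
  have "e i k = R k e0 + H k + c0 *\<^sub>R (\<Sum>j<k. R (k - Suc j) (N i j))"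
    using e_unroll[of i 0 k] by (simp add: e_0)
  then have "norm (e i k) \<le> norm (R k e0) + norm (H k) + norm (c0 *\<^sub>R (\<Sum>j<k. R (k - Suc j) (N i j)))"
    by (simp only: norm_add3_le)
  also have "norm (c0 *\<^sub>R (\<Sum>j<k. R (k - Suc j) (N i j))) \<le> c0 * (\<Sum>j<k. 2 * C * (det_coeff (real CARD('n)) * sqrt (real CARD('n) / c0) * (1 / sqrt (real (Suc (k - Suc j))) * (1 / wt j))
      + \<kappa> (k - Suc j) * norm \<xi>))"
    unfolding norm_scaleR using c0 by (simp only: abs_of_pos) (intro mult_left_mono sum_norm_le bnd, simp)
  also have "\<dots> = c0 * (2 * C * (det_coeff (real CARD('n)) * sqrt (real CARD('n) / c0) * (\<Sum>j<k. 1 / sqrt (real (Suc (k - Suc j))) * (1 / wt j))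
      + (\<Sum>j<k. \<kappa> j) * norm \<xi>))"
    using sum.nat_diff_reindex[of \<kappa> k]
    by (simp only: sum.distrib sum_distrib_left[symmetric] sum_distrib_right[symmetric])
  also have "\<dots> \<le> c0 * (2 * C * (det_coeff (real CARD('n)) * sqrt (real CARD('n) / c0) * (9 / sqrt (real (Suc k))) + \<Lambda> * norm \<xi>))"
    using c0 C(2) det_coeff_nonneg
    by (intro mult_left_mono add_mono mult_right_mono convolution_wt_sqrt \<kappa> mult_nonneg_nonneg) auto
  also have "norm (H k) \<le> c0 * \<Lambda> * norm \<xi>" by (rule norm_H_le[OF \<kappa>(1,2)])
  finally show ?thesis by (simp add: algebra_simps)
qed

end

section \<open>Estimates in expectation\<close>

text \<open>Adaptedness to the filtration of the indices, in combinatorial form.\<close>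

definition determined :: "nat \<Rightarrow> ((nat \<Rightarrow> 'n) \<Rightarrow> 'b) \<Rightarrow> bool" where
  "determined k F \<longleftrightarrow> (\<forall>i i'. (\<forall>j<k. i j = i' j) \<longrightarrow> F i = F i')"

text \<open>For a function of the first \<open>k\<close> indices only, \<open>avg k\<close> is the expectation over independent
  uniform indices, and the dummy value of the remaining indices is irrelevant.\<close>

primrec avg :: "nat \<Rightarrow> ((nat \<Rightarrow> 'n::finite) \<Rightarrow> real) \<Rightarrow> real" where
  "avg 0 F = F (\<lambda>_. undefined)"
| "avg (Suc k) F = avg k (\<lambda>i. (\<Sum>a\<in>UNIV. F (i(k := a))) / real CARD('n))"

lemma determined_mono: "determined k F \<Longrightarrow> k \<le> m \<Longrightarrow> determined m F"
  unfolding determined_def by (meson order.strict_trans2)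

lemma determinedD: "determined k F \<Longrightarrow> k \<le> m \<Longrightarrow> F (i(m := a)) = F i"
  unfolding determined_def by (metis fun_upd_other leD)

lemma determined_upd: "determined (Suc k) F \<Longrightarrow> determined k (\<lambda>i. F (i(k := a)))"
  unfolding determined_def by (metis fun_upd_def less_Suc_eq)

lemma avg_mono: "(\<And>i. F i \<le> G i) \<Longrightarrow> avg k F \<le> avg k G"
proof (induction k arbitrary: F G)
  case (Suc k)
  show ?case unfolding avg.simps by (intro Suc.IH divide_right_mono sum_mono Suc.prems) auto
qed simp

lemma avg_add: "avg k (\<lambda>i. F i + G i) = avg k F + avg k G"
  by (induction k arbitrary: F G) (simp_all add: sum.distrib add_divide_distrib)

lemma avg_cmult: "avg k (\<lambda>i. c * F i) = c * avg k F"
  by (induction k arbitrary: F) (simp_all flip: sum_distrib_left times_divide_eq_right)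

lemma avg_const: "avg k (\<lambda>i. c) = c"
  by (induction k) simp_all

lemma avg_nonneg: "(\<And>i. 0 \<le> F i) \<Longrightarrow> 0 \<le> avg k F"
  using avg_mono[of "\<lambda>_. 0" F k] by (simp add: avg_const)

lemma avg_sum: "avg k (\<lambda>i. \<Sum>a\<in>S. F a i) = (\<Sum>a\<in>S. avg k (F a))"
  by (induction S rule: infinite_finite_induct) (simp_all add: avg_const avg_add)

text \<open>Given the first \<open>k\<close> indices the increments have mean zero, so the cross term vanishes.\<close>

lemma avg_pythagoras:
  fixes X :: "(nat \<Rightarrow> 'n::finite) \<Rightarrow> 'z::real_inner"
  assumes X: "determined k X" and Z: "\<And>a. determined k (Z a)" and sum: "\<And>i. (\<Sum>a\<in>UNIV. Z a i) = 0"
  shows "avg (Suc k) (\<lambda>i. (norm (X i + Z (i k) i))\<^sup>2) =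
    avg k (\<lambda>i. (norm (X i))\<^sup>2) + avg (Suc k) (\<lambda>i. (norm (Z (i k) i))\<^sup>2)"
proof -
  have "(\<Sum>a\<in>UNIV. (norm (X i + Z a i))\<^sup>2) / real CARD('n)
      = (norm (X i))\<^sup>2 + (\<Sum>a\<in>UNIV. (norm (Z a i))\<^sup>2) / real CARD('n)" for i
  proof -
    have "(\<Sum>a\<in>UNIV. (norm (X i + Z a i))\<^sup>2)
        = (\<Sum>a\<in>(UNIV :: 'n set). (norm (X i))\<^sup>2) + 2 * (X i \<bullet> (\<Sum>a\<in>UNIV. Z a i)) + (\<Sum>a\<in>UNIV. (norm (Z a i))\<^sup>2)"
      by (simp add: power2_norm_eq_inner inner_add_left inner_add_right inner_commute sum.distrib
          inner_sum_right sum_distrib_left algebra_simps)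
    then show ?thesis by (simp add: sum add_divide_distrib)
  qed
  then show ?thesis
    using determinedD[OF X order_refl] determinedD[OF Z order_refl] by (simp add: avg_add)
qed

context svrg_process
begin

section \<open>Orthogonal decomposition of the mean square\<close>

lemma e_determined: "determined k (\<lambda>i. e i k)"
proof (induction k rule: less_induct)
  case (less k)
  show ?case
  proof (cases k)
    case 0
    then show ?thesis by (simp add: determined_def e_0)
  next
    case (Suc m)
    have le: "m div M * M \<le> m" by simp
    have dm: "determined k (\<lambda>i. e i m)" by (rule determined_mono[OF less.IH]) (use Suc in auto)
    have dz: "determined k (\<lambda>i. e i (m div M * M))"
      by (rule determined_mono[OF less.IH]) (use Suc le in linarith)+
    show ?thesis
      unfolding determined_def
    proof (intro allI impI)
      fix i i' :: "nat \<Rightarrow> 'n" assume eq: "\<forall>j<k. i j = i' j"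
      have "e i m = e i' m" "e i (m div M * M) = e i' (m div M * M)" "i m = i' m"
        using dm dz eq Suc unfolding determined_def by blast+
      then show "e i k = e i' k" by (simp only: Suc e_Suc)
    qed
  qed
qed

lemma V_determined: "determined k (\<lambda>i. V i k)"
  using e_determined[of k] determined_mono[OF e_determined[of "k div M * M"], of k]
  by (simp add: V_def determined_def) metis

lemma sum_noise: "(\<Sum>a\<in>UNIV. noise a v) = 0"
  using sum_adj_rows[of A "A v"] n_pos by (simp add: noise_def sum_subtractf normal_op_apply sum_constant_scaleR del: sum_constant)

text \<open>The noise terms are martingale differences, so their squares add up instead of their
  norms. The induction peels off the last step and absorbs it into \<open>T\<close>; the offset
  \<open>Y\<close>, known at time \<open>m\<close>, lets the lemma treat differences to the start of
  an epoch.\<close>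

lemma avg_unroll:
  fixes T :: "'x \<Rightarrow> 'z::real_inner"
  assumes "linear T" "determined m Y"
  shows "avg (m + t) (\<lambda>i. (norm (T (e i (m + t)) + Y i))\<^sup>2) =
     avg m (\<lambda>i. (norm (T (R t (e i m) + H t) + Y i))\<^sup>2)
     + c0\<^sup>2 * (\<Sum>s<t. avg (Suc (m + s)) (\<lambda>i. (norm (T (R (t - Suc s) (N i (m + s)))))\<^sup>2))"
  using assms
proof (induction t arbitrary: T Y)
  case 0
  then show ?case by (simp add: R_0 H_def)
next
  case (Suc t)
  interpret T: linear T by fact
  define X where "X i = T (R (Suc 0) (e i (m + t))) + (T h + Y i)" for i
  define Z where "Z a i = c0 *\<^sub>R T (noise a (V i (m + t)))" for a i
  have Y: "determined (m + t) Y" using Suc.prems(2) by (rule determined_mono) simp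
  have X: "determined (m + t) X"
    using e_determined[of "m + t"] Y by (simp add: X_def determined_def) metis
  have Z: "determined (m + t) (Z a)" for a
    using V_determined[of "m + t"] by (simp add: Z_def determined_def) metis
  have "(\<Sum>a\<in>UNIV. Z a i) = 0" for i
    unfolding Z_def scaleR_sum_right[symmetric] T.sum[symmetric] sum_noise by (simp add: T.zero)
  from avg_pythagoras[OF X Z this]
  have "avg (m + Suc t) (\<lambda>i. (norm (T (e i (m + Suc t)) + Y i))\<^sup>2)
      = avg (m + t) (\<lambda>i. (norm (X i))\<^sup>2) + avg (Suc (m + t)) (\<lambda>i. (norm (Z (i (m + t)) i))\<^sup>2)"
    by (simp add: X_def Z_def e_step N_def T.add T.scaleR add_ac del: avg.simps)
  also have "avg (Suc (m + t)) (\<lambda>i. (norm (Z (i (m + t)) i))\<^sup>2)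
      = c0\<^sup>2 * avg (Suc (m + t)) (\<lambda>i. (norm (T (R 0 (N i (m + t)))))\<^sup>2)"
    by (simp add: Z_def N_def R_0 power_mult_distrib avg_cmult del: avg.simps)
  also have "avg (m + t) (\<lambda>i. (norm (X i))\<^sup>2)
      = avg m (\<lambda>i. (norm (T (R (Suc 0) (R t (e i m) + H t)) + (T h + Y i)))\<^sup>2)
     + c0\<^sup>2 * (\<Sum>s<t. avg (Suc (m + s)) (\<lambda>i. (norm (T (R (Suc 0) (R (t - Suc s) (N i (m + s))))))\<^sup>2))"
    unfolding X_def
  proof (rule Suc.IH)
    show "linear (\<lambda>x. T (R (Suc 0) x))"
      using Suc.prems(1) linear_compose[of "blinfun_apply (R (Suc 0))" T]
      by (simp add: o_def bounded_linear.linear blinfun.bounded_linear_right)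
    show "determined m (\<lambda>i. T h + Y i)" using Suc.prems(2) by (auto simp: determined_def)
  qed
  also have "(\<lambda>i. (norm (T (R (Suc 0) (R t (e i m) + H t)) + (T h + Y i)))\<^sup>2)
      = (\<lambda>i. (norm (T (R (Suc t) (e i m) + H (Suc t)) + Y i))\<^sup>2)"
    using R_add[of "Suc 0" t] by (simp add: H_Suc blinfun.add_right T.add add_ac)
  also have "(\<Sum>s<t. avg (Suc (m + s)) (\<lambda>i. (norm (T (R (Suc 0) (R (t - Suc s) (N i (m + s))))))\<^sup>2))
      = (\<Sum>s<t. avg (Suc (m + s)) (\<lambda>i. (norm (T (R (Suc t - Suc s) (N i (m + s)))))\<^sup>2))"
    by (intro sum.cong) (auto simp: R_add[symmetric] Suc_diff_Suc)
  finally show ?case by (simp add: distrib_left del: avg.simps)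
qed

text \<open>A variance is at most the second moment, which leaves the row terms only, and the
  squared norms of the rows sum to \<open>(norm (A v))\<^sup>2\<close>. Averaging over the rows thus
  gains the factor \<open>1 / n\<close>.\<close>

lemma avg_noise_le:
  fixes T :: "'x \<Rightarrow> 'z::real_inner"
  assumes T: "linear T" "\<And>a z. norm (T (blinfun_adj (blinfun_row A a) z)) \<le> c * norm z"
  shows "avg (Suc k) (\<lambda>i. (norm (T (N i k)))\<^sup>2) \<le> c\<^sup>2 / real CARD('n) * avg k (\<lambda>i. (norm (A (V i k)))\<^sup>2)"
proof -
  interpret T: linear T by fact
  have pt: "(\<Sum>a\<in>UNIV. (norm (T (noise a v)))\<^sup>2) \<le> c\<^sup>2 * (norm (A v))\<^sup>2" for v
  proof -
    define u where "u a = T (blinfun_adj (blinfun_row A a) (blinfun_row A a v))" for a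
    have su: "(\<Sum>a\<in>UNIV. u a) = real CARD('n) *\<^sub>R T (B v)"
      using sum_noise[of v] unfolding u_def T.sum[symmetric] noise_def sum_subtractf
      by (simp flip: T.scaleR add: scaleR_conv_of_real sum_constant_scaleR)
    have "(\<Sum>a\<in>UNIV. (norm (T (noise a v)))\<^sup>2) = (\<Sum>a\<in>UNIV. (norm (T (B v) - u a))\<^sup>2)"
      by (simp add: noise_def u_def T.diff)
    also have "\<dots> = real CARD('n) * (norm (T (B v)))\<^sup>2 - 2 * (T (B v) \<bullet> (\<Sum>a\<in>UNIV. u a)) + (\<Sum>a\<in>UNIV. (norm (u a))\<^sup>2)"
      by (simp add: power2_norm_eq_inner inner_diff_left inner_diff_right inner_commute sum.distrib sum_subtractf
          inner_sum_left sum_distrib_left algebra_simps)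
    also have "\<dots> = (\<Sum>a\<in>UNIV. (norm (u a))\<^sup>2) - real CARD('n) * (norm (T (B v)))\<^sup>2"
      unfolding su by (simp add: power2_norm_eq_inner)
    also have "\<dots> \<le> (\<Sum>a\<in>UNIV. (norm (u a))\<^sup>2)" by simp
    also have "\<dots> \<le> (\<Sum>a\<in>UNIV. (c * norm (blinfun_row A a v))\<^sup>2)"
      unfolding u_def by (intro sum_mono power_mono T) auto
    also have "\<dots> = c\<^sup>2 * (norm (A v))\<^sup>2"
      by (simp add: power_mult_distrib norm_vec_sq sum_distrib_left)
    finally show ?thesis .
  qed
  have "avg (Suc k) (\<lambda>i. (norm (T (N i k)))\<^sup>2)
      = avg k (\<lambda>i. (\<Sum>a\<in>UNIV. (norm (T (noise a (V i k))))\<^sup>2) / real CARD('n))"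
    using determinedD[OF V_determined order_refl] by (simp add: N_def)
  also have "\<dots> \<le> avg k (\<lambda>i. c\<^sup>2 / real CARD('n) * (norm (A (V i k)))\<^sup>2)"
    by (intro avg_mono) (use divide_right_mono[OF pt] n_pos in simp)
  finally show ?thesis by (simp only: avg_cmult)
qed

definition "mean_sq j = avg j (\<lambda>i. (norm (A (V i j)))\<^sup>2)"

lemma mean_sq_nonneg: "0 \<le> mean_sq j"
  unfolding mean_sq_def by (intro avg_nonneg) simp

definition "mean_ker r = c0\<^sup>2 * L * sq_ker r"

lemma mean_ker_nonneg: "0 \<le> mean_ker r"
  using L_nonneg sq_ker_nonneg by (simp add: mean_ker_def)

lemma linear_A_poly:
  fixes S S' :: "'x \<Rightarrow>\<^sub>L 'x" and T :: "'x \<Rightarrow>\<^sub>L 'z::real_normed_vector"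
  shows "linear (\<lambda>x. A (S x))" "linear (\<lambda>x. A (S (S' x)))" "linear (blinfun_apply T)"
  by (intro bounded_linear.linear bounded_linear_compose[OF blinfun.bounded_linear_right]
      bounded_linear_compose[OF blinfun.bounded_linear_right] blinfun.bounded_linear_right)+

text \<open>\<open>avg_unroll\<close> is used twice: within the epoch with \<open>T = A\<close> and
  the epoch start as offset, then from the epoch start down to zero with \<open>T\<close> equal to
  \<open>A\<close> after \<open>Q t\<close>. \<open>H_shift\<close> merges the deterministic
  remainders.\<close>

lemma mean_sq_rec:
  assumes t: "t < M"
  shows "mean_sq (K*M + t) \<le> (det_coeff (real CARD('n)) / wt K + norm \<xi>)\<^sup>2
      + (\<Sum>j<K*M. mean_ker (K*M - Suc j) * mean_sq j)
      + (\<Sum>s<t. mean_ker (t - Suc s) * mean_sq (K*M + s))"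
proof -
  have ker: "c0\<^sup>2 * avg (Suc j) (\<lambda>i. (norm (T (N i j)))\<^sup>2) \<le> mean_ker r * mean_sq j"
    if "linear T" "\<And>a z. norm (T (blinfun_adj (blinfun_row A a) z)) \<le> sqrt (real CARD('n) * L * sq_ker r) * norm z"
    for T :: "'x \<Rightarrow> 'y^'n" and r j
  proof -
    have "avg (Suc j) (\<lambda>i. (norm (T (N i j)))\<^sup>2)
       \<le> (sqrt (real CARD('n) * L * sq_ker r))\<^sup>2 / real CARD('n) * mean_sq j"
      unfolding mean_sq_def by (rule avg_noise_le[OF that])
    also have "(sqrt (real CARD('n) * L * sq_ker r))\<^sup>2 / real CARD('n) = L * sq_ker r"
      using L_nonneg sq_ker_nonneg[of r] by simp
    finally show ?thesis by (simp add: mean_ker_def mult_left_mono mult.assoc)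
  qed
  define Y where "Y i = - A (e i (K*M))" for i
  have Y: "determined (K*M) Y" using e_determined[of "K*M"] by (simp add: Y_def determined_def) metis
  have "mean_sq (K*M + t) = avg (K*M + t) (\<lambda>i. (norm (A (e i (K*M + t)) + Y i))\<^sup>2)"
    unfolding mean_sq_def V_def Y_def using t by (simp add: blinfun.diff_right)
  also have "\<dots> = avg (K*M) (\<lambda>i. (norm (A (R t (e i (K*M)) + H t) + Y i))\<^sup>2)
     + c0\<^sup>2 * (\<Sum>s<t. avg (Suc (K*M + s)) (\<lambda>i. (norm (A (R (t - Suc s) (N i (K*M + s)))))\<^sup>2))"
    by (rule avg_unroll[OF linear_A_poly(3) Y])
  also have "(\<lambda>i. (norm (A (R t (e i (K*M)) + H t) + Y i))\<^sup>2) = (\<lambda>i. (norm (A (Q t (e i (0 + K*M))) + A (H t)))\<^sup>2)"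
    by (simp add: Y_def Q_apply blinfun.add_right blinfun.diff_right algebra_simps)
  also have "avg (K*M) \<dots> = avg 0 (\<lambda>i. (norm (A (Q t (R (K*M) (e i 0) + H (K*M))) + A (H t)))\<^sup>2)
     + c0\<^sup>2 * (\<Sum>j<K*M. avg (Suc (0 + j)) (\<lambda>i. (norm (A (Q t (R (K*M - Suc j) (N i (0 + j))))))\<^sup>2))"
    using avg_unroll[OF linear_A_poly(1), of 0 "\<lambda>_. A (H t)" "K*M" "Q t"] by (simp add: determined_def del: avg.simps)
  also have "avg 0 (\<lambda>i. (norm (A (Q t (R (K*M) (e i 0) + H (K*M))) + A (H t)))\<^sup>2)
      = (norm (A (R (K*M) (Q t e0 + H t))))\<^sup>2"
  proof -
    have "Q t (R (K*M) e0) = R (K*M) (Q t e0)"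
      by (simp only: Q_def R_def blinfun_poly_mult_apply[symmetric] mult.commute)
    then have "A (Q t (R (K*M) e0 + H (K*M))) + A (H t) = A (R (K*M) (Q t e0)) + A (Q t (H (K*M)) + H t)"
      by (simp add: blinfun.add_right)
    then show ?thesis unfolding H_shift by (simp add: e_0 blinfun.add_right)
  qed
  also have "(norm (A (R (K*M) (Q t e0 + H t))))\<^sup>2 \<le> (det_coeff (real CARD('n)) / wt K + norm \<xi>)\<^sup>2"
    using det_part_le[OF t, of K] by (intro power_mono) (auto simp: det_coeff_def)
  also have "c0\<^sup>2 * (\<Sum>j<K*M. avg (Suc (0 + j)) (\<lambda>i. (norm (A (Q t (R (K*M - Suc j) (N i (0 + j))))))\<^sup>2))
      \<le> (\<Sum>j<K*M. mean_ker (K*M - Suc j) * mean_sq j)"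
    unfolding sum_distrib_left add_0
    by (intro sum_mono ker linear_A_poly A_QR_adj_row t)
  also have "c0\<^sup>2 * (\<Sum>s<t. avg (Suc (K*M + s)) (\<lambda>i. (norm (A (R (t - Suc s) (N i (K*M + s)))))\<^sup>2))
      \<le> (\<Sum>s<t. mean_ker (t - Suc s) * mean_sq (K*M + s))"
    unfolding sum_distrib_left
    by (intro sum_mono ker linear_A_poly A_R_adj_row) (use t in auto)
  finally show ?thesis by (simp add: add_ac)
qed

text \<open>The alternatives mirror the two entries of the maximum in
  \<open>step_bound_expectation\<close>; each controls the first block of the kernel through one
  entry of the minimum in \<open>sq_ker\<close>.\<close>

definition "small_mean_step \<longleftrightarrow> 45 * (c0\<^sup>2 * L * \<beta> * real M) \<le> 1 \<or> 9 * (c0 * L) * (15 + 7 * ln (real M)) \<le> 1"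

lemma mean_ker_first:
  assumes small_mean_step
  shows "(\<Sum>r<M. mean_ker r) \<le> 1 / 45"
  using assms unfolding small_mean_step_def
proof
  assume s: "45 * (c0\<^sup>2 * L * \<beta> * real M) \<le> 1"
  have "(\<Sum>r<M. mean_ker r) \<le> (\<Sum>r<M. c0\<^sup>2 * L * \<beta>)"
  proof (rule sum_mono)
    fix r assume "r \<in> {..<M}"
    then have r: "r < M" by simp
    show "mean_ker r \<le> c0\<^sup>2 * L * \<beta>"
      unfolding mean_ker_def sq_ker_def if_P[OF r]
      using L_nonneg by (intro mult_left_mono min.cobounded1) auto
  qed
  also have "\<dots> = c0\<^sup>2 * L * \<beta> * real M" by simp
  finally show ?thesis using s by linarith
next
  assume s: "9 * (c0 * L) * (15 + 7 * ln (real M)) \<le> 1"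
  have lnM: "0 \<le> ln (real M)" using M by simp
  have cL: "0 \<le> c0 * L" using c0 L_nonneg by simp
  have "(\<Sum>r<M. mean_ker r) \<le> (\<Sum>r<M. c0 * L * (1 / real (Suc r)))"
  proof (rule sum_mono)
    fix r assume "r \<in> {..<M}"
    then have r: "r < M" by simp
    have "mean_ker r \<le> c0\<^sup>2 * L * (1 / (c0 * real (Suc (2 * r))))"
      unfolding mean_ker_def sq_ker_def if_P[OF r]
      using L_nonneg by (intro mult_left_mono min.cobounded2) auto
    also have "\<dots> = c0 * L * (1 / real (Suc (2 * r)))" using c0 by (simp add: power2_eq_square)
    also have "\<dots> \<le> c0 * L * (1 / real (Suc r))" using cL by (intro mult_left_mono divide_left_mono) auto
    finally show "mean_ker r \<le> c0 * L * (1 / real (Suc r))" .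
  qed
  also have "\<dots> = c0 * L * (\<Sum>m=1..M. 1 / real m)"
    unfolding sum_distrib_left[symmetric]
    by (rule arg_cong[where f = "\<lambda>z. c0 * L * z"], rule sum.reindex_bij_witness[of _ "\<lambda>m. m - 1" Suc]) auto
  also have "\<dots> \<le> c0 * L * (1 + ln (real M))" using cL M by (intro mult_left_mono sum_inverse_le_ln)
  also have "\<dots> \<le> c0 * L * ((15 + 7 * ln (real M)) / 7)" using cL lnM by (intro mult_left_mono) auto
  also have "\<dots> \<le> 1 / 45" using s by simp
  finally show ?thesis .
qed

lemma mean_ker_block:
  assumes m: "m \<ge> 1"
  shows "(\<Sum>r<M. mean_ker (m*M + r)) \<le> 27 / 125 / real m ^ 3"
proof -
  have mM: "real m * real M > 0" "real m > 0" "real M > 0" using m M by auto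
  have "M \<le> m*M" using m by simp
  then have nlt: "\<not> m*M + r < M" for r by linarith
  have cL: "0 \<le> c0 * L" using c0 L_nonneg by simp
  have "(\<Sum>r<M. mean_ker (m*M + r)) \<le> (\<Sum>r<M. 1 * ((real M)\<^sup>2 * (27 / 125) / (real m * real M) ^ 3))"
  proof (rule sum_mono)
    fix r
    have "mean_ker (m*M + r) = (c0 * L) * ((real M)\<^sup>2 * (27 / 125) / real (m*M + r) ^ 3)"
      unfolding mean_ker_def sq_ker_def if_not_P[OF nlt] using c0 by (simp add: power2_eq_square)
    also have "\<dots> \<le> 1 * ((real M)\<^sup>2 * (27 / 125) / (real m * real M) ^ 3)"
      using c0L cL mM by (intro mult_mono divide_left_mono power_mono mult_pos_pos zero_less_power)
        (auto intro: add_pos_nonneg)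
    finally show "mean_ker (m*M + r) \<le> 1 * ((real M)\<^sup>2 * (27 / 125) / (real m * real M) ^ 3)" .
  qed
  also have "\<dots> = 27 / 125 / real m ^ 3" using mM by (simp add: power2_eq_square power3_eq_cube)
  finally show ?thesis .
qed

text \<open>Budget: the first block counted twice gives \<open>2 / 45\<close>, the later ones at
  most \<open>2 * 27 / 125\<close>, together below \<open>1 / 2\<close>. For the later blocks
  \<open>c0 * L \<le> 1\<close> is enough.\<close>

lemma mean_ker_mass:
  assumes small_mean_step
  shows "(\<Sum>r<M. mean_ker r) + (\<Sum>r<J*M. mean_ker r) \<le> 1 / 2"
    "(\<Sum>r<M. mean_ker (m*M + r)) * wt (Suc m) \<le> 12 * real CARD('n)"
proof -
  note first = mean_ker_first[OF assms]
  have block: "(\<Sum>r<M. mean_ker (m*M + r)) \<le> 27 / 125 * (1 / (real m)\<^sup>2)" if m: "m \<ge> 1" for m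
  proof -
    have "(real m)\<^sup>2 \<le> real m ^ 3" using m by (intro power_increasing) auto
    then have "27 / 125 / real m ^ 3 \<le> 27 / 125 / (real m)\<^sup>2" using m by (intro divide_left_mono) auto
    then show ?thesis using mean_ker_block[OF m] by simp
  qed
  have tail: "(\<Sum>m=1..J. \<Sum>r<M. mean_ker (m*M + r)) \<le> 27 / 125 * (\<Sum>m=1..J. 1 / (real m)\<^sup>2)" for J
    unfolding sum_distrib_left by (intro sum_mono block) auto
  then have "2 * (\<Sum>r<M. mean_ker r) + (\<Sum>m=1..J. \<Sum>r<M. mean_ker (m*M + r)) \<le> 1 / 2" for J
    using first sum_inverse_square_le[of J] tail[of J] by linarith
  then show "(\<Sum>r<M. mean_ker r) + (\<Sum>r<J*M. mean_ker r) \<le> 1 / 2"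
    by (intro kernel_mass_le mean_ker_nonneg)
  show "(\<Sum>r<M. mean_ker (m*M + r)) * wt (Suc m) \<le> 12 * real CARD('n)"
  proof (cases "m = 0")
    case True
    have "wt (Suc 0) \<le> 4" by (simp add: wt_def real_le_lsqrt)
    then have "(\<Sum>r<M. mean_ker r) * wt (Suc 0) \<le> (1 / 45) * 4"
      using first wt_pos[of "Suc 0"] by (intro mult_mono) auto
    also have "\<dots> \<le> 12 * real CARD('n)" using n_pos by linarith
    finally show ?thesis using True by simp
  next
    case False
    then have m: "m \<ge> 1" by simp
    have "(\<Sum>r<M. mean_ker (m*M + r)) * wt (Suc m) \<le> (27 / 125 * (1 / (real m)\<^sup>2)) * (9 * (real m)\<^sup>2)"
      using wt_pos[of "Suc m"] m by (intro mult_mono block wt_Suc_le) auto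
    also have "\<dots> = 243 / 125" using m by simp
    also have "\<dots> \<le> 12 * real CARD('n)" using n_pos by linarith
    finally show ?thesis .
  qed
qed

lemma mean_sq_le:
  assumes C: "epoch_const M (12 * real CARD('n)) C" and small: small_mean_step
  shows "mean_sq j \<le> C * (2 * (det_coeff (real CARD('n)))\<^sup>2 / wt j + 2 * (norm \<xi>)\<^sup>2)"
proof -
  have sq: "(det_coeff (real CARD('n)) / wt K + norm \<xi>)\<^sup>2 \<le> 2 * (det_coeff (real CARD('n)))\<^sup>2 / wt K + 2 * (norm \<xi>)\<^sup>2" for K
  proof -
    define x where "x = det_coeff (real CARD('n)) / wt K"
    have "0 \<le> (x - norm \<xi>)\<^sup>2" by simp
    then have "(x + norm \<xi>)\<^sup>2 \<le> 2 * x\<^sup>2 + 2 * (norm \<xi>)\<^sup>2" by (simp add: power2_eq_square algebra_simps)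
    also have "x\<^sup>2 = (det_coeff (real CARD('n)))\<^sup>2 / (wt K * wt K)" by (simp add: x_def power2_eq_square)
    \<comment> \<open>One factor of the weight is given up: the Volterra bound transports decay of
      order \<open>1 / wt\<close>, and this already yields \<open>1 / Suc k\<close> in
      \<open>convolution_wt\<close>.\<close>
    also have "\<dots> \<le> (det_coeff (real CARD('n)))\<^sup>2 / wt K"
      using wt_ge_1[of K] mult_left_mono[of 1 "wt K" "wt K"] by (intro divide_left_mono) auto
    finally show ?thesis by (simp add: x_def)
  qed
  have rec: "mean_sq (K*M + t) \<le> 2 * (det_coeff (real CARD('n)))\<^sup>2 / wt K + 2 * (norm \<xi>)\<^sup>2
      + (\<Sum>j<K*M. mean_ker (K*M - Suc j) * mean_sq j)
      + (\<Sum>s<t. mean_ker (t - Suc s) * mean_sq (K*M + s))" if "t < M" for K t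
    using mean_sq_rec[OF that, of K] sq[of K] by linarith
  show ?thesis
    by (rule C[unfolded epoch_const_def, rule_format, of mean_ker "2 * (det_coeff (real CARD('n)))\<^sup>2"
          "2 * (norm \<xi>)\<^sup>2" mean_sq])
      (intro conjI allI impI mean_ker_nonneg mean_ker_mass small mean_sq_nonneg rec, auto)
qed

text \<open>Mean-square counterpart of \<open>path_error_le\<close>: since squares add, the inverse
  root of the lag enters squared and \<open>convolution_wt\<close> takes the place of
  \<open>convolution_wt_sqrt\<close>. The root is drawn only at the end.\<close>

lemma mean_error_le:
  assumes C: "epoch_const M (12 * real CARD('n)) C" "0 \<le> C" and small: small_mean_step
    and \<kappa>: "\<And>r y. norm (R r (blinfun_adj A y)) \<le> \<kappa> r * norm y" "(\<Sum>r<k. \<kappa> r) \<le> \<Lambda>"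
      "\<And>r. 0 \<le> \<kappa> r" "\<And>r. \<kappa> r \<le> sqrt (real CARD('n) / c0) / sqrt (real (Suc r))"
  shows "sqrt (avg k (\<lambda>i. (norm (e i k))\<^sup>2)) \<le> norm (R k e0)
     + sqrt (18 * c0 * C) * det_coeff (real CARD('n)) / sqrt (real (Suc k))
     + (c0 + c0 * sqrt (2 * C)) * \<Lambda> * norm \<xi>"
proof -
  have \<Lambda>: "0 \<le> \<Lambda>" using \<kappa>(2) sum_nonneg[of "{..<k}" \<kappa>] \<kappa>(3) by force
  define D where "D = det_coeff (real CARD('n))"
  have bnd: "avg (Suc j) (\<lambda>i. (norm (R (k - Suc j) (N i j)))\<^sup>2)
      \<le> 2 * C * D\<^sup>2 / c0 * (1 / real (Suc (k - Suc j)) * (1 / wt j)) + 2 * C * (norm \<xi>)\<^sup>2 * (\<kappa> (k - Suc j))\<^sup>2" for j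
  proof -
    define r where "r = k - Suc j"
    have "avg (Suc j) (\<lambda>i. (norm (R r (N i j)))\<^sup>2) \<le> (\<kappa> r)\<^sup>2 / real CARD('n) * mean_sq j"
      unfolding mean_sq_def
    proof (rule avg_noise_le[OF linear_A_poly(3)])
      show "norm (R r (blinfun_adj (blinfun_row A a) z)) \<le> \<kappa> r * norm z" for a z
        using \<kappa>(1)[of r "axis a z"]
        by (simp add: adj_row_eq_adj_axis norm_eq_sqrt_inner[of "axis _ _"] inner_axis flip: norm_eq_sqrt_inner)
    qed
    also have "\<dots> \<le> (\<kappa> r)\<^sup>2 / real CARD('n) * (C * (2 * D\<^sup>2 / wt j + 2 * (norm \<xi>)\<^sup>2))"
      unfolding D_def by (intro mult_left_mono mean_sq_le C small) auto
    also have "\<dots> = (\<kappa> r)\<^sup>2 / real CARD('n) * (2 * C * D\<^sup>2 * (1 / wt j)) + 2 * C * (norm \<xi>)\<^sup>2 * ((\<kappa> r)\<^sup>2 / real CARD('n))"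
      by (simp add: algebra_simps)
    also have "\<dots> \<le> (1 / c0 * (1 / real (Suc r))) * (2 * C * D\<^sup>2 * (1 / wt j)) + 2 * C * (norm \<xi>)\<^sup>2 * (\<kappa> r)\<^sup>2"
    proof (intro add_mono mult_right_mono mult_left_mono)
      have "(\<kappa> r)\<^sup>2 \<le> (sqrt (real CARD('n) / c0) / sqrt (real (Suc r)))\<^sup>2" by (intro power_mono \<kappa>)
      also have "\<dots> = real CARD('n) * (1 / c0 * (1 / real (Suc r)))" using c0 by (simp add: power_divide)
      finally show "(\<kappa> r)\<^sup>2 / real CARD('n) \<le> 1 / c0 * (1 / real (Suc r))"
        using n_pos by (simp add: pos_divide_le_eq mult.commute)
      show "(\<kappa> r)\<^sup>2 / real CARD('n) \<le> (\<kappa> r)\<^sup>2" using n_pos mult_left_mono[of 1 "real CARD('n)" "(\<kappa> r)\<^sup>2"] by (simp add: divide_le_eq)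
    qed (use C wt_pos[of j] in auto)
    finally show ?thesis unfolding r_def by (simp add: mult_ac)
  qed
  have "avg k (\<lambda>i. (norm (e i k))\<^sup>2) = (norm (R k e0 + H k))\<^sup>2
     + c0\<^sup>2 * (\<Sum>j<k. avg (Suc j) (\<lambda>i. (norm (R (k - Suc j) (N i j)))\<^sup>2))"
    using avg_unroll[OF linear_id, of 0 "\<lambda>_. 0" k] by (simp add: determined_def e_0 id_def)
  also have "\<dots> \<le> (norm (R k e0) + c0 * \<Lambda> * norm \<xi>)\<^sup>2
     + c0\<^sup>2 * (2 * C * D\<^sup>2 / c0 * (9 / real (Suc k)) + 2 * C * (norm \<xi>)\<^sup>2 * \<Lambda>\<^sup>2)"
  proof (intro add_mono mult_left_mono)
    have "norm (R k e0 + H k) \<le> norm (R k e0) + c0 * \<Lambda> * norm \<xi>"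
      using norm_triangle_ineq[of "R k e0" "H k"] norm_H_le[OF \<kappa>(1,2)] by linarith
    then show "(norm (R k e0 + H k))\<^sup>2 \<le> (norm (R k e0) + c0 * \<Lambda> * norm \<xi>)\<^sup>2" by (intro power_mono) auto
    have "(\<Sum>j<k. avg (Suc j) (\<lambda>i. (norm (R (k - Suc j) (N i j)))\<^sup>2))
      \<le> 2 * C * D\<^sup>2 / c0 * (\<Sum>j<k. 1 / real (Suc (k - Suc j)) * (1 / wt j)) + 2 * C * (norm \<xi>)\<^sup>2 * (\<Sum>j<k. (\<kappa> (k - Suc j))\<^sup>2)"
      unfolding sum_distrib_left sum.distrib[symmetric] by (intro sum_mono bnd)
    also have "\<dots> \<le> 2 * C * D\<^sup>2 / c0 * (9 / real (Suc k)) + 2 * C * (norm \<xi>)\<^sup>2 * \<Lambda>\<^sup>2"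
    proof (intro add_mono mult_left_mono convolution_wt)
      have "(\<Sum>j<k. (\<kappa> (k - Suc j))\<^sup>2) = (\<Sum>j<k. (\<kappa> j)\<^sup>2)" by (rule sum.nat_diff_reindex)
      \<comment> \<open>The sum of squares of nonnegative numbers is at most the square of the sum,
        so the same \<open>\<Lambda>\<close> serves both kinds of estimate.\<close>
      also have "\<dots> \<le> (\<Sum>j<k. \<kappa> j * (\<Sum>r<k. \<kappa> r))"
        unfolding power2_eq_square using \<kappa>(3) by (intro sum_mono mult_left_mono member_le_sum) auto
      also have "\<dots> = (\<Sum>r<k. \<kappa> r)\<^sup>2" by (simp add: sum_distrib_right power2_eq_square)
      also have "\<dots> \<le> \<Lambda>\<^sup>2" using \<kappa> by (intro power_mono sum_nonneg) auto
      finally show "(\<Sum>j<k. (\<kappa> (k - Suc j))\<^sup>2) \<le> \<Lambda>\<^sup>2" .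
    qed (use C c0 in auto)
    finally show "(\<Sum>j<k. avg (Suc j) (\<lambda>i. (norm (R (k - Suc j) (N i j)))\<^sup>2))
      \<le> 2 * C * D\<^sup>2 / c0 * (9 / real (Suc k)) + 2 * C * (norm \<xi>)\<^sup>2 * \<Lambda>\<^sup>2" .
  qed auto
  also have "\<dots> = (norm (R k e0) + c0 * \<Lambda> * norm \<xi>)\<^sup>2
     + ((sqrt (18 * c0 * C) * D / sqrt (real (Suc k)))\<^sup>2 + (c0 * sqrt (2 * C) * \<Lambda> * norm \<xi>)\<^sup>2)"
  proof -
    have 1: "(sqrt (18 * c0 * C) * D / sqrt (real (Suc k)))\<^sup>2 = 18 * c0 * C * D\<^sup>2 / real (Suc k)"
      using c0 C by (simp add: power_mult_distrib power_divide)
    have 2: "(c0 * sqrt (2 * C) * \<Lambda> * norm \<xi>)\<^sup>2 = c0\<^sup>2 * (2 * C * (norm \<xi>)\<^sup>2 * \<Lambda>\<^sup>2)"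
      using C by (simp add: power_mult_distrib)
    have 3: "c0\<^sup>2 * (2 * C * D\<^sup>2 / c0 * (9 / real (Suc k))) = 18 * c0 * C * D\<^sup>2 / real (Suc k)"
      using c0 by (simp add: power2_eq_square[of c0])
    show ?thesis unfolding 1 2 distrib_left 3 ..
  qed
  finally have "sqrt (avg k (\<lambda>i. (norm (e i k))\<^sup>2)) \<le> sqrt ((norm (R k e0) + c0 * \<Lambda> * norm \<xi>)\<^sup>2
     + ((sqrt (18 * c0 * C) * D / sqrt (real (Suc k)))\<^sup>2 + (c0 * sqrt (2 * C) * \<Lambda> * norm \<xi>)\<^sup>2))"
    by (rule real_sqrt_le_mono)
  also have "\<dots> \<le> (norm (R k e0) + c0 * \<Lambda> * norm \<xi>) + (sqrt (18 * c0 * C) * D / sqrt (real (Suc k)) + c0 * sqrt (2 * C) * \<Lambda> * norm \<xi>)"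
  proof -
    have s: "sqrt (x\<^sup>2 + (y\<^sup>2 + z\<^sup>2)) \<le> x + (y + z)" if "0 \<le> x" "0 \<le> y" "0 \<le> z" for x y z :: real
      using that by (intro real_le_lsqrt) (auto simp: power2_eq_square algebra_simps)
    show ?thesis by (rule s) (use c0 C \<Lambda> det_coeff_nonneg in \<open>auto simp: D_def\<close>)
  qed
  finally show ?thesis unfolding D_def by (simp add: algebra_simps)
qed

end

section \<open>Truncation and source condition\<close>

lemma iid_event:
  fixes I :: "nat \<Rightarrow> 'w \<Rightarrow> 'n::finite"
  assumes P: "prob_space P" and I: "iid_uniform P I" and J: "finite J"
  shows "{\<omega> \<in> space P. \<forall>j\<in>J. I j \<omega> = b j} \<in> sets P"
    "measure P {\<omega> \<in> space P. \<forall>j\<in>J. I j \<omega> = b j} = 1 / real CARD('n) ^ card J"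
proof -
  interpret prob_space P by fact
  have indep: "indep_vars (\<lambda>_. count_space UNIV) I UNIV"
    and dist: "distr P (count_space UNIV) (I k) = uniform_count_measure UNIV" for k
    using I by (auto simp: iid_uniform_def)
  have meas: "I k \<in> measurable P (count_space UNIV)" for k
    using indep by (auto simp: indep_vars_def)
  have one: "measure P (I k -` {c} \<inter> space P) = 1 / real CARD('n)" for k c
  proof -
    have "measure (distr P (count_space UNIV) (I k)) {c} = measure P (I k -` {c} \<inter> space P)"
      by (rule measure_distr[OF meas]) simp
    then show ?thesis unfolding dist by (simp add: measure_uniform_count_measure)
  qed
  have sets1: "I k -` {c} \<inter> space P \<in> sets P" for k c
    by (rule measurable_sets[OF meas]) simp
  show "{\<omega> \<in> space P. \<forall>j\<in>J. I j \<omega> = b j} \<in> sets P"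
  proof (cases "J = {}")
    case False
    then have "{\<omega> \<in> space P. \<forall>j\<in>J. I j \<omega> = b j} = (\<Inter>j\<in>J. I j -` {b j} \<inter> space P)" by auto
    then show ?thesis by (simp only:) (intro sets.finite_INT J False sets1)
  qed simp
  show "measure P {\<omega> \<in> space P. \<forall>j\<in>J. I j \<omega> = b j} = 1 / real CARD('n) ^ card J"
  proof (cases "J = {}")
    case True
    then show ?thesis by (simp add: prob_space)
  next
    case False
    then have "{\<omega> \<in> space P. \<forall>j\<in>J. I j \<omega> = b j} = (\<Inter>j\<in>J. I j -` {b j} \<inter> space P)" by auto
    then have "measure P {\<omega> \<in> space P. \<forall>j\<in>J. I j \<omega> = b j} = (\<Prod>j\<in>J. measure P (I j -` {b j} \<inter> space P))"
      using indep_varsD[OF indep False J, of "\<lambda>j. {b j}"] by simp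
    then show ?thesis by (simp add: one power_divide)
  qed
qed

text \<open>The induction consumes the last index: splitting by its value \<open>a\<close> freezes
  it inside the function and moves the condition \<open>I k = a\<close> into the event. Hence the
  statement carries an event fixing finitely many later indices; it is used with the empty
  one.\<close>

lemma expectation_eq_avg_event:
  fixes I :: "nat \<Rightarrow> 'w \<Rightarrow> 'n::finite"
  assumes P: "prob_space P" and I: "iid_uniform P I"
    and "determined k F" "finite J" "\<forall>j\<in>J. k \<le> j"
  shows "integrable P (\<lambda>\<omega>. F (\<lambda>j. I j \<omega>) * indicator {\<omega> \<in> space P. \<forall>j\<in>J. I j \<omega> = b j} \<omega>) \<and>
    (\<integral>\<omega>. F (\<lambda>j. I j \<omega>) * indicator {\<omega> \<in> space P. \<forall>j\<in>J. I j \<omega> = b j} \<omega> \<partial>P) = avg k F / real CARD('n) ^ card J"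
  using assms(3-)
proof (induction k arbitrary: F J b)
  case 0
  interpret prob_space P by fact
  have "F (\<lambda>j. I j \<omega>) = F (\<lambda>_. undefined)" for \<omega> using 0(1) by (simp add: determined_def)
  then show ?case using iid_event[OF P I 0(2), of b] by (simp add: emeasure_eq_measure)
next
  case (Suc k)
  interpret prob_space P by fact
  define G where "G a i = F (i(k := a))" for a i
  have G: "determined k (G a)" for a unfolding G_def by (rule determined_upd[OF Suc.prems(1)])
  have kJ: "k \<notin> J" using Suc.prems by force
  have ind: "F (\<lambda>j. I j \<omega>) * indicator {\<omega> \<in> space P. \<forall>j\<in>J. I j \<omega> = b j} \<omega>
     = (\<Sum>a\<in>UNIV. G a (\<lambda>j. I j \<omega>) * indicator {\<omega> \<in> space P. \<forall>j\<in>insert k J. I j \<omega> = (b(k := a)) j} \<omega>)" for \<omega>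
  proof -
    have "G a (\<lambda>j. I j \<omega>) * indicator {\<omega> \<in> space P. \<forall>j\<in>insert k J. I j \<omega> = (b(k := a)) j} \<omega>
      = (if a = I k \<omega> then F (\<lambda>j. I j \<omega>) * indicator {\<omega> \<in> space P. \<forall>j\<in>J. I j \<omega> = b j} \<omega> else 0)" for a
    proof (cases "a = I k \<omega>")
      case True
      then have "(\<lambda>j. I j \<omega>)(k := a) = (\<lambda>j. I j \<omega>)" by (simp add: fun_eq_iff)
      then have "G a (\<lambda>j. I j \<omega>) = F (\<lambda>j. I j \<omega>)" by (simp add: G_def)
      moreover have "(\<forall>j\<in>insert k J. I j \<omega> = (b(k := a)) j) = (\<forall>j\<in>J. I j \<omega> = b j)"
        using True kJ by (auto simp: fun_upd_def)
      ultimately show ?thesis using True by (simp add: indicator_def)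
    qed auto
    then show ?thesis by simp
  qed
  have fin: "finite (insert k J)" and card_insert: "card (insert k J) = Suc (card J)"
    using Suc.prems kJ by auto
  have ge: "\<forall>j\<in>insert k J. k \<le> j" using Suc.prems by (auto intro: Suc_leD)
  have IH: "integrable P (\<lambda>\<omega>. G a (\<lambda>j. I j \<omega>) * indicator {\<omega> \<in> space P. \<forall>j\<in>insert k J. I j \<omega> = (b(k := a)) j} \<omega>)"
     "(\<integral>\<omega>. G a (\<lambda>j. I j \<omega>) * indicator {\<omega> \<in> space P. \<forall>j\<in>insert k J. I j \<omega> = (b(k := a)) j} \<omega> \<partial>P)
       = avg k (G a) / real CARD('n) ^ Suc (card J)" for a
    using Suc.IH[OF G[of a] fin ge, of "b(k := a)"] unfolding card_insert by blast+
  have eq: "avg (Suc k) F / real CARD('n) ^ card J = (\<Sum>a\<in>UNIV. avg k (G a) / real CARD('n) ^ Suc (card J))"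
  proof -
    have "avg (Suc k) F = avg k (\<lambda>i. inverse (real CARD('n)) * (\<Sum>a\<in>UNIV. G a i))"
      by (simp add: G_def divide_inverse mult.commute)
    also have "\<dots> = inverse (real CARD('n)) * (\<Sum>a\<in>UNIV. avg k (G a))" by (simp only: avg_cmult avg_sum)
    finally have "avg (Suc k) F / real CARD('n) ^ card J = (\<Sum>a\<in>UNIV. avg k (G a)) / real CARD('n) ^ Suc (card J)"
      by (simp del: avg.simps add: divide_inverse mult_ac)
    then show ?thesis by (simp only: sum_divide_distrib)
  qed
  show ?case
    unfolding ind eq Bochner_Integration.integral_sum[OF IH(1)] IH(2)
    by (intro conjI refl Bochner_Integration.integrable_sum IH(1))
qed

lemma expectation_eq_avg:
  fixes I :: "nat \<Rightarrow> 'w \<Rightarrow> 'n::finite"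
  assumes "prob_space P" "iid_uniform P I" "determined k F"
  shows "prob_space.expectation P (\<lambda>\<omega>. F (\<lambda>j. I j \<omega>)) = avg k F"
proof -
  have "(\<integral>\<omega>. F (\<lambda>j. I j \<omega>) \<partial>P) = (\<integral>\<omega>. F (\<lambda>j. I j \<omega>) * indicator {\<omega> \<in> space P. \<forall>j\<in>{}. I j \<omega> = undefined} \<omega> \<partial>P)"
    by (intro Bochner_Integration.integral_cong) (auto simp: indicator_def)
  then show ?thesis using expectation_eq_avg_event[OF assms, of "{}" "\<lambda>_. undefined"] by simp
qed

section \<open>The truncated singular value expansion\<close>

lemma norm_sum_orthonormal:
  assumes "finite S" "orthonormal_on S f"
  shows "(norm (\<Sum>j\<in>S. c j *\<^sub>R f j))\<^sup>2 = (\<Sum>j\<in>S. (c j)\<^sup>2)"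
proof -
  have "(norm (\<Sum>j\<in>S. c j *\<^sub>R f j))\<^sup>2 = (\<Sum>j\<in>S. \<Sum>k\<in>S. c j * (c k * (f k \<bullet> f j)))"
    by (simp add: power2_norm_eq_inner inner_sum_left inner_sum_right sum_distrib_left)
  also have "\<dots> = (\<Sum>j\<in>S. \<Sum>k\<in>S. if k = j then (c j)\<^sup>2 else 0)"
    using assms(2) by (intro sum.cong) (auto simp: orthonormal_on_def power2_eq_square)
  also have "\<dots> = (\<Sum>j\<in>S. (c j)\<^sup>2)" using assms(1) by simp
  finally show ?thesis .
qed

lemma bessel_inequality:
  assumes "finite S" "orthonormal_on S f"
  shows "(\<Sum>j\<in>S. (f j \<bullet> x)\<^sup>2) \<le> (norm x)\<^sup>2"
proof -
  define u where "u = (\<Sum>j\<in>S. (f j \<bullet> x) *\<^sub>R f j)"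
  have "0 \<le> (norm (x - u))\<^sup>2" by simp
  also have "\<dots> = (norm x)\<^sup>2 - 2 * (u \<bullet> x) + (norm u)\<^sup>2"
    by (simp add: power2_norm_eq_inner inner_diff_left inner_diff_right inner_commute)
  also have "u \<bullet> x = (\<Sum>j\<in>S. (f j \<bullet> x)\<^sup>2)" by (simp add: u_def inner_sum_left power2_eq_square)
  also have "(norm u)\<^sup>2 = (\<Sum>j\<in>S. (f j \<bullet> x)\<^sup>2)" unfolding u_def by (rule norm_sum_orthonormal[OF assms])
  finally show ?thesis by simp
qed

text \<open>\<open>T\<close> is the orthogonal projection onto the span of the retained right singular vectors, or the
  identity if nothing is truncated.\<close>

definition spectral_cut ::
  "('x::{real_inner,banach} \<Rightarrow>\<^sub>L (('y::{real_inner,banach})^('n::finite))) \<Rightarrow> ('x \<Rightarrow>\<^sub>L ('y^'n)) \<Rightarrow> ('x \<Rightarrow>\<^sub>L 'x) \<Rightarrow> bool" where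
  "spectral_cut Ad A T \<longleftrightarrow>
     (\<forall>x. blinfun_adj A (Ad x) = blinfun_adj A (A x)) \<and> (\<forall>x. normal_op A x = normal_op Ad (T x)) \<and>
     (\<forall>x. normal_op Ad (T x) = T (normal_op Ad x)) \<and> (\<forall>x. T (T x) = T x) \<and>
     (\<forall>x y. T x \<bullet> y = x \<bullet> T y) \<and> (\<forall>y. T (blinfun_adj A y) = blinfun_adj A y)"

lemma spectral_cut_id: "spectral_cut Ad Ad id_blinfun"
  by (simp add: spectral_cut_def)

lemma spectral_cut_norm:
  assumes "spectral_cut Ad A T"
  shows "norm (T x) \<le> norm x" "norm (x - T x) \<le> norm x"
proof -
  have "T x \<bullet> T x = T x \<bullet> x" using assms by (metis spectral_cut_def inner_commute)
  then have "(norm x)\<^sup>2 = (norm (T x))\<^sup>2 + (norm (x - T x))\<^sup>2"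
    by (simp add: power2_norm_eq_inner inner_diff_left inner_diff_right inner_commute)
  then have "(norm (T x))\<^sup>2 \<le> (norm x)\<^sup>2" "(norm (x - T x))\<^sup>2 \<le> (norm x)\<^sup>2" by simp_all
  then show "norm (T x) \<le> norm x" "norm (x - T x) \<le> norm x" by (auto intro: power2_le_imp_le)
qed

text \<open>In the coordinates of the retained singular vectors both normal operators multiply by
  \<open>(\<sigma> j)\<^sup>2 / n\<close>, which gives all commutation rules. The threshold then
  acts twice: \<open>Ad\<close> is small off the cut since the discarded singular values lie below
  it, and the normal operator is bounded below on the cut since the retained ones do not.\<close>

lemma truncation_spectral_cut:
  fixes Ad A :: "'x::{real_inner,banach} \<Rightarrow>\<^sub>L ('y::{real_inner,banach}^'n::finite)"
  assumes tr: "truncation_rule Ad a b \<delta> A" and a: "a \<noteq> 0"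
  defines "\<tau> \<equiv> a * \<delta> powr b"
  obtains T where "spectral_cut Ad A T" "\<And>x. norm (Ad (x - T x)) \<le> \<tau> * norm x"
    "\<And>x. \<tau>\<^sup>2 / real CARD('n) * norm (T x) \<le> norm (normal_op A (T x))"
proof -
  have "\<exists>\<sigma> \<phi> \<psi> J. is_svd Ad \<sigma> \<phi> \<psi> \<and> 0 < \<tau> \<and>
      (\<forall>j j'. j \<le> j' \<and> j' < J \<longrightarrow> \<sigma> j \<ge> \<sigma> j' \<and> \<sigma> j' \<ge> \<tau>) \<and> (\<forall>j\<ge>J. \<sigma> j < \<tau>) \<and>
      (\<forall>x. A x = (\<Sum>j<J. (\<sigma> j * (\<phi> j \<bullet> x)) *\<^sub>R \<psi> j))"
    using tr a unfolding truncation_rule_def \<tau>_def by simp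
  then obtain \<sigma> \<phi> \<psi> J where *: "is_svd Ad \<sigma> \<phi> \<psi> \<and> 0 < \<tau> \<and>
      (\<forall>j j'. j \<le> j' \<and> j' < J \<longrightarrow> \<sigma> j \<ge> \<sigma> j' \<and> \<sigma> j' \<ge> \<tau>) \<and> (\<forall>j\<ge>J. \<sigma> j < \<tau>) \<and>
      (\<forall>x. A x = (\<Sum>j<J. (\<sigma> j * (\<phi> j \<bullet> x)) *\<^sub>R \<psi> j))" by blast
  then have svd: "is_svd Ad \<sigma> \<phi> \<psi>" and \<tau>: "0 < \<tau>"
    and big: "\<And>j j'. j \<le> j' \<Longrightarrow> j' < J \<Longrightarrow> \<sigma> j' \<ge> \<tau>" and small: "\<And>j. j \<ge> J \<Longrightarrow> \<sigma> j < \<tau>"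
    and A: "\<And>x. A x = (\<Sum>j<J. (\<sigma> j * (\<phi> j \<bullet> x)) *\<^sub>R \<psi> j)" by blast+
  have \<sigma>: "\<And>j. 0 \<le> \<sigma> j" and on: "orthonormal_on {j. \<sigma> j \<noteq> 0} \<phi>" "orthonormal_on {j. \<sigma> j \<noteq> 0} \<psi>"
    and sums: "\<And>x. (\<lambda>j. (\<sigma> j * (\<phi> j \<bullet> x)) *\<^sub>R \<psi> j) sums Ad x"
    using svd by (auto simp: is_svd_def)
  have big': "\<sigma> j \<ge> \<tau>" "\<sigma> j \<noteq> 0" if "j < J" for j using big[of j j] that \<tau> by auto
  have onJ: "orthonormal_on {..<J} \<phi>" "orthonormal_on {..<J} \<psi>"
    using on big' by (auto simp: orthonormal_on_def)
  have \<phi>\<phi>: "\<phi> i \<bullet> \<phi> j = (if i = j then 1 else 0)" if "i < J" "j < J" for i j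
    using onJ(1) that by (auto simp: orthonormal_on_def)
  define T where "T = Blinfun (\<lambda>x. \<Sum>j<J. (\<phi> j \<bullet> x) *\<^sub>R \<phi> j)"
  have T: "T x = (\<Sum>j<J. (\<phi> j \<bullet> x) *\<^sub>R \<phi> j)" for x
  proof -
    have "bounded_linear (\<lambda>x. \<Sum>j<J. (\<phi> j \<bullet> x) *\<^sub>R \<phi> j)"
      by (intro bounded_linear_sum bounded_linear_scaleR_const bounded_linear_inner_right)
    then show ?thesis unfolding T_def by (simp add: bounded_linear_Blinfun_apply)
  qed
  have \<phi>sum: "\<phi> i \<bullet> (\<Sum>j<J. c j *\<^sub>R \<phi> j) = c i" if "i < J" for i c
  proof -
    have "\<phi> i \<bullet> (\<Sum>j<J. c j *\<^sub>R \<phi> j) = (\<Sum>j<J. if j = i then c i else 0)"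
      unfolding inner_sum_right by (intro sum.cong) (use \<phi>\<phi>[OF that] in auto)
    then show ?thesis using that by simp
  qed
  have \<psi>Ad: "\<psi> i \<bullet> Ad x = \<sigma> i * (\<phi> i \<bullet> x)" if i: "i < J" for i x
  proof -
    have "(\<lambda>j. \<psi> i \<bullet> ((\<sigma> j * (\<phi> j \<bullet> x)) *\<^sub>R \<psi> j)) sums (\<psi> i \<bullet> Ad x)"
      by (rule bounded_linear.sums[OF bounded_linear_inner_right sums])
    moreover have "(\<lambda>j. \<psi> i \<bullet> ((\<sigma> j * (\<phi> j \<bullet> x)) *\<^sub>R \<psi> j)) = (\<lambda>j. if j = i then \<sigma> i * (\<phi> i \<bullet> x) else 0)"
      using on(2) big'[OF i] by (auto simp: orthonormal_on_def fun_eq_iff)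
    ultimately show ?thesis using sums_single[of i "\<lambda>_. \<sigma> i * (\<phi> i \<bullet> x)"] sums_unique2 by metis
  qed
  have adjA: "blinfun_adj A y = (\<Sum>j<J. (\<sigma> j * (\<psi> j \<bullet> y)) *\<^sub>R \<phi> j)" for y
    by (rule inner_eqI) (simp add: blinfun_adj_inner A inner_sum_left inner_sum_right inner_commute mult_ac)
  have adjAd: "blinfun_adj Ad (\<psi> j) = \<sigma> j *\<^sub>R \<phi> j" if "j < J" for j
    by (rule inner_eqI) (simp add: blinfun_adj_inner inner_commute[of _ "\<psi> j"] \<psi>Ad that inner_commute)
  have Ad\<phi>: "Ad (\<phi> i) = \<sigma> i *\<^sub>R \<psi> i" if i: "i < J" for i
  proof -
    have "(\<lambda>j. (\<sigma> j * (\<phi> j \<bullet> \<phi> i)) *\<^sub>R \<psi> j) = (\<lambda>j. if j = i then \<sigma> i *\<^sub>R \<psi> i else 0)"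
      using on(1) big'[OF i] by (auto simp: orthonormal_on_def fun_eq_iff)
    then show ?thesis using sums[of "\<phi> i"] sums_single[of i "\<lambda>_. \<sigma> i *\<^sub>R \<psi> i"] sums_unique2 by metis
  qed
  let ?n = "real CARD('n)"
  have BA: "normal_op A x = (\<Sum>j<J. ((\<sigma> j)\<^sup>2 / ?n * (\<phi> j \<bullet> x)) *\<^sub>R \<phi> j)" for x
  proof -
    have "\<psi> j \<bullet> A x = \<sigma> j * (\<phi> j \<bullet> x)" if "j < J" for j
    proof -
      have "\<psi> j \<bullet> A x = (\<Sum>k<J. if k = j then \<sigma> j * (\<phi> j \<bullet> x) else 0)"
        unfolding A inner_sum_right using onJ(2) that by (intro sum.cong) (auto simp: orthonormal_on_def)
      then show ?thesis using that by simp
    qed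
    then show ?thesis
      by (auto simp: normal_op_apply adjA scaleR_sum_right power2_eq_square divide_inverse mult_ac intro!: sum.cong)
  qed
  have BdT: "normal_op Ad (T x) = (\<Sum>j<J. ((\<sigma> j)\<^sup>2 / ?n * (\<phi> j \<bullet> x)) *\<^sub>R \<phi> j)" for x
    by (simp add: normal_op_apply T blinfun.sum_right blinfun.scaleR_right Ad\<phi> adjAd scaleR_sum_right
        power2_eq_square divide_inverse mult_ac)
  have TBd: "T (normal_op Ad x) = (\<Sum>j<J. ((\<sigma> j)\<^sup>2 / ?n * (\<phi> j \<bullet> x)) *\<^sub>R \<phi> j)" for x
  proof -
    have "\<phi> j \<bullet> normal_op Ad x = (\<sigma> j)\<^sup>2 / ?n * (\<phi> j \<bullet> x)" if j: "j < J" for j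
      using \<psi>Ad[OF j, of x] by (simp add: normal_op_apply blinfun_adj_inner Ad\<phi> j power2_eq_square divide_inverse)
    then show ?thesis unfolding T by simp
  qed
  have TT: "T (T x) = T x" for x unfolding T[of "T x"] by (subst T) (simp add: \<phi>sum T)
  have cut: "spectral_cut Ad A T"
    unfolding spectral_cut_def
  proof (intro conjI allI)
    fix x y
    show "blinfun_adj A (Ad x) = blinfun_adj A (A x)"
    proof -
      have "normal_op A x = inverse ?n *\<^sub>R blinfun_adj A (Ad x)"
        unfolding BA adjA by (auto simp: \<psi>Ad scaleR_sum_right power2_eq_square divide_inverse mult_ac intro!: sum.cong)
      then show ?thesis by (simp add: normal_op_apply)
    qed
    show "normal_op A x = normal_op Ad (T x)" by (simp add: BA BdT)
    show "normal_op Ad (T x) = T (normal_op Ad x)" by (simp add: BdT TBd)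
    show "T (T x) = T x" by (rule TT)
    show "T x \<bullet> y = x \<bullet> T y" by (simp add: T inner_sum_left inner_sum_right inner_commute mult.commute)
    show "T (blinfun_adj A z) = blinfun_adj A z" for z unfolding T adjA by (simp add: \<phi>sum)
  qed
  have Adsmall: "norm (Ad (x - T x)) \<le> \<tau> * norm x" for x
  proof -
    define u where "u = x - T x"
    have u0: "\<phi> j \<bullet> u = 0" if "j < J" for j using \<phi>sum[OF that] by (simp add: u_def inner_diff_right T)
    have part: "norm (\<Sum>j<m. (\<sigma> j * (\<phi> j \<bullet> u)) *\<^sub>R \<psi> j) \<le> \<tau> * norm u" for m
    proof (rule power2_le_imp_le)
      \<comment> \<open>\<open>is_svd\<close> asserts orthonormality only where the singular value
        is nonzero; the other terms vanish anyway.\<close>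
      define S where "S = {j\<in>{..<m}. \<sigma> j \<noteq> 0}"
      have S: "finite S" "orthonormal_on S \<phi>" "orthonormal_on S \<psi>"
        using on by (auto simp: S_def orthonormal_on_def)
      have "(\<Sum>j<m. (\<sigma> j * (\<phi> j \<bullet> u)) *\<^sub>R \<psi> j) = (\<Sum>j\<in>S. (\<sigma> j * (\<phi> j \<bullet> u)) *\<^sub>R \<psi> j)"
        unfolding S_def by (rule sum.mono_neutral_right) auto
      then have "(norm (\<Sum>j<m. (\<sigma> j * (\<phi> j \<bullet> u)) *\<^sub>R \<psi> j))\<^sup>2 = (\<Sum>j\<in>S. (\<sigma> j * (\<phi> j \<bullet> u))\<^sup>2)"
        using norm_sum_orthonormal[OF S(1,3)] by simp
      also have "\<dots> \<le> (\<Sum>j\<in>S. \<tau>\<^sup>2 * (\<phi> j \<bullet> u)\<^sup>2)"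
      proof (rule sum_mono)
        fix j
        show "(\<sigma> j * (\<phi> j \<bullet> u))\<^sup>2 \<le> \<tau>\<^sup>2 * (\<phi> j \<bullet> u)\<^sup>2"
        proof (cases "j < J")
          case False
          then have "(\<sigma> j)\<^sup>2 \<le> \<tau>\<^sup>2" using small[of j] \<sigma>[of j] by (intro power_mono) auto
          then show ?thesis unfolding power_mult_distrib by (intro mult_right_mono) auto
        qed (simp add: u0)
      qed
      also have "\<dots> \<le> \<tau>\<^sup>2 * (norm u)\<^sup>2"
        unfolding sum_distrib_left[symmetric] by (intro mult_left_mono bessel_inequality S) auto
      finally show "(norm (\<Sum>j<m. (\<sigma> j * (\<phi> j \<bullet> u)) *\<^sub>R \<psi> j))\<^sup>2 \<le> (\<tau> * norm u)\<^sup>2"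
        by (simp add: power_mult_distrib)
    qed (use \<tau> in auto)
    have "(\<lambda>m. norm (\<Sum>j<m. (\<sigma> j * (\<phi> j \<bullet> u)) *\<^sub>R \<psi> j)) \<longlonglongrightarrow> norm (Ad u)"
      using sums[of u] unfolding sums_def by (rule tendsto_norm)
    then have "norm (Ad u) \<le> \<tau> * norm u" by (rule LIMSEQ_le_const2) (use part in auto)
    also have "\<dots> \<le> \<tau> * norm x" using \<tau> spectral_cut_norm(2)[OF cut, of x] by (simp add: u_def)
    finally show ?thesis unfolding u_def .
  qed
  have low: "\<tau>\<^sup>2 / ?n * norm (T x) \<le> norm (normal_op A (T x))" for x
  proof (rule power2_le_imp_le)
    have "(\<tau>\<^sup>2 / ?n * norm (T x))\<^sup>2 = (\<Sum>j<J. (\<tau>\<^sup>2 / ?n * (\<phi> j \<bullet> x))\<^sup>2)"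
      unfolding T power_mult_distrib norm_sum_orthonormal[OF finite_lessThan onJ(1)] by (simp add: sum_distrib_left)
    also have "\<dots> \<le> (\<Sum>j<J. ((\<sigma> j)\<^sup>2 / ?n * (\<phi> j \<bullet> x))\<^sup>2)"
      unfolding power_mult_distrib
      using big' \<tau> by (intro sum_mono mult_right_mono power_mono divide_right_mono) (auto intro: less_imp_le)
    also have "\<dots> = (norm (normal_op A (T x)))\<^sup>2"
    proof -
      have "normal_op A (T x) = (\<Sum>j<J. ((\<sigma> j)\<^sup>2 / ?n * (\<phi> j \<bullet> x)) *\<^sub>R \<phi> j)"
        unfolding BA by (intro sum.cong) (auto simp: T \<phi>sum)
      then show ?thesis using norm_sum_orthonormal[OF finite_lessThan onJ(1)] by simp
    qed
    finally show "(\<tau>\<^sup>2 / ?n * norm (T x))\<^sup>2 \<le> (norm (normal_op A (T x)))\<^sup>2" .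
  qed simp
  show thesis by (rule that[OF cut Adsmall low])
qed

section \<open>Landweber polynomials against fractional powers\<close>

lemma powr_mult_exp_le:
  fixes y :: real
  assumes "0 \<le> y" "0 < \<nu>"
  shows "y powr \<nu> * exp (- y) \<le> (2 * \<nu> / 5) powr \<nu>"
proof -
  have "y powr \<nu> * exp (- y) = (y * exp (- (y / \<nu>))) powr \<nu>"
    using assms by (simp add: powr_mult exp_powr_real)
  also have "\<dots> \<le> (2 * \<nu> / 5) powr \<nu>"
  proof (rule powr_mono2)
    have "y * exp (- (y / \<nu>)) = \<nu> * ((y / \<nu>) * exp (- (y / \<nu>)))" using assms by simp
    also have "\<dots> \<le> \<nu> * (2 / 5)" using assms by (intro mult_left_mono mult_exp_minus_le) auto
    finally show "y * exp (- (y / \<nu>)) \<le> 2 * \<nu> / 5" by simp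
  qed (use assms in auto)
  finally show ?thesis .
qed

text \<open>The scalar form of the Landweber rate. It holds for every positive exponent, that is,
  Landweber iteration does not saturate.\<close>

lemma power_mult_powr_le:
  fixes t :: real
  assumes "0 \<le> t" "0 < c" "c * t \<le> 1" "0 < \<nu>" "k \<ge> 1"
  shows "(1 - c * t) ^ k * t powr \<nu> \<le> (2 * \<nu> / (5 * c)) powr \<nu> * real k powr (- \<nu>)"
proof -
  have k: "0 < real k" using assms by simp
  define y where "y = real k * (c * t)"
  have y: "0 \<le> y" using assms by (simp add: y_def)
  have "(1 - c * t) ^ k \<le> exp (- (c * t)) ^ k"
    using assms exp_ge_add_one_self[of "- (c * t)"] by (intro power_mono) auto
  also have "\<dots> = exp (- y)" by (simp add: y_def flip: exp_of_nat_mult)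
  finally have "(1 - c * t) ^ k * t powr \<nu> \<le> exp (- y) * t powr \<nu>" by (intro mult_right_mono) auto
  also have "\<dots> = (y powr \<nu> * exp (- y)) * (1 / (real k * c)) powr \<nu>"
  proof -
    have "t = y * (1 / (real k * c))" using assms k by (simp add: y_def)
    then have "t powr \<nu> = y powr \<nu> * (1 / (real k * c)) powr \<nu>"
      using y k assms by (simp add: powr_mult del: times_divide_eq_right)
    then show ?thesis by simp
  qed
  also have "\<dots> \<le> (2 * \<nu> / 5) powr \<nu> * (1 / (real k * c)) powr \<nu>"
    using y assms by (intro mult_right_mono powr_mult_exp_le) auto
  also have "\<dots> = (2 * \<nu> / (5 * c)) powr \<nu> * real k powr (- \<nu>)"
    using k assms by (simp add: powr_divide powr_mult powr_minus_divide)
  finally show ?thesis .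
qed

text \<open>Here \<open>z\<close> plays the role of the fractional power of \<open>S\<close> at
  \<open>u\<close>, available only as a limit of polynomials. The interval \<open>{0..r}\<close> may
  be larger than the spectrum of \<open>S\<close>, because the approximants are chosen for
  \<open>normal_op Ad\<close> while \<open>S\<close> is one of its parts.\<close>

lemma blinfun_poly_source_le:
  fixes S :: "'x::{real_inner,banach} \<Rightarrow>\<^sub>L 'x"
  assumes S: "pos_op S" "norm S \<le> \<rho>" "\<rho> \<le> r"
    and p: "uniform_limit {0..r} (\<lambda>m. poly (p m)) (\<lambda>t. t powr \<nu>) sequentially"
    and q: "\<And>t. 0 \<le> t \<Longrightarrow> t \<le> \<rho> \<Longrightarrow> \<bar>poly q t\<bar> \<le> 1" "\<And>t. 0 \<le> t \<Longrightarrow> t \<le> \<rho> \<Longrightarrow> \<bar>poly q t\<bar> * t powr \<nu> \<le> C"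
    and z: "(\<lambda>m. blinfun_poly (p m) S u) \<longlonglongrightarrow> z"
  shows "norm (blinfun_poly q S z) \<le> C * norm u"
proof (rule field_le_epsilon)
  fix e :: real assume e: "0 < e"
  define d where "d = e / (1 + norm u)"
  have nu: "0 < 1 + norm u" by (simp add: add_pos_nonneg)
  have d: "0 < d" using e nu by (simp add: d_def)
  have ev: "\<forall>\<^sub>F m in sequentially. norm (blinfun_poly q S (blinfun_poly (p m) S u)) \<le> (C + d) * norm u"
    using uniform_limitD[OF p d]
  proof eventually_elim
    case (elim m)
    have "norm (blinfun_poly (q * p m) S u) \<le> (C + d) * norm u"
    proof (rule norm_blinfun_poly_le[OF S(1,2)])
      fix t assume t: "0 \<le> t" "t \<le> \<rho>"
      then have "\<bar>poly (p m) t - t powr \<nu>\<bar> \<le> d" using elim S by (auto simp: dist_real_def intro: less_imp_le)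
      then have "\<bar>poly q t\<bar> * \<bar>poly (p m) t - t powr \<nu>\<bar> \<le> 1 * d" using q(1)[OF t] by (intro mult_mono) auto
      moreover have "\<bar>poly (q * p m) t\<bar> \<le> \<bar>poly q t\<bar> * t powr \<nu> + \<bar>poly q t\<bar> * \<bar>poly (p m) t - t powr \<nu>\<bar>"
      proof -
        have "\<bar>poly (p m) t\<bar> \<le> t powr \<nu> + \<bar>poly (p m) t - t powr \<nu>\<bar>" by (smt (verit) powr_ge_zero)
        then have "\<bar>poly q t\<bar> * \<bar>poly (p m) t\<bar> \<le> \<bar>poly q t\<bar> * (t powr \<nu> + \<bar>poly (p m) t - t powr \<nu>\<bar>)"
          by (intro mult_left_mono) auto
        then show ?thesis by (simp add: abs_mult distrib_left)
      qed
      ultimately show "\<bar>poly (q * p m) t\<bar> \<le> C + d" using q(2)[OF t] by linarith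
    qed
    then show ?case by (simp add: blinfun_poly_mult_apply)
  qed
  have "(\<lambda>m. norm (blinfun_poly q S (blinfun_poly (p m) S u))) \<longlonglongrightarrow> norm (blinfun_poly q S z)"
    by (intro tendsto_norm bounded_linear.tendsto[OF blinfun.bounded_linear_right] z)
  then have "norm (blinfun_poly q S z) \<le> (C + d) * norm u"
    by (rule tendsto_upperbound[OF _ ev]) simp
  also have "d * norm u \<le> e" using e nu by (simp add: d_def divide_simps)
  then have "(C + d) * norm u \<le> C * norm u + e" by (simp add: distrib_right)
  finally show "norm (blinfun_poly q S z) \<le> C * norm u + e" .
qed


section \<open>Reading the step size conditions\<close>

lemma step_size_L:
  fixes A :: "'x::{real_inner,banach} \<Rightarrow>\<^sub>L ('y::{real_inner,banach}^'n::finite)"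
  assumes "step_size_ok A c c0" "0 < c0"
  shows "c0 * max_row_sq A \<le> 1"
proof (cases "A = 0")
  case True
  have "blinfun_row A i = 0" for i by (rule blinfun_eqI) (simp add: True)
  then have "max_row_sq A = 0" by (simp add: max_row_sq_def)
  then show ?thesis by simp
next
  case False
  have "0 < max_row_sq A"
  proof (rule ccontr)
    assume "\<not> 0 < max_row_sq A"
    then have "max_row_sq A = 0" using max_row_sq_nonneg[of A] by linarith
    then show False using norm_sq_le_max_row[of A] False by simp
  qed
  then show ?thesis using assms False by (simp add: step_size_ok_def field_simps)
qed

lemma step_bound_expectation_cases:
  fixes A :: "'x::{real_inner,banach} \<Rightarrow>\<^sub>L ('y::{real_inner,banach}^'n::finite)"
  assumes c: "step_size_ok A (step_bound_expectation A M) c0" "0 < c0" and M: "M \<ge> 1"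
  shows "45 * (c0\<^sup>2 * max_row_sq A * ((norm A)\<^sup>2 / real CARD('n)) * real M) \<le> 1 \<or>
    9 * (c0 * max_row_sq A) * (15 + 7 * ln (real M)) \<le> 1"
proof (cases "A = 0")
  case False
  let ?L = "max_row_sq A"
  have L: "0 < ?L"
    using norm_sq_le_max_row[of A] False max_row_sq_nonneg[of A] by (cases "?L = 0") auto
  have n: "0 < real CARD('n)" by simp
  define q where "q = 5 * ?L * inverse (real CARD('n)) * real M"
  have q: "0 < q" using L M n by (simp add: q_def)
  have lnM: "0 \<le> ln (real M)" using M by simp
  consider "c0 < inverse 3 * inverse (norm A) * q powr (- 1 / 2)"
    | "c0 < inverse 9 * inverse ?L * inverse (15 + 7 * ln (real M))"
    using c(1) False unfolding step_size_ok_def step_bound_expectation_def q_def by (auto simp: less_max_iff_disj)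
  then show ?thesis
  proof cases
    case 1
    have "q powr (- 1 / 2) = inverse (sqrt q)"
      using q powr_half_sqrt[of q] powr_minus[of q "1/2"] by simp
    then have "c0 < inverse 3 * inverse (norm A) * inverse (sqrt q)" using 1 by (simp only:)
    then have "3 * c0 * norm A * sqrt q \<le> 1" using False q by (simp add: field_simps)
    then have "(3 * c0 * norm A * sqrt q)\<^sup>2 \<le> 1" using c(2) q by (intro power_le_one) auto
    also have "(3 * c0 * norm A * sqrt q)\<^sup>2 = 45 * (c0\<^sup>2 * ?L * ((norm A)\<^sup>2 / real CARD('n)) * real M)"
      using q by (simp add: power_mult_distrib q_def field_simps)
    finally show ?thesis by blast
  next
    case 2
    then have "c0 < inverse (9 * ?L * (15 + 7 * ln (real M)))" by (simp only: inverse_mult_distrib)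
    moreover have "0 < 9 * ?L * (15 + 7 * ln (real M))" using L lnM by (intro mult_pos_pos) auto
    ultimately have "c0 * (9 * ?L * (15 + 7 * ln (real M))) \<le> 1"
      by (simp add: inverse_eq_divide pos_less_divide_eq less_imp_le del: inverse_mult_distrib)
    then have "9 * (c0 * ?L) * (15 + 7 * ln (real M)) \<le> 1" by (simp only: mult_ac)
    then show ?thesis by blast
  qed
qed simp

text \<open>The witness is the logarithm in \<open>step_bound_pathwise\<close>. From
  \<open>(norm A)\<^sup>2 \<le> n * L\<close> its argument \<open>z\<close> satisfies
  \<open>z\<^sup>2 \<ge> 4 * exp 4 * n\<close>, whence
  \<open>2 * ln z \<ge> 4 + ln (4 * n)\<close>.\<close>

lemma step_bound_pathwise_small:
  fixes A :: "'x::{real_inner,banach} \<Rightarrow>\<^sub>L ('y::{real_inner,banach}^'n::finite)"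
  assumes c: "step_size_ok A (step_bound_pathwise A M) c0" "0 < c0" and M: "M \<ge> 1"
  shows "\<exists>l. 196 * (c0 * real M * (sqrt (max_row_sq A) * norm A)) * l \<le> 1 \<and> 4 + ln (4 * real CARD('n)) \<le> 2 * l"
proof (cases "A = 0")
  case True
  then show ?thesis by (intro exI[of _ "(4 + ln (4 * real CARD('n))) / 2"]) simp
next
  case False
  let ?L = "max_row_sq A"
  have L: "0 < ?L"
    using norm_sq_le_max_row[of A] False max_row_sq_nonneg[of A] by (cases "?L = 0") auto
  have n: "1 \<le> real CARD('n)" using zero_less_card_finite[where 'a='n] by linarith
  define z where "z = 2 * (exp 1)\<^sup>2 * real CARD('n) * sqrt ?L * inverse (norm A)"
  have z: "0 < z" using L False by (simp add: z_def)
  have ln0: "0 \<le> ln (4 * real CARD('n))" by (rule ln_ge_zero) (use n in linarith)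
  have "4 + ln (4 * real CARD('n)) = ln (exp 4 * (4 * real CARD('n)))" using n by (simp add: ln_mult)
  also have "\<dots> \<le> ln (z\<^sup>2)"
  proof (rule ln_mono)
    have "z\<^sup>2 = exp 4 * (4 * real CARD('n)) * (real CARD('n) * ?L / (norm A)\<^sup>2)"
    proof -
      have "((exp (1::real))\<^sup>2)\<^sup>2 = exp 4" by (simp flip: exp_of_nat_mult power_mult)
      then show ?thesis using L by (simp add: z_def power_mult_distrib power2_eq_square[of "real CARD('n)"] divide_inverse power_inverse)
    qed
    moreover have "1 \<le> real CARD('n) * ?L / (norm A)\<^sup>2"
      using norm_sq_le_max_row[of A] False by (simp add: le_divide_eq)
    ultimately show "exp 4 * (4 * real CARD('n)) \<le> z\<^sup>2"
      using mult_left_mono[of 1 "real CARD('n) * ?L / (norm A)\<^sup>2" "exp 4 * (4 * real CARD('n))"] by simp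
  qed (use z n in auto)
  also have "\<dots> = 2 * ln z" using z by (simp add: ln_realpow)
  finally have l: "4 + ln (4 * real CARD('n)) \<le> 2 * ln z" .
  then have lz: "0 < ln z" using ln0 by linarith
  have "c0 < inverse (14\<^sup>2 * sqrt ?L * real M * norm A * ln z)"
    using c(1) False unfolding step_size_ok_def step_bound_pathwise_def z_def by simp
  moreover have "0 < 14\<^sup>2 * sqrt ?L * real M * norm A * ln z" using L M False lz by simp
  ultimately have "c0 * (14\<^sup>2 * sqrt ?L * real M * norm A * ln z) \<le> 1"
    by (simp add: inverse_eq_divide pos_less_divide_eq less_imp_le)
  then have "196 * (c0 * real M * (sqrt ?L * norm A)) * ln z \<le> 1" by (simp add: mult_ac)
  then show ?thesis using l by blast
qed

text \<open>Packs what \<open>path_error_le\<close> and \<open>mean_error_le\<close> require of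
  \<open>\<kappa>\<close>. Up to constants \<open>\<Lambda>\<close> is the amplification of the data
  noise after \<open>k\<close> steps.\<close>

definition noise_gain ::
  "('x::{real_inner,banach} \<Rightarrow>\<^sub>L (('y::{real_inner,banach})^('n::finite))) \<Rightarrow> real \<Rightarrow> nat \<Rightarrow> real \<Rightarrow> bool" where
  "noise_gain A c k \<Lambda> \<longleftrightarrow> (\<exists>\<kappa>.
     (\<forall>r y. norm (blinfun_poly ([:1, - c:] ^ r) (normal_op A) (blinfun_adj A y)) \<le> \<kappa> r * norm y) \<and>
     (\<Sum>r<k. \<kappa> r) \<le> \<Lambda> \<and> (\<forall>r. 0 \<le> \<kappa> r \<and> \<kappa> r \<le> sqrt (real CARD('n) / c) / sqrt (real (Suc r))))"

lemma resolvent_adj_le: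
  fixes A :: "'x::{real_inner,banach} \<Rightarrow>\<^sub>L ('y::{real_inner,banach}^'n::finite)"
  assumes c: "0 < c" "c * max_row_sq A \<le> 1"
  shows "norm (blinfun_poly ([:1, - c:] ^ r) (normal_op A) (blinfun_adj A y))
    \<le> sqrt (real CARD('n) / c) / sqrt (real (Suc r)) * norm y"
proof -
  have "norm (blinfun_poly ([:1, - c:] ^ r) (normal_op A) (blinfun_adj A y))
    \<le> sqrt (real CARD('n)) * sqrt (1 / (c * real (Suc r))) * norm y"
  proof (rule norm_poly_adj_le)
    fix x assume x: "0 \<le> x" "x \<le> (norm A)\<^sup>2 / real CARD('n)"
    note s = step_arg_bounds[OF c x]
    have "c * (x * (poly ([:1, - c:] ^ r) x)\<^sup>2) = (c * x) * (1 - c * x) ^ (2 * r)"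
      by (simp add: poly_power mult.commute[of x] power_mult power2_eq_square flip: power_mult_distrib)
    also have "\<dots> \<le> 1 / real (Suc (2 * r))" by (rule mult_power_le_inverse[OF s])
    also have "\<dots> \<le> 1 / real (Suc r)" by (intro divide_left_mono) auto
    finally have "x * (poly ([:1, - c:] ^ r) x)\<^sup>2 \<le> 1 / (c * real (Suc r))"
      using c by (simp add: field_simps del: of_nat_Suc poly_power)
    then show "x * (poly ([:1, - c:] ^ r) x)\<^sup>2 \<le> (sqrt (1 / (c * real (Suc r))))\<^sup>2" using c by simp
  qed (use c in simp)
  then show ?thesis by (simp add: real_sqrt_divide real_sqrt_mult)
qed

lemma noise_gain_sqrt:
  fixes A :: "'x::{real_inner,banach} \<Rightarrow>\<^sub>L ('y::{real_inner,banach}^'n::finite)"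
  assumes c: "0 < c" "c * max_row_sq A \<le> 1"
  shows "noise_gain A c k (sqrt (real CARD('n) / c) * (2 * sqrt (real k)))"
  unfolding noise_gain_def
proof (intro exI conjI allI)
  show "norm (blinfun_poly ([:1, - c:] ^ r) (normal_op A) (blinfun_adj A y))
    \<le> sqrt (real CARD('n) / c) / sqrt (real (Suc r)) * norm y" for r y
    by (rule resolvent_adj_le[OF c])
  have "(\<Sum>r<k. sqrt (real CARD('n) / c) / sqrt (real (Suc r))) = sqrt (real CARD('n) / c) * (\<Sum>r<k. 1 / sqrt (real (Suc r)))"
    by (simp add: sum_distrib_left)
  also have "\<dots> \<le> sqrt (real CARD('n) / c) * (2 * sqrt (real k))"
    using c by (intro mult_left_mono sum_inverse_sqrt_le) auto
  finally show "(\<Sum>r<k. sqrt (real CARD('n) / c) / sqrt (real (Suc r))) \<le> sqrt (real CARD('n) / c) * (2 * sqrt (real k))" .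
qed (use c in auto)

text \<open>On the range of the cut the normal operator is bounded below by \<open>l\<close>, so one more power of it
  can be traded for the factor \<open>1 / l\<close>.\<close>

lemma noise_gain_cut:
  fixes A :: "'x::{real_inner,banach} \<Rightarrow>\<^sub>L ('y::{real_inner,banach}^'n::finite)"
  assumes c: "0 < c" "c * max_row_sq A \<le> 1" and cut: "spectral_cut Ad A T" and l: "0 < l"
    and low: "\<And>x. l * norm (T x) \<le> norm (normal_op A (T x))"
  shows "noise_gain A c k (sqrt (real CARD('n) / c) * (5 * sqrt (sqrt 27 / (c * l))))"
proof -
  let ?n = "real CARD('n)" and ?B = "normal_op A"
  \<comment> \<open>\<open>sqrt 27\<close> comes from \<open>cube_mult_power_le\<close>, and
    \<open>\<mu>\<close> is where the untruncated bound and the one using \<open>l\<close> cross, as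
    \<open>sum_min_decay_le\<close> expects.\<close>
  define \<mu> where "\<mu> = sqrt 27 / (c * l)"
  have \<mu>: "0 < \<mu>" using c l by (simp add: \<mu>_def)
  define \<kappa> where "\<kappa> r = sqrt (?n / c) * min (1 / sqrt (real (Suc r))) (\<mu> / wt r)" for r
  have TB: "T (?B x) = ?B (T x)" for x using cut by (simp add: spectral_cut_def)
  have second: "norm (blinfun_poly ([:1, - c:] ^ r) ?B (blinfun_adj A y)) \<le> sqrt (?n / c) * (\<mu> / wt r) * norm y" for r y
  proof -
    let ?p = "[:1, - c:] ^ r"
    have Ty: "T (blinfun_adj A y) = blinfun_adj A y" using cut by (simp add: spectral_cut_def)
    have "T (blinfun_poly ?p ?B (blinfun_adj A y)) = blinfun_poly ?p ?B (T (blinfun_adj A y))"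
      by (rule blinfun_poly_intertwine[OF bounded_linear.linear[OF blinfun.bounded_linear_right] TB])
    then have Tfix: "T (blinfun_poly ?p ?B (blinfun_adj A y)) = blinfun_poly ?p ?B (blinfun_adj A y)"
      unfolding Ty .
    have 1: "l * norm (blinfun_poly ?p ?B (blinfun_adj A y)) \<le> norm (?B (blinfun_poly ?p ?B (blinfun_adj A y)))"
      using low[of "blinfun_poly ?p ?B (blinfun_adj A y)"] unfolding Tfix .
    have 2: "?B (blinfun_poly ?p ?B (blinfun_adj A y)) = blinfun_poly ([:0,1:] * ?p) ?B (blinfun_adj A y)"
      by (simp only: blinfun_poly_mult_apply) (simp add: blinfun_poly_pCons_apply)
    have 3: "norm (blinfun_poly ([:0,1:] * ?p) ?B (blinfun_adj A y)) \<le> sqrt ?n * (sqrt (27 / c ^ 3) / wt r) * norm y"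
    proof (rule norm_poly_adj_le)
      fix x assume x: "0 \<le> x" "x \<le> (norm A)\<^sup>2 / ?n"
      note s = step_arg_bounds[OF c x]
      have px: "poly ([:0,1:] * ?p) x = x * (1 - c * x) ^ r" by (simp add: poly_power mult.commute)
      have "c ^ 3 * (x * (poly ([:0,1:] * ?p) x)\<^sup>2) = (c * x) ^ 3 * (1 - c * x) ^ (2 * r)"
        unfolding px power_even_eq power_mult_distrib by (simp add: power2_eq_square power3_eq_cube)
      also have "\<dots> \<le> 27 / (wt r)\<^sup>2" by (rule cube_mult_power_le[OF s])
      finally have "x * (poly ([:0,1:] * ?p) x)\<^sup>2 \<le> 27 / (wt r)\<^sup>2 / c ^ 3"
        using c by (subst pos_le_divide_eq) (auto simp: mult.commute)
      then show "x * (poly ([:0,1:] * ?p) x)\<^sup>2 \<le> (sqrt (27 / c ^ 3) / wt r)\<^sup>2"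
        using c by (simp add: power_divide mult.commute del: poly_power)
    qed (use c wt_pos[of r] in auto)
    have 4: "sqrt ?n * (sqrt (27 / c ^ 3) / wt r) = l * (sqrt (?n / c) * (\<mu> / wt r))"
    proof -
      have "c ^ 3 = c\<^sup>2 * c" by (simp add: power3_eq_cube power2_eq_square)
      then have "sqrt (c ^ 3) = c * sqrt c" using c(1) by (simp add: real_sqrt_mult)
      then show ?thesis using c(1) l wt_pos[of r] by (simp add: \<mu>_def real_sqrt_divide)
    qed
    have "l * norm (blinfun_poly ?p ?B (blinfun_adj A y)) \<le> l * (sqrt (?n / c) * (\<mu> / wt r) * norm y)"
      using 1 3 unfolding 2 4 mult.assoc[of l] by (rule order_trans)
    then show ?thesis using l by (rule mult_left_le_imp_le)
  qed
  show ?thesis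
    unfolding noise_gain_def \<mu>_def[symmetric]
  proof (intro exI[of _ \<kappa>] conjI allI)
    show "norm (blinfun_poly ([:1, - c:] ^ r) ?B (blinfun_adj A y)) \<le> \<kappa> r * norm y" for r y
      using second[of r y] resolvent_adj_le[OF c, of r y] by (auto simp: \<kappa>_def min_def)
    have "(\<Sum>r<k. \<kappa> r) = sqrt (?n / c) * (\<Sum>r<k. min (1 / sqrt (real (Suc r))) (\<mu> / wt r))"
      by (simp add: \<kappa>_def sum_distrib_left)
    also have "\<dots> \<le> sqrt (?n / c) * (5 * sqrt \<mu>)"
      using c by (intro mult_left_mono sum_min_decay_le \<mu>) auto
    finally show "(\<Sum>r<k. \<kappa> r) \<le> sqrt (?n / c) * (5 * sqrt \<mu>)" .
    show "0 \<le> \<kappa> r" for r using c \<mu> wt_pos[of r] by (simp add: \<kappa>_def)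
    have "sqrt (?n / c) * min (1 / sqrt (real (Suc r))) (\<mu> / wt r) \<le> sqrt (?n / c) * (1 / sqrt (real (Suc r)))" for r
      using c by (intro mult_left_mono min.cobounded1) auto
    then show "\<kappa> r \<le> sqrt (?n / c) / sqrt (real (Suc r))" for r by (simp add: \<kappa>_def)
  qed
qed

lemma blinfun_poly_kernel:
  fixes S :: "'x::{real_inner,banach} \<Rightarrow>\<^sub>L 'x"
  assumes "S u = 0"
  shows "blinfun_poly p S u = poly p 0 *\<^sub>R u"
proof (induction p)
  case (pCons c p)
  then show ?case using assms by (simp add: blinfun_poly_pCons_apply blinfun.scaleR_right)
qed simp

lemma combine_error_terms:
  fixes c D F x g l :: real
  assumes "0 \<le> c" "0 \<le> D" "0 \<le> F" "0 \<le> x" "0 \<le> g" "0 \<le> l" "k \<ge> 1"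
  shows "c * x + g + D / sqrt (real (Suc k)) + F * l \<le> (1 + c + D + F) * (x + 1 / sqrt (real k) + g + l)"
proof -
  have "D / sqrt (real (Suc k)) \<le> D / sqrt (real k)" using assms by (intro divide_left_mono) auto
  also have "\<dots> = D * (1 / sqrt (real k))" by simp
  also have "\<dots> \<le> (1 + c + D + F) * (1 / sqrt (real k))" using assms by (intro mult_right_mono) auto
  finally have "D / sqrt (real (Suc k)) \<le> (1 + c + D + F) * (1 / sqrt (real k))" .
  moreover have "c * x \<le> (1 + c + D + F) * x" "F * l \<le> (1 + c + D + F) * l"
    using assms by (auto intro!: mult_right_mono)
  moreover have "1 * g \<le> (1 + c + D + F) * g" by (rule mult_right_mono) (use assms in auto)
  ultimately show ?thesis unfolding distrib_left by linarith
qed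

section \<open>The initial error under the source condition\<close>

locale source_data =
  fixes Ad :: "'x::{real_inner,banach} \<Rightarrow>\<^sub>L ('y::{real_inner,banach}^'n::finite)"
    and x0 xd w :: 'x and yd :: "'y^'n" and M :: nat and c0 \<nu> :: real
  assumes Ad_xd: "Ad xd = yd" and M: "M \<ge> 1" and c0: "0 < c0" and \<nu>: "0 < \<nu>"
    and source: "xd - x0 = blinfun_powr (normal_op Ad) \<nu> w"
begin

lemma source_sequence:
  obtains p where "uniform_limit {0..norm (normal_op Ad)} (\<lambda>m. poly (p m)) (\<lambda>t. t powr \<nu>) sequentially"
    "(\<lambda>m. blinfun_poly (p m) (normal_op Ad) w) \<longlonglongrightarrow> xd - x0"
proof -
  obtain p where p: "uniform_limit {0..norm (normal_op Ad)} (\<lambda>m. poly (p m)) (\<lambda>t. t powr \<nu>) sequentially"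
    "(\<lambda>m. blinfun_poly (p m) (normal_op Ad)) \<longlonglongrightarrow> blinfun_powr (normal_op Ad) \<nu>"
    using blinfun_powr_limit[OF pos_op_normal_op \<nu>] by blast
  have "(\<lambda>m. blinfun_poly (p m) (normal_op Ad) w) \<longlonglongrightarrow> blinfun_powr (normal_op Ad) \<nu> w"
    by (intro bounded_linear.tendsto[OF blinfun.bounded_linear_left] p)
  then show thesis using that p(1) source by simp
qed

definition "rate_const = (2 * \<nu> / (5 * c0)) powr \<nu> * norm w"

text \<open>Split by \<open>T\<close>. On its range the two normal operators agree, so the source
  condition persists with \<open>T w\<close> and the Landweber rate applies. The rest lies in the
  kernel of \<open>normal_op A\<close>, where the iteration stands still, and is bounded by
  \<open>\<gamma>\<close>.\<close>

lemma initial_error_le: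
  assumes cut: "spectral_cut Ad A T" and L: "c0 * max_row_sq A \<le> 1" and k: "k \<ge> 1"
    and g: "norm ((xd - x0) - T (xd - x0)) \<le> \<gamma>"
  shows "norm (blinfun_poly ([:1, - c0:] ^ k) (normal_op A) (x0 - xd)) \<le> rate_const * real k powr (- \<nu>) + \<gamma>"
proof -
  let ?p = "[:1, - c0:] ^ k" and ?B = "normal_op A" and ?Bd = "normal_op Ad"
  define z where "z = xd - x0"
  obtain p where p: "uniform_limit {0..norm ?Bd} (\<lambda>m. poly (p m)) (\<lambda>t. t powr \<nu>) sequentially"
    "(\<lambda>m. blinfun_poly (p m) ?Bd w) \<longlonglongrightarrow> z" using source_sequence z_def by metis
  have cutB: "?B x = ?Bd (T x)" "T (?Bd x) = ?B (T x)" "T (T x) = T x" for x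
    using cut by (metis spectral_cut_def)+
  have Ble: "norm ?B \<le> norm ?Bd"
  proof (rule norm_blinfun_bound)
    show "norm (?B x) \<le> norm ?Bd * norm x" for x
      unfolding cutB(1)
      by (rule order_trans[OF norm_blinfun mult_left_mono[OF spectral_cut_norm(1)[OF cut]]]) simp
  qed simp
  have "T (blinfun_poly (p m) ?Bd w) = blinfun_poly (p m) ?B (T w)" for m
    by (rule blinfun_poly_intertwine[OF bounded_linear.linear[OF blinfun.bounded_linear_right] cutB(2)])
  moreover have "(\<lambda>m. T (blinfun_poly (p m) ?Bd w)) \<longlonglongrightarrow> T z"
    by (intro bounded_linear.tendsto[OF blinfun.bounded_linear_right] p)
  ultimately have lim: "(\<lambda>m. blinfun_poly (p m) ?B (T w)) \<longlonglongrightarrow> T z" by simp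
  have "norm (blinfun_poly ?p ?B (T z)) \<le> ((2 * \<nu> / (5 * c0)) powr \<nu> * real k powr (- \<nu>)) * norm (T w)"
  proof (rule blinfun_poly_source_le[OF pos_op_normal_op order_refl Ble p(1) _ _ lim])
    fix t assume "0 \<le> t" "t \<le> norm ?B"
    then have t: "0 \<le> t" "t \<le> (norm A)\<^sup>2 / real CARD('n)" using norm_normal_op_le[of A] by auto
    note s = step_arg_bounds[OF c0 L t]
    have pt: "\<bar>poly ?p t\<bar> = (1 - c0 * t) ^ k" using s by (simp add: poly_power mult.commute power_abs)
    show "\<bar>poly ?p t\<bar> \<le> 1" unfolding pt using s by (intro power_le_one) auto
    show "\<bar>poly ?p t\<bar> * t powr \<nu> \<le> (2 * \<nu> / (5 * c0)) powr \<nu> * real k powr (- \<nu>)"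
      unfolding pt by (rule power_mult_powr_le[OF t(1) c0 s(2) \<nu> k])
  qed
  also have "\<dots> \<le> ((2 * \<nu> / (5 * c0)) powr \<nu> * real k powr (- \<nu>)) * norm w"
    by (intro mult_left_mono spectral_cut_norm(1)[OF cut]) auto
  finally have 1: "norm (blinfun_poly ?p ?B (T z)) \<le> rate_const * real k powr (- \<nu>)"
    by (simp add: rate_const_def mult_ac)
  have "?B (z - T z) = 0" unfolding cutB(1) by (simp add: blinfun.diff_right cutB(3))
  then have "blinfun_poly ?p ?B (z - T z) = z - T z" by (simp add: blinfun_poly_kernel poly_power)
  then have 2: "norm (blinfun_poly ?p ?B (z - T z)) \<le> \<gamma>" using g by (simp add: z_def)
  have "x0 - xd = - (T z) - (z - T z)" by (simp add: z_def)
  then have "blinfun_poly ?p ?B (x0 - xd) = - blinfun_poly ?p ?B (T z) - blinfun_poly ?p ?B (z - T z)"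
    by (simp only: blinfun.diff_right blinfun.minus_right)
  then show ?thesis
    using norm_triangle_ineq4[of "- blinfun_poly ?p ?B (T z)" "blinfun_poly ?p ?B (z - T z)"] 1 2 by simp
qed

text \<open>The remainder again satisfies a source condition, now for the part \<open>S\<close> of
  \<open>normal_op Ad\<close> off the cut. Since the norm of \<open>S\<close> is at most
  \<open>\<tau>\<^sup>2 / n\<close>, its power \<open>\<nu>\<close> is at most
  \<open>\<tau> powr (2 * \<nu>)\<close>.\<close>

lemma cut_remainder_le:
  assumes cut: "spectral_cut Ad A T" and \<tau>: "0 < \<tau>" and small: "\<And>x. norm (Ad (x - T x)) \<le> \<tau> * norm x"
  shows "norm ((xd - x0) - T (xd - x0)) \<le> \<tau> powr (2 * \<nu>) * norm w"
proof -
  let ?n = "real CARD('n)" and ?Bd = "normal_op Ad"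
  have n: "1 \<le> ?n" using zero_less_card_finite[where 'a='n] by linarith
  define z where "z = xd - x0"
  obtain p where p: "uniform_limit {0..norm ?Bd} (\<lambda>m. poly (p m)) (\<lambda>t. t powr \<nu>) sequentially"
    "(\<lambda>m. blinfun_poly (p m) ?Bd w) \<longlonglongrightarrow> z" using source_sequence z_def by metis
  define Tc where "Tc = id_blinfun - T"
  have Tc: "Tc x = x - T x" for x by (simp add: Tc_def minus_blinfun.rep_eq)
  define S where "S = ?Bd o\<^sub>L Tc"
  have S: "S x = ?Bd (Tc x)" for x by (simp add: S_def)
  have sym: "Tc x \<bullet> y = x \<bullet> Tc y" for x y
    using cut by (simp add: Tc spectral_cut_def inner_diff_left inner_diff_right)
  have comm: "Tc (?Bd x) = ?Bd (Tc x)" "Tc (Tc x) = Tc x" for x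
    using cut by (simp_all add: Tc spectral_cut_def blinfun.diff_right)
  have Bd: "?Bd x \<bullet> y = x \<bullet> ?Bd y" "0 \<le> ?Bd x \<bullet> x" for x y
    using pos_op_normal_op[of Ad] by (auto simp: pos_op_def)
  have pS: "pos_op S"
    unfolding pos_op_def
  proof (intro conjI allI)
    show "S x \<bullet> y = x \<bullet> S y" for x y by (simp add: S Bd(1) sym comm)
    have "S x \<bullet> x = ?Bd (Tc x) \<bullet> Tc x" for x by (metis S comm sym)
    then show "0 \<le> S x \<bullet> x" for x by (simp add: Bd(2))
  qed
  have Sle: "norm (S x) \<le> \<tau>\<^sup>2 / ?n * norm x" for x
  proof -
    have fixS: "Tc (S x) = S x" by (simp add: S comm)
    have "norm (S x) * norm (S x) = S x \<bullet> S x" by (simp flip: power2_norm_eq_inner power2_eq_square)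
    also have "\<dots> = inverse ?n * (Ad (Tc x) \<bullet> Ad (S x))"
      by (subst S) (simp add: normal_op_apply blinfun_adj_inner')
    also have "\<dots> = inverse ?n * (Ad (Tc x) \<bullet> Ad (Tc (S x)))" by (simp only: fixS)
    also have "\<dots> \<le> inverse ?n * ((\<tau> * norm x) * (\<tau> * norm (S x)))"
      using small[of x] small[of "S x"] \<tau> n
      by (intro mult_left_mono order_trans[OF norm_cauchy_schwarz] mult_mono) (auto simp: Tc)
    finally have "norm (S x) * norm (S x) \<le> norm (S x) * (\<tau>\<^sup>2 / ?n * norm x)"
      by (simp add: power2_eq_square divide_inverse mult_ac)
    then show ?thesis
    proof (cases "S x = 0")
      case False
      then have "0 < norm (S x)" by simp
      then show ?thesis using \<open>norm (S x) * norm (S x) \<le> norm (S x) * (\<tau>\<^sup>2 / ?n * norm x)\<close>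
        by (rule mult_left_le_imp_le[rotated])
    qed simp
  qed
  have Sn: "norm S \<le> \<tau>\<^sup>2 / ?n" by (rule norm_blinfun_bound) (use Sle in auto)
  have SBd: "norm S \<le> norm ?Bd"
  proof (rule norm_blinfun_bound)
    show "norm (S x) \<le> norm ?Bd * norm x" for x
      unfolding S Tc using spectral_cut_norm(2)[OF cut, of x]
      by (intro order_trans[OF norm_blinfun] mult_left_mono) auto
  qed simp
  have "Tc (blinfun_poly (p m) ?Bd w) = blinfun_poly (p m) S (Tc w)" for m
    by (rule blinfun_poly_intertwine[OF bounded_linear.linear[OF blinfun.bounded_linear_right]]) (simp add: S comm)
  moreover have "(\<lambda>m. Tc (blinfun_poly (p m) ?Bd w)) \<longlonglongrightarrow> Tc z"
    by (intro bounded_linear.tendsto[OF blinfun.bounded_linear_right] p)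
  ultimately have lim: "(\<lambda>m. blinfun_poly (p m) S (Tc w)) \<longlonglongrightarrow> Tc z" by simp
  have "norm (blinfun_poly 1 S (Tc z)) \<le> \<tau> powr (2 * \<nu>) * norm (Tc w)"
  proof (rule blinfun_poly_source_le[OF pS order_refl SBd p(1) _ _ lim])
    fix t assume t: "0 \<le> t" "t \<le> norm S"
    then have "t \<le> \<tau>\<^sup>2 / ?n" using Sn by linarith
    also have "\<dots> \<le> \<tau>\<^sup>2" using n by (simp add: divide_le_eq mult_le_cancel_left1)
    finally have "t powr \<nu> \<le> (\<tau>\<^sup>2) powr \<nu>" using t \<nu> by (intro powr_mono2) auto
    also have "(\<tau>\<^sup>2) powr \<nu> = \<tau> powr (2 * \<nu>)" using \<tau> by (simp add: powr_powr[symmetric] powr_realpow)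
    finally show "\<bar>poly 1 t\<bar> * t powr \<nu> \<le> \<tau> powr (2 * \<nu>)" by simp
  qed simp
  also have "\<dots> \<le> \<tau> powr (2 * \<nu>) * norm w"
    unfolding Tc by (intro mult_left_mono spectral_cut_norm(2)[OF cut]) auto
  finally show ?thesis by (simp add: Tc z_def)
qed

lemma svrg_process_svrg:
  assumes cut: "spectral_cut Ad A T" and L: "c0 * max_row_sq A \<le> 1"
  shows "svrg_process A \<xi> c0 M (x0 - xd) (\<lambda>i k. svrg A (yd + \<xi>) c0 M x0 i k - xd)"
proof
  show "M \<ge> 1" "0 < c0" "c0 * max_row_sq A \<le> 1" by (fact M c0 L)+
  show "svrg A (yd + \<xi>) c0 M x0 i 0 - xd = x0 - xd" for i by simp
  fix i :: "nat \<Rightarrow> 'n" and k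
  define x z where "x = svrg A (yd + \<xi>) c0 M x0 i k" and "z = svrg A (yd + \<xi>) c0 M x0 i (k div M * M)"
  \<comment> \<open>The truncated operator need not map \<open>xd\<close> to \<open>yd\<close>; the
    first condition of \<open>spectral_cut\<close> makes the difference vanish after the adjoint, so
    \<open>\<xi>\<close> alone remains.\<close>
  have res: "blinfun_adj A (A z - (yd + \<xi>)) = blinfun_adj A (A (z - xd)) - blinfun_adj A \<xi>"
  proof -
    have "blinfun_adj A yd = blinfun_adj A (A xd)" using cut by (simp add: spectral_cut_def flip: Ad_xd)
    then show ?thesis by (simp add: blinfun.diff_right blinfun.add_right)
  qed
  have dif: "x - xd - (z - xd) = x - z" by simp
  show "svrg A (yd + \<xi>) c0 M x0 i (Suc k) - xd = svrg A (yd + \<xi>) c0 M x0 i k - xd -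
      c0 *\<^sub>R (blinfun_adj (blinfun_row A (i k)) (blinfun_row A (i k)
        (svrg A (yd + \<xi>) c0 M x0 i k - xd - (svrg A (yd + \<xi>) c0 M x0 i (k div M * M) - xd)))
      + normal_op A (svrg A (yd + \<xi>) c0 M x0 i (k div M * M) - xd)
      - inverse (real CARD('n)) *\<^sub>R blinfun_adj A \<xi>)"
    unfolding svrg.simps Let_def x_def[symmetric] z_def[symmetric] normal_op_apply res dif
    by (simp add: algebra_simps)
qed

lemma expectation_svrg:
  assumes P: "prob_space P" "iid_uniform P I"
    and proc: "svrg_process A \<xi> c0 M (x0 - xd) (\<lambda>i k. svrg A (yd + \<xi>) c0 M x0 i k - xd)"
  shows "prob_space.expectation P (\<lambda>\<omega>. (norm (svrg A (yd + \<xi>) c0 M x0 (\<lambda>j. I j \<omega>) k - xd))\<^sup>2)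
    = avg k (\<lambda>i. (norm (svrg A (yd + \<xi>) c0 M x0 i k - xd))\<^sup>2)"
proof (rule expectation_eq_avg[OF P])
  show "determined k (\<lambda>i. (norm (svrg A (yd + \<xi>) c0 M x0 i k - xd))\<^sup>2)"
    using svrg_process.e_determined[OF proc, of k] unfolding determined_def by metis
qed

text \<open>The additional argument \<open>j\<close> of the error measure \<open>G\<close> makes the constant uniform in the index
  sequence.\<close>

definition error_bound :: "('y^'n \<Rightarrow> ('x \<Rightarrow>\<^sub>L ('y^'n)) \<Rightarrow> nat \<Rightarrow> 'j \<Rightarrow> real) \<Rightarrow> (('x \<Rightarrow>\<^sub>L ('y^'n)) \<Rightarrow> real) \<Rightarrow> bool" where
  "error_bound G s \<longleftrightarrow> (\<exists>C\<ge>0. \<forall>\<xi> A T \<gamma> \<Lambda> k j. k \<ge> 1 \<and> spectral_cut Ad A T \<and> norm ((xd - x0) - T (xd - x0)) \<le> \<gamma> \<and>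
     noise_gain A c0 k \<Lambda> \<and> step_size_ok A (s A) c0 \<longrightarrow>
     G \<xi> A k j \<le> C * (real k powr (- \<nu>) + 1 / sqrt (real k) + \<gamma> + \<Lambda> * norm \<xi>))"

lemma error_boundI:
  assumes DF: "0 \<le> D" "0 \<le> F"
    and G: "\<And>\<xi> A k j \<kappa> \<Lambda>. svrg_process A \<xi> c0 M (x0 - xd) (\<lambda>i k. svrg A (yd + \<xi>) c0 M x0 i k - xd) \<Longrightarrow>
      step_size_ok A (s A) c0 \<Longrightarrow>
      (\<And>r y. norm (blinfun_poly ([:1, - c0:] ^ r) (normal_op A) (blinfun_adj A y)) \<le> \<kappa> r * norm y) \<Longrightarrow>
      (\<Sum>r<k. \<kappa> r) \<le> \<Lambda> \<Longrightarrow> (\<And>r. 0 \<le> \<kappa> r) \<Longrightarrow> (\<And>r. \<kappa> r \<le> sqrt (real CARD('n) / c0) / sqrt (real (Suc r))) \<Longrightarrow>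
      G \<xi> A k j \<le> norm (blinfun_poly ([:1, - c0:] ^ k) (normal_op A) (x0 - xd)) + D / sqrt (real (Suc k)) + F * \<Lambda> * norm \<xi>"
  shows "error_bound G s"
  unfolding error_bound_def
proof (intro exI[of _ "1 + rate_const + D + F"] conjI allI impI)
  have r0: "0 \<le> rate_const" by (simp add: rate_const_def)
  show "0 \<le> 1 + rate_const + D + F" using r0 DF by simp
  fix \<xi> :: "'y^'n" and A T \<gamma> \<Lambda> k j
  assume *: "k \<ge> 1 \<and> spectral_cut Ad A T \<and> norm ((xd - x0) - T (xd - x0)) \<le> \<gamma> \<and>
    noise_gain A c0 k \<Lambda> \<and> step_size_ok A (s A) c0"
  then have k: "k \<ge> 1" and cut: "spectral_cut Ad A T" and \<gamma>: "norm ((xd - x0) - T (xd - x0)) \<le> \<gamma>"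
    and step: "step_size_ok A (s A) c0" by auto
  obtain \<kappa> where \<kappa>: "\<And>r y. norm (blinfun_poly ([:1, - c0:] ^ r) (normal_op A) (blinfun_adj A y)) \<le> \<kappa> r * norm y"
    "(\<Sum>r<k. \<kappa> r) \<le> \<Lambda>" "\<And>r. 0 \<le> \<kappa> r" "\<And>r. \<kappa> r \<le> sqrt (real CARD('n) / c0) / sqrt (real (Suc r))"
    using * unfolding noise_gain_def by blast
  have L: "c0 * max_row_sq A \<le> 1" by (rule step_size_L[OF step c0])
  have "G \<xi> A k j \<le> rate_const * real k powr (- \<nu>) + \<gamma> + D / sqrt (real (Suc k)) + F * (\<Lambda> * norm \<xi>)"
    using G[OF svrg_process_svrg[OF cut L] step \<kappa>, of \<xi> j] initial_error_le[OF cut L k \<gamma>]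
    unfolding mult.assoc[of F] by linarith
  also have "\<dots> \<le> (1 + rate_const + D + F) * (real k powr (- \<nu>) + 1 / sqrt (real k) + \<gamma> + \<Lambda> * norm \<xi>)"
  proof (rule combine_error_terms[OF r0 DF])
    show "0 \<le> \<gamma>" using \<gamma> norm_ge_zero order_trans by blast
    have "0 \<le> \<Lambda>" using \<kappa>(2) sum_nonneg[of "{..<k}" \<kappa>] \<kappa>(3) by force
    then show "0 \<le> \<Lambda> * norm \<xi>" by simp
  qed (use k in auto)
  finally show "G \<xi> A k j \<le> (1 + rate_const + D + F) * (real k powr (- \<nu>) + 1 / sqrt (real k) + \<gamma> + \<Lambda> * norm \<xi>)" .
qed

definition "initial_const = sqrt (real CARD('n)) * (real M * sqrt (27 / c0)) * norm (x0 - xd)"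

text \<open>The extra argument has type \<open>unit\<close> because the index sequence has been
  averaged out.\<close>

lemma mean_bound:
  fixes P :: "'w measure" and I :: "nat \<Rightarrow> 'w \<Rightarrow> 'n"
  assumes P: "prob_space P" "iid_uniform P I"
  shows "error_bound (\<lambda>\<xi> A k (_::unit). sqrt (prob_space.expectation P
      (\<lambda>\<omega>. (norm (svrg A (yd + \<xi>) c0 M x0 (\<lambda>j. I j \<omega>) k - xd))\<^sup>2))) (\<lambda>A. step_bound_expectation A M)"
proof -
  obtain E where E: "0 \<le> E" "epoch_const M (12 * real CARD('n)) E"
    using epoch_const_exists[of "12 * real CARD('n)" M] M by auto
  show ?thesis
  proof (rule error_boundI[of "sqrt (18 * c0 * E) * initial_const" "c0 + c0 * sqrt (2 * E)"], goal_cases)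
    case (3 \<xi> A k j \<kappa> \<Lambda>)
    interpret svrg_process A \<xi> c0 M "x0 - xd" "\<lambda>i k. svrg A (yd + \<xi>) c0 M x0 i k - xd" by (rule 3)
    have small: small_mean_step
      unfolding small_mean_step_def by (rule step_bound_expectation_cases[OF 3(2) c0 M])
    show ?case
      unfolding expectation_svrg[OF P 3(1)]
      using mean_error_le[OF E(2,1) small 3(3)[folded R_def] 3(4-6)]
      by (simp add: det_coeff_def initial_const_def R_def)
  qed (use c0 E in \<open>auto simp: initial_const_def\<close>)
qed

lemma path_bound: "error_bound (\<lambda>\<xi> A k i. norm (svrg A (yd + \<xi>) c0 M x0 i k - xd)) (\<lambda>A. step_bound_pathwise A M)"
proof -
  obtain E where E: "0 \<le> E" "epoch_const M (12 * real CARD('n)) E"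
    using epoch_const_exists[of "12 * real CARD('n)" M] M by auto
  show ?thesis
  proof (rule error_boundI[of "18 * c0 * E * initial_const * sqrt (real CARD('n) / c0)" "c0 + 2 * c0 * E"], goal_cases)
    case (3 \<xi> A k j \<kappa> \<Lambda>)
    interpret svrg_process A \<xi> c0 M "x0 - xd" "\<lambda>i k. svrg A (yd + \<xi>) c0 M x0 i k - xd" by (rule 3)
    have small: small_path_step
      unfolding small_path_step_def by (rule step_bound_pathwise_small[OF 3(2) c0 M])
    show ?case
      using path_error_le[OF E(2,1) small 3(3)[folded R_def] 3(4-6)]
      by (simp add: det_coeff_def initial_const_def R_def)
  qed (use c0 E in \<open>auto simp: initial_const_def\<close>)
qed

end

section \<open>Convergence rates\<close>

text \<open>Stated for any \<open>m\<close> up to \<open>min \<nu> (1 / 2)\<close> to cover both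
  thresholds: \<open>k powr (- m)\<close> dominates both decaying terms, and the threshold is the
  point where it reaches the target rate.\<close>

lemma late_index_rates:
  fixes \<nu> m \<delta> :: real
  assumes \<nu>: "0 < \<nu>" and \<delta>: "0 < \<delta>" "\<delta> < 1" and m: "0 < m" "m \<le> \<nu>" "m \<le> 1 / 2"
    and k: "\<delta> powr (- (2 * \<nu> / ((1 + 2 * \<nu>) * m))) \<le> real k"
  shows "k \<ge> 1" "real k powr (- \<nu>) \<le> \<delta> powr (2 * \<nu> / (1 + 2 * \<nu>))"
    "1 / sqrt (real k) \<le> \<delta> powr (2 * \<nu> / (1 + 2 * \<nu>))"
proof -
  have "0 < \<delta> powr (- (2 * \<nu> / ((1 + 2 * \<nu>) * m)))" using \<delta> by simp
  then have "0 < real k" using k by linarith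
  then show k1: "k \<ge> 1" by simp
  have "real k powr (- m) \<le> (\<delta> powr (- (2 * \<nu> / ((1 + 2 * \<nu>) * m)))) powr (- m)"
    using m \<delta> k by (intro powr_mono2') auto
  also have "\<dots> = \<delta> powr (2 * \<nu> / (1 + 2 * \<nu>))" using m by (simp add: powr_powr)
  finally have base: "real k powr (- m) \<le> \<delta> powr (2 * \<nu> / (1 + 2 * \<nu>))" .
  have "real k powr (- \<nu>) \<le> real k powr (- m)" using m k1 by (intro powr_mono) auto
  then show "real k powr (- \<nu>) \<le> \<delta> powr (2 * \<nu> / (1 + 2 * \<nu>))" using base by linarith
  have "1 / sqrt (real k) = real k powr (- (1 / 2))" using k1 by (simp add: powr_minus_divide powr_half_sqrt)
  also have "\<dots> \<le> real k powr (- m)" using m k1 by (intro powr_mono) auto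
  finally show "1 / sqrt (real k) \<le> \<delta> powr (2 * \<nu> / (1 + 2 * \<nu>))" using base by linarith
qed

text \<open>The exponent \<open>b\<close> balances the truncation error
  \<open>\<tau> powr (2 * \<nu>)\<close> against the amplified data noise
  \<open>\<delta> / \<tau>\<close>, because \<open>2 * \<nu> * b = 1 - b\<close>.\<close>

lemma threshold_rates:
  fixes \<nu> a \<delta> b c N :: real
  assumes \<nu>: "0 < \<nu>" and a: "0 < a" and b: "b = inverse (1 + 2 * \<nu>)" and \<delta>: "0 < \<delta>" and c: "0 < c" "0 < N"
  shows "(a * \<delta> powr b) powr (2 * \<nu>) = a powr (2 * \<nu>) * \<delta> powr (2 * \<nu> / (1 + 2 * \<nu>))"
    "sqrt (N / c) * (5 * sqrt (sqrt 27 / (c * ((a * \<delta> powr b)\<^sup>2 / N)))) * \<delta>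
      = 5 * sqrt (N / c) * sqrt (sqrt 27 * N / c) / a * \<delta> powr (2 * \<nu> / (1 + 2 * \<nu>))"
proof -
  have "b * (2 * \<nu>) = 2 * \<nu> / (1 + 2 * \<nu>)" by (simp add: b divide_inverse)
  then show "(a * \<delta> powr b) powr (2 * \<nu>) = a powr (2 * \<nu>) * \<delta> powr (2 * \<nu> / (1 + 2 * \<nu>))"
    using a \<delta> by (simp add: powr_mult powr_powr)
  define t where "t = a * \<delta> powr b"
  have t: "0 < t" using a \<delta> by (simp add: t_def)
  have "1 - b = 2 * \<nu> / (1 + 2 * \<nu>)" using \<nu> by (simp add: b field_simps)
  then have "\<delta> / \<delta> powr b = \<delta> powr (2 * \<nu> / (1 + 2 * \<nu>))" using \<delta> powr_diff[of \<delta> 1 b] by simp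
  moreover have "\<delta> / t = \<delta> / \<delta> powr b / a" by (simp add: t_def mult.commute)
  ultimately have \<delta>t: "\<delta> / t = \<delta> powr (2 * \<nu> / (1 + 2 * \<nu>)) / a" by simp
  have root: "sqrt (sqrt 27 / (c * (t\<^sup>2 / N))) = sqrt (sqrt 27 * N / c) / t"
  proof -
    have "sqrt 27 / (c * (t\<^sup>2 / N)) = sqrt 27 * N / c / t\<^sup>2" by simp
    then show ?thesis using t by (simp only: real_sqrt_divide real_sqrt_abs abs_of_pos)
  qed
  have "sqrt (N / c) * (5 * (sqrt (sqrt 27 * N / c) / t)) * \<delta> = 5 * sqrt (N / c) * sqrt (sqrt 27 * N / c) * (\<delta> / t)"
    by simp
  then show "sqrt (N / c) * (5 * sqrt (sqrt 27 / (c * ((a * \<delta> powr b)\<^sup>2 / N)))) * \<delta>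
      = 5 * sqrt (N / c) * sqrt (sqrt 27 * N / c) / a * \<delta> powr (2 * \<nu> / (1 + 2 * \<nu>))"
    unfolding t_def[symmetric] root \<delta>t by simp
qed

text \<open>This stopping index balances \<open>k powr (- \<nu>)\<close> against
  \<open>sqrt k * \<delta>\<close>. The bound \<open>\<nu> \<le> 1 / 2\<close> makes the gradient
  noise term \<open>1 / sqrt k\<close> no larger than \<open>k powr (- \<nu>)\<close>.\<close>

lemma stopping_index_rates:
  fixes \<nu> \<delta> C1 C2 :: real
  assumes \<nu>: "0 < \<nu>" "\<nu> \<le> 1 / 2" and \<delta>: "0 < \<delta>" and C: "0 < C1" "0 < C2"
    and k: "C1 * \<delta> powr (- (2 / (1 + 2 * \<nu>))) \<le> real k" "real k \<le> C2 * \<delta> powr (- (2 / (1 + 2 * \<nu>)))"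
  shows "k \<ge> 1" "real k powr (- \<nu>) \<le> C1 powr (- \<nu>) * \<delta> powr (2 * \<nu> / (1 + 2 * \<nu>))"
    "1 / sqrt (real k) \<le> C1 powr (- \<nu>) * \<delta> powr (2 * \<nu> / (1 + 2 * \<nu>))"
    "sqrt (real k) * \<delta> \<le> sqrt C2 * \<delta> powr (2 * \<nu> / (1 + 2 * \<nu>))"
proof -
  have pos: "0 < C1 * \<delta> powr (- (2 / (1 + 2 * \<nu>)))" using C \<delta> by simp
  then have "0 < real k" using k(1) by linarith
  then show k1: "k \<ge> 1" by simp
  have "real k powr (- \<nu>) \<le> (C1 * \<delta> powr (- (2 / (1 + 2 * \<nu>)))) powr (- \<nu>)"
    using \<nu> pos k by (intro powr_mono2') auto
  also have "\<dots> = C1 powr (- \<nu>) * \<delta> powr (2 * \<nu> / (1 + 2 * \<nu>))"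
    using C \<delta> by (simp add: powr_mult powr_powr)
  finally show base: "real k powr (- \<nu>) \<le> C1 powr (- \<nu>) * \<delta> powr (2 * \<nu> / (1 + 2 * \<nu>))" .
  have "1 / sqrt (real k) = real k powr (- (1 / 2))" using k1 by (simp add: powr_minus_divide powr_half_sqrt)
  also have "\<dots> \<le> real k powr (- \<nu>)" using \<nu> k1 by (intro powr_mono) auto
  finally show "1 / sqrt (real k) \<le> C1 powr (- \<nu>) * \<delta> powr (2 * \<nu> / (1 + 2 * \<nu>))" using base by linarith
  have "sqrt (real k) \<le> sqrt C2 * sqrt (\<delta> powr (- (2 / (1 + 2 * \<nu>))))"
    using k(2) by (simp flip: real_sqrt_mult)
  also have "sqrt (\<delta> powr (- (2 / (1 + 2 * \<nu>)))) = \<delta> powr (- (1 / (1 + 2 * \<nu>)))"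
  proof -
    have "sqrt (\<delta> powr (- (2 / (1 + 2 * \<nu>)))) = \<delta> powr (- (2 / (1 + 2 * \<nu>)) * (1 / 2))"
      by (simp only: powr_half_sqrt[symmetric] powr_ge_zero powr_powr)
    also have "- (2 / (1 + 2 * \<nu>)) * (1 / 2) = - (1 / (1 + 2 * \<nu>))" using \<nu> by (simp add: field_simps)
    finally show ?thesis .
  qed
  finally have "sqrt (real k) * \<delta> \<le> sqrt C2 * \<delta> powr (- (1 / (1 + 2 * \<nu>))) * \<delta>"
    using \<delta> by (intro mult_right_mono) auto
  also have "\<dots> = sqrt C2 * \<delta> powr (- (1 / (1 + 2 * \<nu>)) + 1)"
    using \<delta> by (simp only: powr_add powr_one less_imp_le mult.assoc)
  also have "- (1 / (1 + 2 * \<nu>)) + 1 = 2 * \<nu> / (1 + 2 * \<nu>)" using \<nu> by (simp add: field_simps)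
  finally show "sqrt (real k) * \<delta> \<le> sqrt C2 * \<delta> powr (2 * \<nu> / (1 + 2 * \<nu>))" .
qed

context source_data
begin

lemma truncated_data:
  assumes tr: "truncation_rule Ad a b \<delta> A" and a: "0 < a" and \<delta>: "0 < \<delta>" and L: "c0 * max_row_sq A \<le> 1"
  obtains T where "spectral_cut Ad A T"
    "norm ((xd - x0) - T (xd - x0)) \<le> (a * \<delta> powr b) powr (2 * \<nu>) * norm w"
    "noise_gain A c0 k (sqrt (real CARD('n) / c0) * (5 * sqrt (sqrt 27 / (c0 * ((a * \<delta> powr b)\<^sup>2 / real CARD('n))))))"
proof -
  have "a \<noteq> 0" using a by simp
  then obtain T where T: "spectral_cut Ad A T" "\<And>x. norm (Ad (x - T x)) \<le> a * \<delta> powr b * norm x"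
    "\<And>x. (a * \<delta> powr b)\<^sup>2 / real CARD('n) * norm (T x) \<le> norm (normal_op A (T x))"
    using truncation_spectral_cut[OF tr] by metis
  have t: "0 < a * \<delta> powr b" using a \<delta> by simp
  have t2: "0 < (a * \<delta> powr b)\<^sup>2 / real CARD('n)" using t by (intro divide_pos_pos zero_less_power) auto
  show thesis
  proof (rule that[OF T(1) cut_remainder_le[OF T(1) t T(2)]])
    show "noise_gain A c0 k (sqrt (real CARD('n) / c0) * (5 * sqrt (sqrt 27 / (c0 * ((a * \<delta> powr b)\<^sup>2 / real CARD('n))))))"
      by (rule noise_gain_cut[OF c0 L T(1) t2 T(3)])
  qed
qed

lemma truncated_rhs_le:
  assumes a: "0 < a" and b: "b = inverse (1 + 2 * \<nu>)" and \<delta>: "0 < \<delta>" "\<delta> < 1" and m: "0 < m" "m \<le> \<nu>" "m \<le> 1 / 2"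
    and k: "\<delta> powr (- (2 * \<nu> / ((1 + 2 * \<nu>) * m))) \<le> real k" and C: "0 \<le> C"
  shows "C * (real k powr (- \<nu>) + 1 / sqrt (real k) + (a * \<delta> powr b) powr (2 * \<nu>) * norm w
      + sqrt (real CARD('n) / c0) * (5 * sqrt (sqrt 27 / (c0 * ((a * \<delta> powr b)\<^sup>2 / real CARD('n))))) * \<delta>)
    \<le> C * (2 + a powr (2 * \<nu>) * norm w + 5 * sqrt (real CARD('n) / c0) * sqrt (sqrt 27 * real CARD('n) / c0) / a)
      * \<delta> powr (2 * \<nu> / (1 + 2 * \<nu>))"
proof -
  have n: "0 < real CARD('n)" by simp
  show ?thesis
    unfolding threshold_rates[OF \<nu> a b \<delta>(1) c0 n] mult.assoc[of C]
    using late_index_rates[OF \<nu> \<delta> m k] by (intro mult_left_mono C) (simp add: algebra_simps)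
qed

lemma truncated_rate:
  assumes G: "error_bound G s" and a: "0 < a" and b: "b = inverse (1 + 2 * \<nu>)"
    and m: "0 < m" "m \<le> \<nu>" "m \<le> 1 / 2"
  shows "\<exists>C. \<forall>\<xi> \<delta> A k j. \<delta> = norm \<xi> \<and> 0 < \<delta> \<and> \<delta> < 1 \<and> truncation_rule Ad a b \<delta> A \<and> step_size_ok A (s A) c0 \<and>
    real k \<ge> \<delta> powr (- (2 * \<nu> / ((1 + 2 * \<nu>) * m))) \<longrightarrow> G \<xi> A k j \<le> C * \<delta> powr (2 * \<nu> / (1 + 2 * \<nu>))"
proof -
  obtain C where C: "0 \<le> C" and bound: "\<And>\<xi> A T \<gamma> \<Lambda> k j. k \<ge> 1 \<Longrightarrow> spectral_cut Ad A T \<Longrightarrow>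
     norm ((xd - x0) - T (xd - x0)) \<le> \<gamma> \<Longrightarrow> noise_gain A c0 k \<Lambda> \<Longrightarrow> step_size_ok A (s A) c0 \<Longrightarrow>
     G \<xi> A k j \<le> C * (real k powr (- \<nu>) + 1 / sqrt (real k) + \<gamma> + \<Lambda> * norm \<xi>)"
    using G unfolding error_bound_def by blast
  show ?thesis
  proof (intro exI allI impI, elim conjE)
    fix \<xi> :: "'y^'n" and \<delta> A k j
    assume "\<delta> = norm \<xi>" and \<delta>: "0 < \<delta>" "\<delta> < 1" and tr: "truncation_rule Ad a b \<delta> A"
      and step: "step_size_ok A (s A) c0" and k: "\<delta> powr (- (2 * \<nu> / ((1 + 2 * \<nu>) * m))) \<le> real k"
    have L: "c0 * max_row_sq A \<le> 1" by (rule step_size_L[OF step c0])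
    obtain T where T: "spectral_cut Ad A T"
      "norm ((xd - x0) - T (xd - x0)) \<le> (a * \<delta> powr b) powr (2 * \<nu>) * norm w"
      "noise_gain A c0 k (sqrt (real CARD('n) / c0) * (5 * sqrt (sqrt 27 / (c0 * ((a * \<delta> powr b)\<^sup>2 / real CARD('n))))))"
      by (rule truncated_data[OF tr a \<delta>(1) L])
    show "G \<xi> A k j \<le> C * (2 + a powr (2 * \<nu>) * norm w
        + 5 * sqrt (real CARD('n) / c0) * sqrt (sqrt 27 * real CARD('n) / c0) / a) * \<delta> powr (2 * \<nu> / (1 + 2 * \<nu>))"
      using bound[OF late_index_rates(1)[OF \<nu> \<delta> m k] T step, of \<xi> j] truncated_rhs_le[OF a b \<delta> m k C]
      unfolding \<open>\<delta> = norm \<xi>\<close>[symmetric] by (rule order_trans)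
  qed
qed

lemma stopped_rhs_le:
  assumes \<nu>2: "\<nu> \<le> 1 / 2" and \<delta>: "0 < \<delta>" and C12: "0 < C1" "0 < C2"
    and k: "C1 * \<delta> powr (- (2 / (1 + 2 * \<nu>))) \<le> real k" "real k \<le> C2 * \<delta> powr (- (2 / (1 + 2 * \<nu>)))"
    and C: "0 \<le> C"
  shows "C * (real k powr (- \<nu>) + 1 / sqrt (real k) + 0 + sqrt (real CARD('n) / c0) * (2 * sqrt (real k)) * \<delta>)
    \<le> C * (2 * C1 powr (- \<nu>) + 2 * sqrt (real CARD('n) / c0) * sqrt C2) * \<delta> powr (2 * \<nu> / (1 + 2 * \<nu>))"
proof -
  note r = stopping_index_rates[OF \<nu> \<nu>2 \<delta> C12 k]
  have "2 * sqrt (real CARD('n) / c0) * (sqrt (real k) * \<delta>)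
      \<le> 2 * sqrt (real CARD('n) / c0) * (sqrt C2 * \<delta> powr (2 * \<nu> / (1 + 2 * \<nu>)))"
    using c0 by (intro mult_left_mono r(4)) auto
  then show ?thesis
    unfolding mult.assoc[of C] using r(2,3) by (intro mult_left_mono C) (simp add: algebra_simps)
qed

lemma stopped_rate:
  assumes G: "error_bound G s" and \<nu>2: "\<nu> \<le> 1 / 2" and C12: "0 < C1" "0 < C2"
    and kstop: "\<And>\<delta>. 0 < \<delta> \<Longrightarrow> \<delta> \<le> \<delta>0 \<Longrightarrow> C1 * \<delta> powr (- (2 / (1 + 2 * \<nu>))) \<le> real (kstop \<delta>) \<and>
      real (kstop \<delta>) \<le> C2 * \<delta> powr (- (2 / (1 + 2 * \<nu>)))"
  shows "\<exists>C. \<forall>\<xi> \<delta> A j. \<delta> = norm \<xi> \<and> 0 < \<delta> \<and> \<delta> \<le> \<delta>0 \<and> truncation_rule Ad 0 b \<delta> A \<and> step_size_ok A (s A) c0 \<longrightarrow>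
    G \<xi> A (kstop \<delta>) j \<le> C * \<delta> powr (2 * \<nu> / (1 + 2 * \<nu>))"
proof -
  obtain C where C: "0 \<le> C" and bound: "\<And>\<xi> A T \<gamma> \<Lambda> k j. k \<ge> 1 \<Longrightarrow> spectral_cut Ad A T \<Longrightarrow>
     norm ((xd - x0) - T (xd - x0)) \<le> \<gamma> \<Longrightarrow> noise_gain A c0 k \<Lambda> \<Longrightarrow> step_size_ok A (s A) c0 \<Longrightarrow>
     G \<xi> A k j \<le> C * (real k powr (- \<nu>) + 1 / sqrt (real k) + \<gamma> + \<Lambda> * norm \<xi>)"
    using G unfolding error_bound_def by blast
  show ?thesis
  proof (intro exI allI impI, elim conjE)
    fix \<xi> :: "'y^'n" and \<delta> A j
    assume "\<delta> = norm \<xi>" and \<delta>: "0 < \<delta>" "\<delta> \<le> \<delta>0" and "truncation_rule Ad 0 b \<delta> A" and step: "step_size_ok A (s A) c0"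
    then have A: "A = Ad" by (simp add: truncation_rule_def)
    note k = conjunct1[OF kstop[OF \<delta>]] conjunct2[OF kstop[OF \<delta>]]
    have L: "c0 * max_row_sq A \<le> 1" by (rule step_size_L[OF step c0])
    have g: "norm ((xd - x0) - id_blinfun (xd - x0)) \<le> 0" by simp
    have cut: "spectral_cut Ad A id_blinfun" unfolding A by (rule spectral_cut_id)
    show "G \<xi> A (kstop \<delta>) j
      \<le> C * (2 * C1 powr (- \<nu>) + 2 * sqrt (real CARD('n) / c0) * sqrt C2) * \<delta> powr (2 * \<nu> / (1 + 2 * \<nu>))"
      using bound[OF stopping_index_rates(1)[OF \<nu> \<nu>2 \<delta>(1) C12 k] cut g noise_gain_sqrt[OF c0 L] step, of \<xi> j]
        stopped_rhs_le[OF \<nu>2 \<delta>(1) C12 k C]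
      unfolding \<open>\<delta> = norm \<xi>\<close>[symmetric] by (rule order_trans)
  qed
qed

end

theorem corollary2p1:
  fixes Ys :: "'n::finite \<Rightarrow> 'y::{real_inner,banach} set"
    and Ad :: "'x::{real_inner,banach} \<Rightarrow>\<^sub>L ('y^'n)"
    and x0 xd w :: 'x
    and yd :: "'y^'n"
    and P :: "'w measure"
    and I :: "nat \<Rightarrow> 'w \<Rightarrow> 'n"
    and M :: nat
    and c0 \<nu> a b :: real
  assumes Ys: "\<And>i. subspace (Ys i) \<and> closed (Ys i)"
    and Ad: "range (blinfun_apply Ad) \<subseteq> hilbert_prod Ys"
    and yd: "yd \<in> range (blinfun_apply Ad)"
    and xd: "is_arg_min (\<lambda>x. norm (x - x0)) (\<lambda>x. blinfun_apply Ad x = yd) xd"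
    and P: "prob_space P"
    and I: "iid_uniform P I"
    and M: "M \<ge> 1"
    and c0: "c0 > 0"
    and \<nu>: "\<nu> > 0"
    and w: "w \<in> (null_space Ad)\<^sup>\<bottom>"
    and source: "xd - x0 = blinfun_apply (blinfun_powr (normal_op Ad) \<nu>) w"
    and a: "a \<ge> 0"
    and b: "b = inverse (1 + 2 * \<nu>)"
  shows
    "(a > 0 \<longrightarrow>
       (\<exists>C. \<forall>\<xi> \<delta> A k. \<xi> \<in> hilbert_prod Ys \<and> \<delta> = norm \<xi> \<and> 0 < \<delta> \<and> \<delta> < 1 \<and>
          truncation_rule Ad a b \<delta> A \<and> step_size_ok A (step_bound_expectation A M) c0 \<and>
          real k \<ge> \<delta> powr (- (2 * \<nu> / ((1 + 2 * \<nu>) * min \<nu> (1 / 2)))) \<longrightarrow>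
          sqrt (prob_space.expectation P
            (\<lambda>\<omega>. (norm (svrg A (yd + \<xi>) c0 M x0 (\<lambda>j. I j \<omega>) k - xd))\<^sup>2))
            \<le> C * \<delta> powr (2 * \<nu> / (1 + 2 * \<nu>))) \<and>
       (\<forall>\<epsilon>. 0 < \<epsilon> \<and> \<epsilon> < 1 / 2 \<longrightarrow>
         (\<exists>C. \<forall>\<xi> \<delta> A k i. \<xi> \<in> hilbert_prod Ys \<and> \<delta> = norm \<xi> \<and> 0 < \<delta> \<and> \<delta> < 1 \<and>
            truncation_rule Ad a b \<delta> A \<and> step_size_ok A (step_bound_pathwise A M) c0 \<and>
            real k \<ge> \<delta> powr (- (2 * \<nu> / ((1 + 2 * \<nu>) * min \<nu> (1 / 2 - \<epsilon>)))) \<longrightarrow>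
            norm (svrg A (yd + \<xi>) c0 M x0 i k - xd) \<le> C * \<delta> powr (2 * \<nu> / (1 + 2 * \<nu>))))) \<and>
     (a = 0 \<longrightarrow>
       (\<forall>(kstop :: real \<Rightarrow> nat) C1 C2 \<delta>0. 0 < C1 \<and> C1 < C2 \<and> 0 < \<delta>0 \<and>
          (\<forall>\<delta>. 0 < \<delta> \<and> \<delta> \<le> \<delta>0 \<longrightarrow>
             C1 * \<delta> powr (- (2 / (1 + 2 * \<nu>))) \<le> real (kstop \<delta>) \<and>
             real (kstop \<delta>) \<le> C2 * \<delta> powr (- (2 / (1 + 2 * \<nu>)))) \<longrightarrow>
          (\<nu> \<le> 1 / 2 \<longrightarrow>
            (\<exists>C. \<forall>\<xi> \<delta> A. \<xi> \<in> hilbert_prod Ys \<and> \<delta> = norm \<xi> \<and> 0 < \<delta> \<and> \<delta> < 1 \<and> \<delta> \<le> \<delta>0 \<and>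
               truncation_rule Ad a b \<delta> A \<and> step_size_ok A (step_bound_expectation A M) c0 \<longrightarrow>
               sqrt (prob_space.expectation P
                 (\<lambda>\<omega>. (norm (svrg A (yd + \<xi>) c0 M x0 (\<lambda>j. I j \<omega>) (kstop \<delta>) - xd))\<^sup>2))
                 \<le> C * \<delta> powr (2 * \<nu> / (1 + 2 * \<nu>)))) \<and>
          (\<nu> < 1 / 2 \<longrightarrow>
            (\<exists>C. \<forall>\<xi> \<delta> A i. \<xi> \<in> hilbert_prod Ys \<and> \<delta> = norm \<xi> \<and> 0 < \<delta> \<and> \<delta> < 1 \<and> \<delta> \<le> \<delta>0 \<and>
               truncation_rule Ad a b \<delta> A \<and> step_size_ok A (step_bound_pathwise A M) c0 \<longrightarrow>
               norm (svrg A (yd + \<xi>) c0 M x0 i (kstop \<delta>) - xd)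
                 \<le> C * \<delta> powr (2 * \<nu> / (1 + 2 * \<nu>))))))"
proof -
  interpret source_data Ad x0 xd w yd M c0 \<nu>
    by unfold_locales (use xd M c0 \<nu> source in \<open>auto simp: is_arg_min_def\<close>)
  show ?thesis
  proof (intro conjI impI allI, goal_cases)
    case 1
    have "0 < min \<nu> (1 / 2)" "min \<nu> (1 / 2) \<le> \<nu>" "min \<nu> (1 / 2) \<le> 1 / 2" using \<nu> by auto
    from truncated_rate[OF mean_bound[OF P I] 1 b this] show ?case by blast
  next
    case (2 \<epsilon>)
    have "0 < min \<nu> (1 / 2 - \<epsilon>)" "min \<nu> (1 / 2 - \<epsilon>) \<le> \<nu>" "min \<nu> (1 / 2 - \<epsilon>) \<le> 1 / 2"
      using \<nu> 2 by (auto simp: min_def)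
    from truncated_rate[OF path_bound 2(1) b this] show ?case by blast
  next
    case (3 kstop C1 C2 \<delta>0)
    then have "0 < C1" "0 < C2" by auto
    from stopped_rate[OF mean_bound[OF P I] 3(3) this, of \<delta>0 kstop b] 3 show ?case by blast
  next
    case (4 kstop C1 C2 \<delta>0)
    then have "0 < C1" "0 < C2" "\<nu> \<le> 1 / 2" by auto
    from stopped_rate[OF path_bound this(3,1,2), of \<delta>0 kstop b] 4 show ?case by blast
  qed
qed

end
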